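(* Let $n,k$ be positive integers, let $\mathcal B$ be a unital C*-algebra, let $\mathcal S\subseteq\mathcal B$ be an operator subsystem, and let $C^*\{\mathcal S\}$ be the C*-subalgebra of $\mathcal B$ generated by $\mathcal S$. Assume that $\mathcal S$ is a unitary operator subsystem of $C^*\{\mathcal S\}$. Then $\mathcal S$ has the complete C*TR$(n,k)$-property in $\mathcal B$ if and only if $C^*\{\mathcal S\}$ has the complete TR$(n,k)$-property in $\mathcal B$.
   Context: An operator subsystem of a unital C*-algebra $\mathcal B$ is a $*$-closed subspace containing the unit of $\mathcal B$. For self-adjoint $a_1,a_2$, $a_1<a_2$ means $a_2-a_1\ge\delta1$ for some scalar $\delta>0$. For a unital C*-subalgebra $\mathcal A\subseteq\mathcal B$ (same unit), $\mathcal A$ has the TR$(n,k)$-property in $\mathcal B$ if for all self-adjoint $x_1,\dots,x_n,y_1,\dots,y_k\in\mathcal A$: whenever there is a self-adjoint $b\in\mathcal B$ with $x_i<b<y_j$ for all $i\le n$, $j\le k$, there is a self-adjoint $a\in\mathcal A$ with $x_i<a<y_j$ for all $i\le n$, $j\le k$. It has the complete TR$(n,k)$-property if $M_m(\mathcal A)$ has the TR$(n,k)$-property in $M_m(\mathcal B)$ for every positive integer $m$. An operator subsystem $\mathcal S\subseteq\mathcal B$ has the C*TR$(n,k)$-property in $\mathcal B$ if for all self-adjoint $x_1,\dots,x_n,y_1,\dots,y_k\in\mathcal S$: whenever there is a self-adjoint $b\in\mathcal B$ with $x_i<b<y_j$ for all $i,j$, there is a self-adjoint $a\in C^*\{\mathcal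 S\}$ with $x_i<a<y_j$ for all $i,j$. It has the complete C*TR$(n,k)$-property in $\mathcal B$ if $M_m(\mathcal S)\subset M_m(\mathcal B)$ has the C*TR$(n,k)$-property for every positive integer $m$. An operator subsystem $\mathcal S$ of a unital C*-algebra $\mathcal A$ is called unitary if the unitaries of $\mathcal A$ that belong to $\mathcal S$ generate $\mathcal A$ as a C*-algebra. *)

theory Defs
  imports "HOL-Analysis.Abstract_Metric_Spaces" "HOL-Algebra.Module"
    "HOL-Algebra.Algebraic_Closure_Type"
begin

section \<open>Unital C*-algebras\<close>

text \<open>A C*-algebra is a carrier-based structure, so that the matrix algebras over it, for
  all sizes, are again structures of the same kind and every notion below can be applied to
  them without change.\<close>

abbreviation complex_ring :: "complex ring"
  where "complex_ring \<equiv> ring_of_type_algebra"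

record 'a cstar = "(complex, 'a) module" +
  adj :: "'a \<Rightarrow> 'a"
  cnorm :: "'a \<Rightarrow> real"

text \<open>The value off the carrier is set to 0 because the library's locale
  \<^locale>\<open>Metric_space\<close> wants nonnegativity and symmetry on the whole type.\<close>

definition cdist :: "('a, 'b) cstar_scheme \<Rightarrow> 'a \<Rightarrow> 'a \<Rightarrow> real"
  where "cdist A x y =
    (if x \<in> carrier A \<and> y \<in> carrier A then cnorm A (x \<ominus>\<^bsub>A\<^esub> y) else 0)"

text \<open>The zero algebra is not excluded; \<open>\<parallel>1\<parallel> = 1\<close> follows from the axioms in all other cases.\<close>

locale unital_cstar_algebra = module complex_ring A + ring A
    for A :: "('a, 'b) cstar_scheme" (structure) +
  assumes smult_mult_left:
      "\<lbrakk>x \<in> carrier A; y \<in> carrier A\<rbrakk> \<Longrightarrow> (c \<odot>\<^bsub>A\<^esub> x) \<otimes>\<^bsub>A\<^esub> y = c \<odot>\<^bsub>A\<^esub> (x \<otimes>\<^bsub>A\<^esub> y)"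
    and smult_mult_right:
      "\<lbrakk>x \<in> carrier A; y \<in> carrier A\<rbrakk> \<Longrightarrow> x \<otimes>\<^bsub>A\<^esub> (c \<odot>\<^bsub>A\<^esub> y) = c \<odot>\<^bsub>A\<^esub> (x \<otimes>\<^bsub>A\<^esub> y)"
    and adj_closed: "x \<in> carrier A \<Longrightarrow> adj A x \<in> carrier A"
    and adj_adj: "x \<in> carrier A \<Longrightarrow> adj A (adj A x) = x"
    and adj_add:
      "\<lbrakk>x \<in> carrier A; y \<in> carrier A\<rbrakk> \<Longrightarrow> adj A (x \<oplus>\<^bsub>A\<^esub> y) = adj A x \<oplus>\<^bsub>A\<^esub> adj A y"
    and adj_smult: "x \<in> carrier A \<Longrightarrow> adj A (c \<odot>\<^bsub>A\<^esub> x) = cnj c \<odot>\<^bsub>A\<^esub> adj A x"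
    and adj_mult:
      "\<lbrakk>x \<in> carrier A; y \<in> carrier A\<rbrakk> \<Longrightarrow> adj A (x \<otimes>\<^bsub>A\<^esub> y) = adj A y \<otimes>\<^bsub>A\<^esub> adj A x"
    and cnorm_eq_zero: "x \<in> carrier A \<Longrightarrow> cnorm A x = 0 \<longleftrightarrow> x = \<zero>\<^bsub>A\<^esub>"
    and cnorm_triangle:
      "\<lbrakk>x \<in> carrier A; y \<in> carrier A\<rbrakk> \<Longrightarrow> cnorm A (x \<oplus>\<^bsub>A\<^esub> y) \<le> cnorm A x + cnorm A y"
    and cnorm_smult: "x \<in> carrier A \<Longrightarrow> cnorm A (c \<odot>\<^bsub>A\<^esub> x) = cmod c * cnorm A x"
    and cnorm_mult:
      "\<lbrakk>x \<in> carrier A; y \<in> carrier A\<rbrakk> \<Longrightarrow> cnorm A (x \<otimes>\<^bsub>A\<^esub> y) \<le> cnorm A x * cnorm A y"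
    and cstar_identity: "x \<in> carrier A \<Longrightarrow> cnorm A (adj A x \<otimes>\<^bsub>A\<^esub> x) = (cnorm A x)\<^sup>2"
    and complete: "Metric_space.mcomplete (carrier A) (cdist A)"

definition self_adjoint :: "('a, 'b) cstar_scheme \<Rightarrow> 'a set"
  where "self_adjoint A = {x \<in> carrier A. adj A x = x}"

definition unitaries :: "('a, 'b) cstar_scheme \<Rightarrow> 'a set"
  where "unitaries A =
    {u \<in> carrier A. adj A u \<otimes>\<^bsub>A\<^esub> u = \<one>\<^bsub>A\<^esub> \<and> u \<otimes>\<^bsub>A\<^esub> adj A u = \<one>\<^bsub>A\<^esub>}"

definition cstar_spectrum :: "('a, 'b) cstar_scheme \<Rightarrow> 'a \<Rightarrow> complex set"
  where "cstar_spectrum A x = {z. (z \<odot>\<^bsub>A\<^esub> \<one>\<^bsub>A\<^esub>) \<ominus>\<^bsub>A\<^esub> x \<notin> Units A}"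

definition cstar_positive :: "('a, 'b) cstar_scheme \<Rightarrow> 'a set"
  where "cstar_positive A = {x \<in> self_adjoint A. cstar_spectrum A x \<subseteq> complex_of_real ` {0..}}"

definition strictly_below :: "('a, 'b) cstar_scheme \<Rightarrow> 'a \<Rightarrow> 'a \<Rightarrow> bool"
  where "strictly_below A x y \<longleftrightarrow>
    (\<exists>\<delta>>0. (y \<ominus>\<^bsub>A\<^esub> x) \<ominus>\<^bsub>A\<^esub> (complex_of_real \<delta> \<odot>\<^bsub>A\<^esub> \<one>\<^bsub>A\<^esub>) \<in> cstar_positive A)"


section \<open>Subalgebras and operator subsystems\<close>

definition cstar_subalgebra :: "('a, 'b) cstar_scheme \<Rightarrow> 'a set \<Rightarrow> bool"
  where "cstar_subalgebra B A \<longleftrightarrow>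
    submodule A complex_ring B \<and>
    (\<forall>x\<in>A. \<forall>y\<in>A. x \<otimes>\<^bsub>B\<^esub> y \<in> A) \<and>
    (\<forall>x\<in>A. adj B x \<in> A) \<and>
    closedin (Metric_space.mtopology (carrier B) (cdist B)) A"

definition cstar_generated :: "('a, 'b) cstar_scheme \<Rightarrow> 'a set \<Rightarrow> 'a set"
  where "cstar_generated B E = \<Inter>{A. cstar_subalgebra B A \<and> E \<subseteq> A}"

definition operator_subsystem :: "('a, 'b) cstar_scheme \<Rightarrow> 'a set \<Rightarrow> bool"
  where "operator_subsystem B S \<longleftrightarrow>
    submodule S complex_ring B \<and> (\<forall>x\<in>S. adj B x \<in> S) \<and> \<one>\<^bsub>B\<^esub> \<in> S"

definition unitary_operator_subsystem :: "('a, 'b) cstar_scheme \<Rightarrow> 'a set \<Rightarrow> bool"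
  where "unitary_operator_subsystem A S \<longleftrightarrow>
    operator_subsystem A S \<and> cstar_generated A (unitaries A \<inter> S) = carrier A"


section \<open>Matrix algebras\<close>

definition mats :: "nat \<Rightarrow> 'a set \<Rightarrow> (nat \<times> nat \<Rightarrow> 'a) set"
  where "mats m E = ({..<m} \<times> {..<m}) \<rightarrow>\<^sub>E E"

definition column_norm :: "nat \<Rightarrow> ('a, 'b) cstar_scheme \<Rightarrow> (nat \<Rightarrow> 'a) \<Rightarrow> real"
  where "column_norm m A v = sqrt (cnorm A (\<Oplus>\<^bsub>A\<^esub>i\<in>{..<m}. adj A (v i) \<otimes>\<^bsub>A\<^esub> v i))"

text \<open>The C*-norm of \<open>M\<^sub>m(A)\<close>: the operator norm for the action of \<open>M\<^sub>m(A)\<close> on the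
  Hilbert \<open>A\<close>-module \<open>A\<^sup>m\<close> of columns, whose inner product is
  \<open>\<langle>v, w\<rangle> = \<Sum>\<^sub>i v\<^sub>i\<^sup>* w\<^sub>i\<close>.\<close>

definition matrix_norm :: "nat \<Rightarrow> ('a, 'b) cstar_scheme \<Rightarrow> (nat \<times> nat \<Rightarrow> 'a) \<Rightarrow> real"
  where "matrix_norm m A x =
    Sup {column_norm m A (\<lambda>i\<in>{..<m}. \<Oplus>\<^bsub>A\<^esub>j\<in>{..<m}. x (i, j) \<otimes>\<^bsub>A\<^esub> v j) | v.
      v \<in> {..<m} \<rightarrow>\<^sub>E carrier A \<and> column_norm m A v \<le> 1}"

definition matrix_algebra ::
    "nat \<Rightarrow> ('a, 'b) cstar_scheme \<Rightarrow> (nat \<times> nat \<Rightarrow> 'a) cstar"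
  where "matrix_algebra m A =
    \<lparr>carrier = mats m (carrier A),
     monoid.mult = (\<lambda>x y. \<lambda>(i, j)\<in>{..<m} \<times> {..<m}. \<Oplus>\<^bsub>A\<^esub>l\<in>{..<m}. x (i, l) \<otimes>\<^bsub>A\<^esub> y (l, j)),
     one = (\<lambda>(i, j)\<in>{..<m} \<times> {..<m}. if i = j then \<one>\<^bsub>A\<^esub> else \<zero>\<^bsub>A\<^esub>),
     ring.zero = (\<lambda>_\<in>{..<m} \<times> {..<m}. \<zero>\<^bsub>A\<^esub>),
     add = (\<lambda>x y. \<lambda>p\<in>{..<m} \<times> {..<m}. x p \<oplus>\<^bsub>A\<^esub> y p),
     module.smult = (\<lambda>c x. \<lambda>p\<in>{..<m} \<times> {..<m}. c \<odot>\<^bsub>A\<^esub> x p),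
     adj = (\<lambda>x. \<lambda>(i, j)\<in>{..<m} \<times> {..<m}. adj A (x (j, i))),
     cnorm = matrix_norm m A\<rparr>"


section \<open>Tight Riesz properties\<close>

text \<open>Given \<open>n\<close> lower and \<open>k\<close> upper bounds from \<open>E\<close> that can be interpolated in \<open>B\<close>, they
  can be interpolated in \<open>F\<close>. The order is that of \<open>B\<close> throughout.\<close>

definition interpolates ::
    "nat \<Rightarrow> nat \<Rightarrow> ('a, 'b) cstar_scheme \<Rightarrow> 'a set \<Rightarrow> 'a set \<Rightarrow> bool"
  where "interpolates n k B E F \<longleftrightarrow>
    (\<forall>x y :: nat \<Rightarrow> 'a.
      (\<forall>i\<in>{1..n}. x i \<in> E \<inter> self_adjoint B) \<longrightarrow>
      (\<forall>j\<in>{1..k}. y j \<in> E \<inter> self_adjoint B) \<longrightarrow>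
      (\<exists>b\<in>self_adjoint B. \<forall>i\<in>{1..n}. \<forall>j\<in>{1..k}.
        strictly_below B (x i) b \<and> strictly_below B b (y j)) \<longrightarrow>
      (\<exists>a\<in>F \<inter> self_adjoint B. \<forall>i\<in>{1..n}. \<forall>j\<in>{1..k}.
        strictly_below B (x i) a \<and> strictly_below B a (y j)))"

text \<open>\<open>TR\<close> is meant for unital C*-subalgebras \<open>A\<close>, \<open>CTR\<close> for operator subsystems \<open>S\<close>.\<close>

definition TR :: "nat \<Rightarrow> nat \<Rightarrow> ('a, 'b) cstar_scheme \<Rightarrow> 'a set \<Rightarrow> bool"
  where "TR n k B A \<longleftrightarrow> interpolates n k B A A"

definition complete_TR :: "nat \<Rightarrow> nat \<Rightarrow> ('a, 'b) cstar_scheme \<Rightarrow> 'a set \<Rightarrow> bool"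
  where "complete_TR n k B A \<longleftrightarrow> (\<forall>m\<ge>1. TR n k (matrix_algebra m B) (mats m A))"

definition CTR :: "nat \<Rightarrow> nat \<Rightarrow> ('a, 'b) cstar_scheme \<Rightarrow> 'a set \<Rightarrow> bool"
  where "CTR n k B S \<longleftrightarrow> interpolates n k B S (cstar_generated B S)"

definition complete_CTR :: "nat \<Rightarrow> nat \<Rightarrow> ('a, 'b) cstar_scheme \<Rightarrow> 'a set \<Rightarrow> bool"
  where "complete_CTR n k B S \<longleftrightarrow> (\<forall>m\<ge>1. CTR n k (matrix_algebra m B) (mats m S))"

end

theory Submission
  imports Defs
begin

text \<open>Let \<open>A = C\<^sup>*{S}\<close>. If \<open>u \<in> S\<close> is unitary and interpolation into \<open>A\<close> is possible for all matrices
  over an operator system \<open>T\<close> with \<open>S \<subseteq> T \<subseteq> A\<close>, then also for all matrices over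
  \<open>T + u T + T u\<^sup>* + u T u\<^sup>*\<close>: these are the compressions \<open>V\<^sup>* x V\<close> of matrices \<open>x\<close> over \<open>T\<close> of twice the
  size by the isometry \<open>V = (1; u\<^sup>*)/\<surd>2\<close>, whose range projection \<open>V V\<^sup>*\<close> has entries in \<open>T\<close> because \<open>u\<close> is
  unitary. With \<open>p = 1 - V V\<^sup>*\<close> and \<open>t\<close> large, \<open>V\<^sup>* x V < b\<close> implies \<open>x - t p < V b V\<^sup>*\<close>, and
  \<open>x - t p < a\<close> implies \<open>V\<^sup>* x V < V\<^sup>* a V\<close>. Iterating over words in the unitaries of \<open>S\<close> produces a dense
  subspace of \<open>A\<close>, and strict inequalities survive small perturbations. The order theory behind this
  (positive elements are the squares of self-adjoint ones and the elements \<open>x\<^sup>* x\<close>; \<open>M\<^sub>m(B)\<close> is a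
  C*-algebra) is obtained from the iteration \<open>y \<mapsto> (k + y\<^sup>2)/2\<close> for square roots and the Neumann
  series, without functional calculus or the spectral radius formula.\<close>

section \<open>Elementary facts and limits\<close>

text \<open>A compressed inequality controls only the corner cut out by V; the off-diagonal blocks
  of V b V^* - x are arbitrary. Strictness pays for them: half of the gap in the corner absorbs the
  off-diagonal blocks by completing a square, and t p dominates what this leaves in the
  complementary corner. Since V^* p V = 0, the shift by t p changes a bound upstairs but not its
  compression, and since p has entries in T, the shifted bound is again admissible. Only finitely
  many bounds occur, so one t serves all of them. The blocks 1 and u^* of V produce the factors 1
  and u on the left and 1 and u^* on the right, while the entries of V V^* are multiples of 1, u,
  u^* and u^* u = 1. Each dilation doubles the matrix size, so a word of length l over M_m uses the
  hypothesis for size 2^l m; this is where completeness of the property enters. The interpolants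
  always come from A, so only the bounds have to climb through the larger systems. The algebra
  generated by M_m(S) is M_m(A), hence both properties have the same target.\<close>

lemma complex_ring_simps [simp]:
  "carrier complex_ring = UNIV" "monoid.mult complex_ring = (*)" "one complex_ring = 1"
  "ring.zero complex_ring = 0" "add complex_ring = (+)"
  by (simp_all add: ring_of_type_algebra_def fun_eq_iff)

context unital_cstar_algebra
begin

lemma smult_mem [simp, intro]: "x \<in> carrier A \<Longrightarrow> c \<odot> x \<in> carrier A"
  by simp

lemma smult_add_left: "x \<in> carrier A \<Longrightarrow> (c + d) \<odot> x = c \<odot> x \<oplus> d \<odot> x"
  using smult_l_distr[of c d x] by simp

lemma smult_add_right: "x \<in> carrier A \<Longrightarrow> y \<in> carrier A \<Longrightarrow> c \<odot> (x \<oplus> y) = c \<odot> x \<oplus> c \<odot> y"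
  using smult_r_distr[of c x y] by simp

lemma smult_smult [simp]: "x \<in> carrier A \<Longrightarrow> c \<odot> (d \<odot> x) = (c * d) \<odot> x"
  using smult_assoc1[of c d x] by simp

lemma smult_1 [simp]: "x \<in> carrier A \<Longrightarrow> 1 \<odot> x = x"
  using smult_one[of x] by simp

lemma smult_0 [simp]: "x \<in> carrier A \<Longrightarrow> 0 \<odot> x = \<zero>"
  using smult_l_null[of x] by simp

lemma smult_zero [simp]: "c \<odot> \<zero> = \<zero>"
  using smult_r_null[of c] by simp

lemma smult_minus_left: "x \<in> carrier A \<Longrightarrow> (- c) \<odot> x = \<ominus> (c \<odot> x)"
  by (rule minus_equality[symmetric]) (simp_all flip: smult_add_left)

lemma smult_minus_right: "x \<in> carrier A \<Longrightarrow> c \<odot> (\<ominus> x) = \<ominus> (c \<odot> x)"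
  by (rule minus_equality[symmetric]) (simp_all add: l_neg flip: smult_add_right)

lemma smult_minus_one: "x \<in> carrier A \<Longrightarrow> (- 1) \<odot> x = \<ominus> x"
  by (simp add: smult_minus_left)

lemma smult_diff_left: "x \<in> carrier A \<Longrightarrow> (c - d) \<odot> x = c \<odot> x \<ominus> d \<odot> x"
  using smult_add_left[of x c "- d"] by (simp add: smult_minus_left minus_eq)

lemma smult_diff_right:
  "x \<in> carrier A \<Longrightarrow> y \<in> carrier A \<Longrightarrow> c \<odot> (x \<ominus> y) = c \<odot> x \<ominus> c \<odot> y"
  by (simp add: minus_eq smult_add_right smult_minus_right)

lemma smult_two: "x \<in> carrier A \<Longrightarrow> 2 \<odot> x = x \<oplus> x"
  using smult_add_left[of x 1 1] by simp

lemma smult_half_add: "x \<in> carrier A \<Longrightarrow> (1/2) \<odot> (x \<oplus> x) = x"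
  by (simp add: smult_add_right flip: smult_add_left)

section \<open>Involution and norm\<close>

declare adj_closed [simp, intro] adj_adj [simp] cstar_identity [simp]

lemma adj_zero [simp]: "adj A \<zero> = \<zero>"
  using adj_smult[of \<zero> 0] by simp

lemma adj_one [simp]: "adj A \<one> = \<one>"
proof -
  have "adj A \<one> = adj A \<one> \<otimes> adj A (adj A \<one>)" by simp
  also have "\<dots> = adj A (adj A \<one> \<otimes> \<one>)" by (subst adj_mult) auto
  finally show ?thesis by simp
qed

lemma adj_uminus: "x \<in> carrier A \<Longrightarrow> adj A (\<ominus> x) = \<ominus> (adj A x)"
  using adj_smult[of x "-1"] by (simp add: smult_minus_one)

lemma adj_diff: "x \<in> carrier A \<Longrightarrow> y \<in> carrier A \<Longrightarrow> adj A (x \<ominus> y) = adj A x \<ominus> adj A y"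
  by (simp add: minus_eq adj_add adj_uminus)

lemmas adj_simps = adj_add adj_smult adj_mult adj_uminus adj_diff

lemma cnorm_zero [simp]: "cnorm A \<zero> = 0"
  by (simp add: cnorm_eq_zero)

lemma cnorm_uminus [simp]: "x \<in> carrier A \<Longrightarrow> cnorm A (\<ominus> x) = cnorm A x"
  using cnorm_smult[of x "-1"] by (simp add: smult_minus_one)

lemma cnorm_nonneg [simp]: "x \<in> carrier A \<Longrightarrow> 0 \<le> cnorm A x"
  using cnorm_triangle[of x "\<ominus> x"] by (simp add: r_neg)

lemma cnorm_diff: "x \<in> carrier A \<Longrightarrow> y \<in> carrier A \<Longrightarrow> cnorm A (x \<ominus> y) \<le> cnorm A x + cnorm A y"
  using cnorm_triangle[of x "\<ominus> y"] by (simp add: minus_eq)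

lemma cnorm_diff_commute:
  "x \<in> carrier A \<Longrightarrow> y \<in> carrier A \<Longrightarrow> cnorm A (x \<ominus> y) = cnorm A (y \<ominus> x)"
proof -
  assume xy: "x \<in> carrier A" "y \<in> carrier A"
  then have "x \<ominus> y = \<ominus> (y \<ominus> x)" by algebra
  with xy show ?thesis by simp
qed

lemma cnorm_diff_triangle:
  assumes "x \<in> carrier A" "y \<in> carrier A" "z \<in> carrier A"
  shows "cnorm A (x \<ominus> z) \<le> cnorm A (x \<ominus> y) + cnorm A (y \<ominus> z)"
proof -
  have "x \<ominus> z = (x \<ominus> y) \<oplus> (y \<ominus> z)" using assms by algebra
  with assms show ?thesis using cnorm_triangle[of "x \<ominus> y" "y \<ominus> z"] by simp
qed

lemma diff_eq_zero: "x \<in> carrier A \<Longrightarrow> y \<in> carrier A \<Longrightarrow> x \<ominus> y = \<zero> \<longleftrightarrow> x = y"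
  by (metis minus_eq r_neg minus_equality minus_minus a_inv_closed a_comm)

lemma Metric: "Metric_space (carrier A) (cdist A)"
  by unfold_locales
    (auto simp: cdist_def cnorm_diff_commute cnorm_eq_zero diff_eq_zero cnorm_diff_triangle)

text \<open>Isometry of the involution is not among the axioms. The C*-identity and
  submultiplicativity bound the square of the norm of \<open>x\<close> by the product of the norms
  of \<open>adj A x\<close> and \<open>x\<close>; cancelling gives one inequality, and replacing
  \<open>x\<close> by its adjoint the other.\<close>

lemma cnorm_adj [simp]: "x \<in> carrier A \<Longrightarrow> cnorm A (adj A x) = cnorm A x"
proof -
  have le: "cnorm A x \<le> cnorm A (adj A x)" if x: "x \<in> carrier A" for x
  proof (cases "cnorm A x = 0")
    case False
    have "cnorm A x * cnorm A x \<le> cnorm A (adj A x) * cnorm A x"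
      using cnorm_mult[of "adj A x" x] x by (simp add: power2_eq_square)
    moreover have "cnorm A x > 0" using False x by (simp add: order_less_le)
    ultimately show ?thesis by simp
  qed (use x in simp)
  show ?thesis if "x \<in> carrier A" using le[of x] le[of "adj A x"] that by simp
qed

text \<open>The C*-identity makes the norm of the unit a root of \<open>r = r^2\<close>. The value 0
  occurs in the zero algebra, so only an upper bound is claimed.\<close>

lemma cnorm_one_le: "cnorm A \<one> \<le> 1"
proof -
  have "cnorm A \<one> = (cnorm A \<one>)\<^sup>2" using cstar_identity[of \<one>] by simp
  then have "cnorm A \<one> * (cnorm A \<one> - 1) = 0" by (simp add: power2_eq_square algebra_simps)
  then show ?thesis by auto
qed

lemma cnorm_scalar_le: "cnorm A (c \<odot> \<one>) \<le> cmod c"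
  using mult_left_mono[OF cnorm_one_le, of "cmod c"] by (simp add: cnorm_smult)

abbreviation scal :: "real \<Rightarrow> 'a"
  where "scal t \<equiv> complex_of_real t \<odot> \<one>"

text \<open>Membership of the sequence and of the limit is part of the notion, so that the limit
  rules chain without side conditions. The norm replaces the topology of \<open>cdist\<close>, which
  is met again where completeness and closedness are used.\<close>

definition cconv :: "(nat \<Rightarrow> 'a) \<Rightarrow> 'a \<Rightarrow> bool"
  where "cconv y l \<longleftrightarrow>
    (\<forall>n. y n \<in> carrier A) \<and> l \<in> carrier A \<and> (\<lambda>n. cnorm A (y n \<ominus> l)) \<longlonglongrightarrow> 0"

lemma cconvI:
  assumes "\<And>n. y n \<in> carrier A" "l \<in> carrier A" "\<And>n. cnorm A (y n \<ominus> l) \<le> e n" "e \<longlonglongrightarrow> 0"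
  shows "cconv y l"
  unfolding cconv_def
  using assms by (auto intro!: tendsto_sandwich[OF _ _ tendsto_const assms(4)] always_eventually)

lemma cconv_unique: "cconv y l \<Longrightarrow> cconv y l' \<Longrightarrow> l = l'"
proof -
  assume 1: "cconv y l" "cconv y l'"
  then have c: "l \<in> carrier A" "l' \<in> carrier A" "\<And>n. y n \<in> carrier A" by (auto simp: cconv_def)
  have "(\<lambda>n. cnorm A (y n \<ominus> l) + cnorm A (y n \<ominus> l')) \<longlonglongrightarrow> 0 + 0"
    using 1 by (intro tendsto_add) (auto simp: cconv_def)
  moreover have "cnorm A (l \<ominus> l') \<le> cnorm A (y n \<ominus> l) + cnorm A (y n \<ominus> l')" for n
    using cnorm_diff_triangle[of l "y n" l'] c by (simp add: cnorm_diff_commute)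
  ultimately have "cnorm A (l \<ominus> l') \<le> 0"
    by (intro LIMSEQ_le_const) auto
  then have "cnorm A (l \<ominus> l') = 0" using c by (intro antisym) auto
  then show ?thesis using c by (simp add: cnorm_eq_zero diff_eq_zero)
qed

lemma cconv_const: "l \<in> carrier A \<Longrightarrow> cconv (\<lambda>_. l) l"
  by (simp add: cconv_def diff_eq_zero[THEN iffD2])

lemma cconv_Suc: "cconv y l \<Longrightarrow> cconv (\<lambda>n. y (Suc n)) l"
  unfolding cconv_def using LIMSEQ_Suc by blast

lemma cconv_add: "cconv y l \<Longrightarrow> cconv z k \<Longrightarrow> cconv (\<lambda>n. y n \<oplus> z n) (l \<oplus> k)"
proof -
  assume yz: "cconv y l" "cconv z k"
  then have c: "\<And>n. y n \<in> carrier A" "\<And>n. z n \<in> carrier A" "l \<in> carrier A" "k \<in> carrier A"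
    by (auto simp: cconv_def)
  have "(y n \<oplus> z n) \<ominus> (l \<oplus> k) = (y n \<ominus> l) \<oplus> (z n \<ominus> k)" for n using c(1,2)[of n] c(3,4) by algebra
  then have "cnorm A ((y n \<oplus> z n) \<ominus> (l \<oplus> k)) \<le> cnorm A (y n \<ominus> l) + cnorm A (z n \<ominus> k)" for n
    using c by (simp add: cnorm_triangle)
  moreover have "(\<lambda>n. cnorm A (y n \<ominus> l) + cnorm A (z n \<ominus> k)) \<longlonglongrightarrow> 0 + 0"
    using yz by (intro tendsto_add) (auto simp: cconv_def)
  ultimately show ?thesis using c by (intro cconvI) auto
qed

lemma cconv_smult: "cconv y l \<Longrightarrow> cconv (\<lambda>n. c \<odot> y n) (c \<odot> l)"
proof -
  assume y: "cconv y l"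
  then have c: "\<And>n. y n \<in> carrier A" "l \<in> carrier A" by (auto simp: cconv_def)
  have "(\<lambda>n. cmod c * cnorm A (y n \<ominus> l)) \<longlonglongrightarrow> cmod c * 0"
    using y by (intro tendsto_mult) (auto simp: cconv_def)
  moreover have "cnorm A (c \<odot> y n \<ominus> c \<odot> l) \<le> cmod c * cnorm A (y n \<ominus> l)" for n
    using c by (simp add: smult_diff_right[symmetric] cnorm_smult)
  ultimately show ?thesis using c by (intro cconvI) auto
qed

lemma cconv_adj: "cconv y l \<Longrightarrow> cconv (\<lambda>n. adj A (y n)) (adj A l)"
  by (auto simp: cconv_def adj_diff[symmetric])

lemma cconv_cnorm: "cconv y l \<Longrightarrow> (\<lambda>n. cnorm A (y n)) \<longlonglongrightarrow> cnorm A l"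
proof -
  assume y: "cconv y l"
  then have c: "\<And>n. y n \<in> carrier A" "l \<in> carrier A" by (auto simp: cconv_def)
  have "\<bar>cnorm A (y n) - cnorm A l\<bar> \<le> cnorm A (y n \<ominus> l)" for n
  proof -
    have yn: "y n \<in> carrier A" using c(1) .
    have eq: "(y n \<ominus> l) \<oplus> l = y n" using yn c(2) by algebra
    have eq': "y n \<ominus> (y n \<ominus> l) = l" using yn c(2) by algebra
    have "cnorm A (y n) \<le> cnorm A (y n \<ominus> l) + cnorm A l"
      using cnorm_triangle[OF minus_closed[OF yn c(2)] c(2)] by (simp only: eq)
    moreover have "cnorm A l \<le> cnorm A (y n) + cnorm A (y n \<ominus> l)"
      using cnorm_diff[OF yn minus_closed[OF yn c(2)]] by (simp only: eq')
    ultimately show ?thesis by argo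
  qed
  then have "(\<lambda>n. cnorm A (y n) - cnorm A l) \<longlonglongrightarrow> 0"
    by (intro Lim_null_comparison[OF always_eventually y[unfolded cconv_def, THEN conjunct2, THEN conjunct2]])
      simp
  then show ?thesis by (rule LIM_zero_cancel)
qed

lemma cconv_mult: "cconv y l \<Longrightarrow> cconv z k \<Longrightarrow> cconv (\<lambda>n. y n \<otimes> z n) (l \<otimes> k)"
proof -
  assume yz: "cconv y l" "cconv z k"
  then have c: "\<And>n. y n \<in> carrier A" "\<And>n. z n \<in> carrier A" "l \<in> carrier A" "k \<in> carrier A"
    by (auto simp: cconv_def)
  have "(y n \<otimes> z n) \<ominus> (l \<otimes> k) = (y n \<ominus> l) \<otimes> z n \<oplus> l \<otimes> (z n \<ominus> k)" for n
    using c(1,2)[of n] c(3,4) by algebra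
  then have "cnorm A ((y n \<otimes> z n) \<ominus> (l \<otimes> k))
      \<le> cnorm A (y n \<ominus> l) * cnorm A (z n) + cnorm A l * cnorm A (z n \<ominus> k)" for n
    using c by (simp, intro order.trans[OF cnorm_triangle] add_mono cnorm_mult) auto
  moreover have "(\<lambda>n. cnorm A (y n \<ominus> l) * cnorm A (z n) + cnorm A l * cnorm A (z n \<ominus> k))
      \<longlonglongrightarrow> 0 * cnorm A k + cnorm A l * 0"
    by (intro tendsto_add tendsto_mult cconv_cnorm yz tendsto_const)
      (use yz in \<open>auto simp: cconv_def\<close>)
  ultimately show ?thesis using c by (intro cconvI) auto
qed

lemma cconv_uminus: "cconv y l \<Longrightarrow> cconv (\<lambda>n. \<ominus> (y n)) (\<ominus> l)"
  using cconv_smult[of y l "-1"] by (auto simp: cconv_def smult_minus_one)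

lemma cconv_diff: "cconv y l \<Longrightarrow> cconv z k \<Longrightarrow> cconv (\<lambda>n. y n \<ominus> z n) (l \<ominus> k)"
  unfolding minus_eq by (intro cconv_add cconv_uminus)

lemmas cconv_intros = cconv_const cconv_add cconv_smult cconv_adj cconv_mult cconv_uminus cconv_diff

lemma cconv_norm_le:
  assumes "cconv y l" "\<And>n. cnorm A (y n) \<le> r" shows "cnorm A l \<le> r"
  using LIMSEQ_le_const2[OF cconv_cnorm[OF assms(1)]] assms(2) by auto

lemma cconv_Cauchy:
  assumes y: "\<And>n. y n \<in> carrier A"
    and cau: "\<And>e. e > 0 \<Longrightarrow> \<exists>N. \<forall>m\<ge>N. \<forall>n\<ge>N. cnorm A (y m \<ominus> y n) < e"
  shows "\<exists>l. cconv y l"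
proof -
  interpret M: Metric_space "carrier A" "cdist A" by (rule Metric)
  have "M.MCauchy y"
    unfolding M.MCauchy_def using y cau by (auto simp: cdist_def)
  then obtain l where l: "limitin M.mtopology y l sequentially"
    using complete M.mcomplete_def by blast
  then have "l \<in> carrier A" "(\<lambda>n. cdist A (y n) l) \<longlonglongrightarrow> 0"
    by (auto simp: M.limitin_metric_dist_null)
  then show ?thesis using y by (auto simp: cconv_def cdist_def)
qed

text \<open>The scalar sequence \<open>s\<close> majorizes \<open>y\<close>; this replaces the convergence theory of series.\<close>

lemma cconv_majorized:
  assumes y: "\<And>n. y n \<in> carrier A"
    and d: "\<And>n. cnorm A (y (Suc n) \<ominus> y n) \<le> s (Suc n) - s n" and s: "convergent s"
  shows "\<exists>l. cconv y l"
proof (rule cconv_Cauchy[OF y])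
  have tel: "cnorm A (y (m + j) \<ominus> y m) \<le> s (m + j) - s m" for m j
  proof (induction j)
    case 0
    then show ?case using y by (simp add: diff_eq_zero[THEN iffD2])
  next
    case (Suc j)
    then show ?case
      using cnorm_diff_triangle[of "y (m + Suc j)" "y (m + j)" "y m"] y d[of "m + j"] by simp
  qed
  fix e :: real assume "e > 0"
  have "Cauchy s" using s by (simp add: Cauchy_convergent_iff)
  then obtain N where N: "\<And>m n. m \<ge> N \<Longrightarrow> n \<ge> N \<Longrightarrow> \<bar>s m - s n\<bar> < e"
    using \<open>e > 0\<close> unfolding Cauchy_def dist_real_def by blast
  have aux: "cnorm A (y n \<ominus> y m) < e" if "N \<le> m" "m \<le> n" for m n
    using tel[of m "n - m"] N[of n m] that by simp
  have "cnorm A (y m \<ominus> y n) < e" if "N \<le> m" "N \<le> n" for m n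
    using aux[of m n] aux[of n m] that y[of m] y[of n] by (cases "m \<le> n") (auto simp: cnorm_diff_commute)
  then show "\<exists>N. \<forall>m\<ge>N. \<forall>n\<ge>N. cnorm A (y m \<ominus> y n) < e" by blast
qed

lemma cconv_commute:
  assumes "cconv y l" "z \<in> carrier A" "\<And>n. y n \<otimes> z = z \<otimes> y n"
  shows "l \<otimes> z = z \<otimes> l"
proof -
  have "cconv (\<lambda>n. y n \<otimes> z) (l \<otimes> z)" "cconv (\<lambda>n. z \<otimes> y n) (z \<otimes> l)"
    using assms by (intro cconv_intros; simp)+
  then show ?thesis using assms(3) cconv_unique by simp
qed

text \<open>Iterating \<open>z \<mapsto> 1 + k z\<close> from 0 yields the partial sums of the
  geometric series without naming powers of \<open>k\<close>. The limit solves
  \<open>l = 1 + k l\<close>, so it is a right inverse of \<open>1 - k\<close>; it commutes with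
  \<open>k\<close> as all iterates do, so it is also a left inverse.\<close>

lemma neumann:
  assumes k: "k \<in> carrier A" and lt: "cnorm A k < 1"
  shows "\<one> \<ominus> k \<in> Units A"
proof -
  define y where "y n = ((\<lambda>z. \<one> \<oplus> k \<otimes> z) ^^ n) \<zero>" for n
  have y0: "y 0 = \<zero>" and yS: "y (Suc n) = \<one> \<oplus> k \<otimes> y n" for n by (simp_all add: y_def)
  have yc: "y n \<in> carrier A" for n by (induction n) (use k in \<open>auto simp: y0 yS\<close>)
  have comm: "y n \<otimes> k = k \<otimes> y n" for n
  proof (induction n)
    case (Suc n)
    have "y (Suc n) \<otimes> k = k \<oplus> k \<otimes> (y n \<otimes> k)" using k yc[of n] by (simp add: yS l_distr m_assoc)
    also have "\<dots> = k \<otimes> y (Suc n)" using k yc[of n] by (simp add: yS Suc r_distr)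
    finally show ?case .
  qed (use k in \<open>simp add: y0\<close>)
  have dn: "cnorm A (y (Suc n) \<ominus> y n) \<le> cnorm A k ^ n" for n
  proof (induction n)
    case 0
    then show ?case using k cnorm_one_le by (simp add: y0 yS minus_eq)
  next
    case (Suc n)
    have "(\<one> \<oplus> k \<otimes> a) \<ominus> (\<one> \<oplus> k \<otimes> b) = k \<otimes> (a \<ominus> b)"
      if "a \<in> carrier A" "b \<in> carrier A" for a b
      using that k by algebra
    from this[OF yc yc] have "y (Suc (Suc n)) \<ominus> y (Suc n) = k \<otimes> (y (Suc n) \<ominus> y n)"
      by (metis yS)
    then have "cnorm A (y (Suc (Suc n)) \<ominus> y (Suc n)) \<le> cnorm A k * cnorm A (y (Suc n) \<ominus> y n)"
      using cnorm_mult k yc by simp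
    also have "\<dots> \<le> cnorm A k * cnorm A k ^ n" using Suc k by (intro mult_left_mono) auto
    finally show ?case by simp
  qed
  have "convergent (\<lambda>n. \<Sum>i<n. cnorm A k ^ i)"
    using lt k summable_geometric[of "cnorm A k"] by (simp add: summable_iff_convergent)
  then obtain l where l: "cconv y l"
    using cconv_majorized[of y "\<lambda>n. \<Sum>i<n. cnorm A k ^ i"] yc dn by auto
  then have lc: "l \<in> carrier A" by (simp add: cconv_def)
  have "cconv (\<lambda>n. y (Suc n)) (\<one> \<oplus> k \<otimes> l)" unfolding yS
    using l k by (intro cconv_intros) auto
  then have fix1: "l = \<one> \<oplus> k \<otimes> l" using cconv_Suc[OF l] cconv_unique by blast
  have fix2: "l \<otimes> k = k \<otimes> l" using cconv_commute[OF l k] comm by blast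
  have "(\<one> \<ominus> k) \<otimes> l = l \<ominus> k \<otimes> l" using lc k by algebra
  also have "\<dots> = (\<one> \<oplus> k \<otimes> l) \<ominus> k \<otimes> l" using fix1 by simp
  also have "\<dots> = \<one>" using lc k by algebra
  finally have inv1: "(\<one> \<ominus> k) \<otimes> l = \<one>" .
  have "l \<otimes> (\<one> \<ominus> k) = l \<ominus> l \<otimes> k" using lc k by (algebra; simp)
  also have "\<dots> = (\<one> \<ominus> k) \<otimes> l" unfolding fix2 using lc k by algebra
  finally have "l \<otimes> (\<one> \<ominus> k) = \<one>" using inv1 by simp
  then show ?thesis using inv1 lc k unfolding Units_def by auto
qed

end

section \<open>Square roots and the positive cone\<close>

context unital_cstar_algebra
begin

text \<open>For \<open>k = 1 - a\<close>, a fixed point \<open>l\<close> of the iteration gives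
  \<open>(1 - l)^2 = 1 - k = a\<close>. The same iteration with the scalar 1 in place of
  \<open>k\<close> majorizes it; that sequence only has to be increasing and bounded, so the case of
  norm exactly 1, where the scalar fixed point is a double root, is included. The commutation clause
  holds because the iterates are polynomials in \<open>k\<close>; it is what lets roots of commuting
  elements commute later.\<close>

lemma cstar_sqrt:
  assumes a: "a \<in> carrier A" "adj A a = a" "cnorm A (\<one> \<ominus> a) \<le> 1"
  shows "\<exists>b\<in>carrier A. adj A b = b \<and> b \<otimes> b = a \<and> cnorm A (\<one> \<ominus> b) \<le> 1 \<and>
    (\<forall>z\<in>carrier A. a \<otimes> z = z \<otimes> a \<longrightarrow> b \<otimes> z = z \<otimes> b)"
proof -
  define k where "k = \<one> \<ominus> a"
  have k: "k \<in> carrier A" "adj A k = k" "cnorm A k \<le> 1" using a by (auto simp: k_def adj_simps)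
  define y where "y n = ((\<lambda>z. (1/2) \<odot> (k \<oplus> z \<otimes> z)) ^^ n) \<zero>" for n
  define s :: "nat \<Rightarrow> real" where "s n = ((\<lambda>t. (1 + t * t) / 2) ^^ n) 0" for n
  have y0: "y 0 = \<zero>" and yS: "y (Suc n) = (1/2) \<odot> (k \<oplus> y n \<otimes> y n)" for n
    by (simp_all add: y_def)
  have s0: "s 0 = 0" and sS: "s (Suc n) = (1 + s n * s n) / 2" for n by (simp_all add: s_def)
  have yc: "y n \<in> carrier A" for n by (induction n) (use k in \<open>auto simp: y0 yS\<close>)
  have s01: "0 \<le> s n \<and> s n \<le> 1" for n
  proof (induction n)
    case (Suc n)
    then have "s n * s n \<le> 1 * 1" by (intro mult_mono) auto
    then show ?case by (simp add: sS)
  qed (simp add: s0)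
  \<comment> \<open>The increment is half the square of \<open>1 - s n\<close>.\<close>
  have smono: "s n \<le> s (Suc n)" for n
    using zero_le_square[of "s n - 1"] by (simp add: sS algebra_simps)
  then have "incseq s" by (rule incseq_SucI)
  then have conv: "convergent s"
    using s01 by (intro Bseq_mono_convergent BseqI'[of _ 1]) (auto simp: incseq_def)
  have yadj: "adj A (y n) = y n" for n
    by (induction n) (use k yc in \<open>simp_all add: y0 yS adj_simps\<close>)
  have comm: "y n \<otimes> z = z \<otimes> y n" if z: "z \<in> carrier A" "k \<otimes> z = z \<otimes> k" for n z
  proof (induction n)
    case (Suc n)
    have "(y n \<otimes> y n) \<otimes> z = z \<otimes> (y n \<otimes> y n)"
      using Suc yc[of n] z by (metis m_assoc)
    then show ?case using z k yc[of n]
      by (simp add: yS smult_mult_left smult_mult_right l_distr r_distr)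
  qed (use z in \<open>simp add: y0\<close>)
  have ycomm: "y m \<otimes> y n = y n \<otimes> y m" for m n
    using comm[OF yc] comm[OF k(1)] by metis
  have ynorm: "cnorm A (y n) \<le> s n" for n
  proof (induction n)
    case (Suc n)
    have "cnorm A (y n \<otimes> y n) \<le> s n * s n"
      using cnorm_mult[of "y n" "y n"] mult_mono[OF Suc Suc] yc[of n] s01[of n] by simp
    then have "cnorm A (k \<oplus> y n \<otimes> y n) \<le> 1 + s n * s n"
      using cnorm_triangle[of k "y n \<otimes> y n"] k yc[of n] by simp
    then show ?case using k yc[of n] by (simp add: yS sS cnorm_smult)
  qed (simp add: y0 s0)
  \<comment> \<open>The difference of squares factors because \<open>p\<close> and \<open>q\<close>
    commute; the iterates do so since each of them commutes with everything that commutes with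
    \<open>k\<close>.\<close>
  have step: "(1/2) \<odot> (k \<oplus> p \<otimes> p) \<ominus> (1/2) \<odot> (k \<oplus> q \<otimes> q) = (1/2) \<odot> ((p \<ominus> q) \<otimes> (p \<oplus> q))"
    if pq: "p \<in> carrier A" "q \<in> carrier A" "p \<otimes> q = q \<otimes> p" for p q
  proof -
    have "(p \<ominus> q) \<otimes> (p \<oplus> q) = (k \<oplus> p \<otimes> p) \<ominus> (k \<oplus> q \<otimes> q) \<oplus> (p \<otimes> q \<ominus> q \<otimes> p)"
      using pq(1,2) k(1) by (algebra; simp)
    also have "\<dots> = (k \<oplus> p \<otimes> p) \<ominus> (k \<oplus> q \<otimes> q)" using pq k(1) by (simp add: diff_eq_zero)
    finally show ?thesis using pq k(1) by (simp add: smult_diff_right)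
  qed
  have dn: "cnorm A (y (Suc n) \<ominus> y n) \<le> s (Suc n) - s n" for n
  proof (induction n)
    case 0
    then show ?case using k by (simp add: y0 yS s0 sS minus_eq cnorm_smult)
  next
    case (Suc n)
    have "y (Suc (Suc n)) \<ominus> y (Suc n) = (1/2) \<odot> ((y (Suc n) \<ominus> y n) \<otimes> (y (Suc n) \<oplus> y n))"
      using step[OF yc yc ycomm] by (metis yS)
    then have "cnorm A (y (Suc (Suc n)) \<ominus> y (Suc n))
        = cnorm A ((y (Suc n) \<ominus> y n) \<otimes> (y (Suc n) \<oplus> y n)) / 2"
      using yc by (simp add: cnorm_smult)
    \<comment> \<open>The scalar sequence satisfies the same difference formula, so the norm bounds
      of the two factors multiply to its next increment.\<close>
    also have "\<dots> \<le> (s (Suc n) - s n) * (s (Suc n) + s n) / 2"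
    proof -
      have "cnorm A (y (Suc n) \<oplus> y n) \<le> s (Suc n) + s n"
        using cnorm_triangle[OF yc yc, of "Suc n" n] ynorm[of n] ynorm[of "Suc n"] by linarith
      then have "cnorm A (y (Suc n) \<ominus> y n) * cnorm A (y (Suc n) \<oplus> y n)
          \<le> (s (Suc n) - s n) * (s (Suc n) + s n)"
        using Suc yc smono[of n] by (intro mult_mono) auto
      then show ?thesis
        using cnorm_mult[of "y (Suc n) \<ominus> y n" "y (Suc n) \<oplus> y n"] yc by simp
    qed
    also have "\<dots> = s (Suc (Suc n)) - s (Suc n)"
      unfolding sS[of "Suc n"] by (subst (3) sS) (simp add: field_simps)
    finally show ?case .
  qed
  obtain l where l: "cconv y l" using cconv_majorized[OF yc dn conv] by blast
  then have lc: "l \<in> carrier A" by (simp add: cconv_def)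
  have "cconv (\<lambda>n. y (Suc n)) ((1/2) \<odot> (k \<oplus> l \<otimes> l))" unfolding yS
    using l k by (intro cconv_intros) auto
  then have fixl: "l = (1/2) \<odot> (k \<oplus> l \<otimes> l)" using cconv_Suc[OF l] cconv_unique by blast
  have "2 \<odot> l = 2 \<odot> ((1/2) \<odot> (k \<oplus> l \<otimes> l))" using fixl by simp
  then have fix2: "l \<oplus> l = k \<oplus> l \<otimes> l" using lc k by (simp add: smult_two)
  define b where "b = \<one> \<ominus> l"
  have bc: "b \<in> carrier A" using lc by (simp add: b_def)
  have "cconv (\<lambda>n. y n) (adj A l)" using cconv_adj[OF l] by (simp add: yadj)
  then have ladj: "adj A l = l" using cconv_unique l by blast
  have "b \<otimes> b = \<one> \<ominus> (l \<oplus> l) \<oplus> l \<otimes> l" unfolding b_def using lc by (algebra; simp)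
  also have "\<dots> = \<one> \<ominus> k" unfolding fix2 using lc k(1) by (algebra; simp)
  also have "\<dots> = a" unfolding k_def using a(1) by (algebra; simp)
  finally have bb: "b \<otimes> b = a" .
  have "\<one> \<ominus> b = l" unfolding b_def using lc by (algebra; simp)
  moreover have "cnorm A l \<le> 1" using cconv_norm_le[OF l] ynorm s01 by (meson order_trans)
  ultimately have bn: "cnorm A (\<one> \<ominus> b) \<le> 1" by simp
  have bcomm: "b \<otimes> z = z \<otimes> b" if z: "z \<in> carrier A" "a \<otimes> z = z \<otimes> a" for z
  proof -
    have "k \<otimes> z = z \<ominus> a \<otimes> z" unfolding k_def using a(1) z(1) by (algebra; simp)
    also have "\<dots> = z \<otimes> k" unfolding z(2) k_def using a(1) z(1) by (algebra; simp)
    finally have "l \<otimes> z = z \<otimes> l" using comm[OF z(1)] cconv_commute[OF l z(1)] by blast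
    moreover have "b \<otimes> z = z \<ominus> l \<otimes> z" unfolding b_def using lc z(1) by (algebra; simp)
    moreover have "z \<otimes> b = z \<ominus> z \<otimes> l" unfolding b_def using lc z(1) by (algebra; simp)
    ultimately show ?thesis by simp
  qed
  have "adj A b = b" using lc ladj by (simp add: b_def adj_simps)
  then show ?thesis using bc bb bn bcomm by blast
qed

text \<open>A norm description of positivity: unlike the spectral one, it is visibly a convex cone.\<close>

definition npos :: "'a set"
  where "npos = {a \<in> carrier A. adj A a = a \<and> (\<exists>t\<ge>0. cnorm A (scal t \<ominus> a) \<le> t)}"

lemma nposD: "a \<in> npos \<Longrightarrow> a \<in> carrier A" "a \<in> npos \<Longrightarrow> adj A a = a"
  by (auto simp: npos_def)

text \<open>The witness of \<open>npos\<close> may be enlarged because \<open>s - a\<close> is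
  \<open>(s - t) + (t - a)\<close>. This makes the witness positive where one has to divide by
  it.\<close>

lemma npos_bound_mono:
  assumes "a \<in> carrier A" "cnorm A (scal t \<ominus> a) \<le> t" "t \<le> s"
  shows "cnorm A (scal s \<ominus> a) \<le> s"
proof -
  have "scal s = scal (s - t) \<oplus> scal t"
    by (subst smult_add_left[symmetric]) simp_all
  then have "scal s \<ominus> a = scal (s - t) \<oplus> (scal t \<ominus> a)"
    using assms(1) by (simp add: minus_eq a_assoc)
  then have "cnorm A (scal s \<ominus> a)
      \<le> cnorm A (scal (s - t)) + cnorm A (scal t \<ominus> a)"
    using assms(1) cnorm_triangle by simp
  also have "\<dots> \<le> (s - t) + t"
    using cnorm_scalar_le[of "complex_of_real (s - t)"] assms
    by (intro add_mono) (simp_all only: norm_of_real abs_of_nonneg diff_ge_0_iff_ge)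
  finally show ?thesis by simp
qed

lemma npos_add: "a \<in> npos \<Longrightarrow> b \<in> npos \<Longrightarrow> a \<oplus> b \<in> npos"
proof -
  assume "a \<in> npos" "b \<in> npos"
  then obtain s t where st: "s \<ge> 0" "t \<ge> 0" "cnorm A (scal s \<ominus> a) \<le> s"
      "cnorm A (scal t \<ominus> b) \<le> t"
    and ab: "a \<in> carrier A" "b \<in> carrier A" "adj A a = a" "adj A b = b"
    by (auto simp: npos_def)
  have "scal (s + t) \<ominus> (a \<oplus> b)
      = (scal s \<oplus> scal t) \<ominus> (a \<oplus> b)"
    by (simp add: smult_add_left)
  also have "\<dots> = (scal s \<ominus> a) \<oplus> (scal t \<ominus> b)"
  proof -
    have "scal s \<in> carrier A" "scal t \<in> carrier A" by auto
    then show ?thesis using ab(1,2) by (algebra; simp)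
  qed
  finally have "cnorm A (scal (s + t) \<ominus> (a \<oplus> b)) \<le> s + t"
    using st ab cnorm_triangle[of "scal s \<ominus> a" "scal t \<ominus> b"] by simp
  then show ?thesis using st ab by (auto simp: npos_def adj_simps intro!: exI[of _ "s + t"])
qed

lemma npos_smult: "a \<in> npos \<Longrightarrow> c \<ge> 0 \<Longrightarrow> complex_of_real c \<odot> a \<in> npos"
proof -
  assume "a \<in> npos" and c: "c \<ge> 0"
  then obtain t where t: "t \<ge> 0" "cnorm A (scal t \<ominus> a) \<le> t"
    and a: "a \<in> carrier A" "adj A a = a" by (auto simp: npos_def)
  have "scal (c * t) \<ominus> complex_of_real c \<odot> a
      = complex_of_real c \<odot> (scal t \<ominus> a)"
    using a by (simp add: smult_diff_right)
  then have "cnorm A (scal (c * t) \<ominus> complex_of_real c \<odot> a) \<le> c * t"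
    using a c t by (simp add: cnorm_smult mult_left_mono)
  then show ?thesis using t a c by (auto simp: npos_def adj_simps intro!: exI[of _ "c * t"])
qed

lemma npos_scalar: "c \<ge> 0 \<Longrightarrow> scal c \<in> npos"
  by (auto simp: npos_def adj_simps diff_eq_zero[THEN iffD2] intro!: exI[of _ c])

lemma npos_zero: "\<zero> \<in> npos"
  using npos_scalar[of 0] by simp

lemma npos_cnorm_diff:
  assumes "a \<in> carrier A" "adj A a = a" "cnorm A a \<le> t"
  shows "scal t \<ominus> a \<in> npos"
proof -
  have "scal t \<ominus> (scal t \<ominus> a) = a"
  proof -
    have "scal t \<in> carrier A" by auto
    then show ?thesis using assms(1) by (algebra; simp)
  qed
  moreover have "t \<ge> 0" using assms by (meson cnorm_nonneg order_trans)
  ultimately show ?thesis using assms by (auto simp: npos_def adj_simps intro!: exI[of _ t])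
qed

text \<open>Dividing by the witness moves \<open>a\<close> into the closed unit ball around 1, where
  \<open>cstar_sqrt\<close> applies; the root is scaled back by the square root of the
  witness.\<close>

lemma npos_sqrt:
  assumes "a \<in> npos"
  shows "\<exists>b\<in>npos. b \<otimes> b = a \<and> (\<forall>z\<in>carrier A. a \<otimes> z = z \<otimes> a \<longrightarrow> b \<otimes> z = z \<otimes> b)"
proof -
  from assms obtain t0 where t0: "t0 \<ge> 0" "cnorm A (scal t0 \<ominus> a) \<le> t0"
    and a: "a \<in> carrier A" "adj A a = a" by (auto simp: npos_def)
  \<comment> \<open>The given witness may be 0, as it can be for \<open>a = 0\<close>.\<close>
  define t where "t = t0 + 1"
  have t: "t > 0" "cnorm A (scal t \<ominus> a) \<le> t"
    using npos_bound_mono[OF a(1) t0(2), of t] t0 by (auto simp: t_def)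
  let ?a = "complex_of_real (1 / t) \<odot> a"
  have "\<one> \<ominus> ?a = complex_of_real (1 / t) \<odot> (scal t \<ominus> a)"
    using a t by (simp add: smult_diff_right)
  then have "cnorm A (\<one> \<ominus> ?a) = (1 / t) * cnorm A (scal t \<ominus> a)"
    using t(1) a(1) by (simp only: cnorm_smult minus_closed smult_mem one_closed norm_of_real) simp
  then have "cnorm A (\<one> \<ominus> ?a) \<le> 1" using t by simp
  moreover have "?a \<in> carrier A" "adj A ?a = ?a" using a by (simp_all add: adj_smult)
  ultimately obtain b where b: "b \<in> carrier A" "adj A b = b" "b \<otimes> b = ?a" "cnorm A (\<one> \<ominus> b) \<le> 1"
    "\<And>z. z \<in> carrier A \<Longrightarrow> ?a \<otimes> z = z \<otimes> ?a \<Longrightarrow> b \<otimes> z = z \<otimes> b"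
    using cstar_sqrt[of ?a] by metis
  have "b \<in> npos" using b by (auto simp: npos_def intro!: exI[of _ 1])
  then have "complex_of_real (sqrt t) \<odot> b \<in> npos" using t by (intro npos_smult) auto
  moreover have "(complex_of_real (sqrt t) \<odot> b) \<otimes> (complex_of_real (sqrt t) \<odot> b) = a"
    using b(1,3) t(1) a(1) by (simp add: smult_mult_left smult_mult_right flip: of_real_mult)
  moreover have "(complex_of_real (sqrt t) \<odot> b) \<otimes> z = z \<otimes> (complex_of_real (sqrt t) \<odot> b)"
    if "z \<in> carrier A" "a \<otimes> z = z \<otimes> a" for z
  proof -
    have "?a \<otimes> z = z \<otimes> ?a" using that a(1) by (simp add: smult_mult_left smult_mult_right)
    then have "b \<otimes> z = z \<otimes> b" using b(5) that(1) by blast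
    then show ?thesis using b(1) that(1) by (simp add: smult_mult_left smult_mult_right)
  qed
  ultimately show ?thesis by blast
qed

text \<open>\<open>c + i d\<close> is \<open>\<surd>t\<close> times a unitary.\<close>

lemma cnorm_commuting_squares:
  assumes c: "c \<in> carrier A" "adj A c = c" and d: "d \<in> carrier A" "adj A d = d"
    and cd: "c \<otimes> d = d \<otimes> c" and t: "c \<otimes> c \<oplus> d \<otimes> d = scal t" "t \<ge> 0"
  shows "cnorm A (c \<otimes> c) \<le> t"
proof -
  define u where "u = c \<oplus> \<i> \<odot> d"
  have uc: "u \<in> carrier A" using c d by (simp add: u_def)
  have au: "adj A u = c \<ominus> \<i> \<odot> d" using c d by (simp add: u_def adj_simps smult_minus_left minus_eq)
  have e: "\<i> \<odot> d \<in> carrier A" "\<i> \<odot> d \<otimes> c = c \<otimes> (\<i> \<odot> d)"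
    "(\<i> \<odot> d) \<otimes> (\<i> \<odot> d) = \<ominus> (d \<otimes> d)"
    using c d cd by (simp_all add: smult_mult_left smult_mult_right smult_minus_one)
  have "adj A u \<otimes> u = c \<otimes> c \<oplus> (c \<otimes> (\<i> \<odot> d) \<ominus> \<i> \<odot> d \<otimes> c) \<ominus> (\<i> \<odot> d) \<otimes> (\<i> \<odot> d)"
    unfolding au unfolding u_def using c(1) e(1) by (algebra; simp)
  also have "\<dots> = c \<otimes> c \<oplus> d \<otimes> d" unfolding e(2,3) using c d e(1) by (simp add: diff_eq_zero[THEN iffD2] minus_eq r_neg)
  finally have "(cnorm A u)\<^sup>2 = cnorm A (scal t)"
    using cstar_identity[OF uc] t(1) by simp
  then have un: "(cnorm A u)\<^sup>2 \<le> t" using cnorm_scalar_le[of "complex_of_real t"] t by simp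
  have "2 \<odot> c = u \<oplus> adj A u" unfolding au unfolding u_def smult_two[OF c(1)] using c(1) e(1) by (algebra; simp)
  then have "2 * cnorm A c \<le> 2 * cnorm A u"
    using cnorm_triangle[of u "adj A u"] uc cnorm_smult[OF c(1), of 2] by simp
  then have "(cnorm A c)\<^sup>2 \<le> (cnorm A u)\<^sup>2" using c by (intro power_mono) auto
  then show ?thesis using un cstar_identity[OF c(1)] c by simp
qed

text \<open>Scaled to norm at most 1, \<open>c\<close> has a companion \<open>s\<close> with
  \<open>s^2 = 1 - c^2\<close>, like cosine and sine. Since \<open>s\<close> commutes with
  \<open>c\<close>, \<open>cnorm_commuting_squares\<close> bounds the norm of \<open>1 - c^2\<close>
  by 1, and this is membership of \<open>c^2\<close> in \<open>npos\<close> with witness 1.\<close>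

lemma npos_square:
  assumes b: "b \<in> carrier A" "adj A b = b"
  shows "b \<otimes> b \<in> npos"
proof -
  define r where "r = cnorm A b + 1"
  have r: "r > 0" using b by (simp add: r_def add_nonneg_pos)
  define c where "c = complex_of_real (1 / r) \<odot> b"
  have c: "c \<in> carrier A" "adj A c = c" using b by (auto simp: c_def adj_simps)
  have cn: "cnorm A c \<le> 1"
    unfolding c_def cnorm_smult[OF b(1)] norm_of_real using b r by (simp add: r_def)
  have ccn: "cnorm A (c \<otimes> c) \<le> 1"
    using cstar_identity[OF c(1)] c cn by (simp add: power_le_one)
  have e: "\<one> \<ominus> (\<one> \<ominus> c \<otimes> c) = c \<otimes> c" using c(1) by (algebra; simp)
  obtain s where s: "s \<in> carrier A" "adj A s = s" "s \<otimes> s = \<one> \<ominus> c \<otimes> c"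
    "(\<one> \<ominus> c \<otimes> c) \<otimes> c = c \<otimes> (\<one> \<ominus> c \<otimes> c) \<longrightarrow> s \<otimes> c = c \<otimes> s"
    using cstar_sqrt[of "\<one> \<ominus> c \<otimes> c"] c e ccn by (simp add: adj_simps) blast
  have "(\<one> \<ominus> c \<otimes> c) \<otimes> c = c \<otimes> (\<one> \<ominus> c \<otimes> c)" using c(1) by (algebra; simp)
  then have sc: "s \<otimes> c = c \<otimes> s" using s by simp
  have "s \<otimes> s \<oplus> c \<otimes> c = \<one>" unfolding s(3) using c(1) by (algebra; simp)
  then have "cnorm A (s \<otimes> s) \<le> 1"
    using cnorm_commuting_squares[of s c 1] s c sc by simp
  then have "c \<otimes> c \<in> npos" using s(3) c by (auto simp: npos_def adj_simps intro!: exI[of _ 1])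
  then have "complex_of_real (r * r) \<odot> (c \<otimes> c) \<in> npos" using r by (intro npos_smult) auto
  also have "complex_of_real (r * r) \<odot> (c \<otimes> c) = b \<otimes> b"
    using b r by (simp add: c_def smult_mult_left smult_mult_right)
  finally show ?thesis .
qed

text \<open>The root \<open>d\<close> of \<open>t - a\<close> commutes with the root
  \<open>c\<close> of \<open>a\<close>, and \<open>c^2 + d^2 = t\<close>, so the norm of
  \<open>c^2 = a\<close> is at most \<open>t\<close>. Together with \<open>npos_cnorm_diff\<close>
  this translates between order bounds and norm bounds.\<close>

lemma npos_cnorm_le:
  assumes a: "a \<in> npos" and ta: "scal t \<ominus> a \<in> npos" and t: "t \<ge> 0"
  shows "cnorm A a \<le> t"
proof -
  obtain c where c: "c \<in> npos" "c \<otimes> c = a" using npos_sqrt[OF a] by blast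
  obtain d where d: "d \<in> npos" "d \<otimes> d = scal t \<ominus> a"
    "\<And>z. z \<in> carrier A \<Longrightarrow> (scal t \<ominus> a) \<otimes> z = z \<otimes> (scal t \<ominus> a)
      \<Longrightarrow> d \<otimes> z = z \<otimes> d"
    using npos_sqrt[OF ta] by blast
  have cc: "c \<in> carrier A" using c nposD by blast
  have "(scal t \<ominus> c \<otimes> c) \<otimes> c = c \<otimes> (scal t \<ominus> c \<otimes> c)"
    using cc by (simp add: minus_eq l_distr r_distr l_minus r_minus m_assoc
      smult_mult_left smult_mult_right)
  then have dc: "d \<otimes> c = c \<otimes> d" using d(3)[OF cc] by (simp only: c(2))
  have "c \<otimes> c \<oplus> d \<otimes> d = scal t"
  proof -
    have "scal t \<in> carrier A" "a \<in> carrier A" using nposD a by auto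
    then show ?thesis unfolding c(2) d(2) by (algebra; simp)
  qed
  then show ?thesis
    using cnorm_commuting_squares[OF cc nposD(2)[OF c(1)] nposD[OF d(1)] dc[symmetric] _ t] c(2) by simp
qed

lemma npos_antisym: "a \<in> npos \<Longrightarrow> \<ominus> a \<in> npos \<Longrightarrow> a = \<zero>"
  using npos_cnorm_le[of a 0] nposD(1)[of a] by (simp add: minus_eq order.antisym flip: cnorm_eq_zero)

lemma npos_cnorm_mono:
  assumes "a \<in> npos" "b \<ominus> a \<in> npos" "b \<in> npos"
  shows "cnorm A a \<le> cnorm A b"
proof (rule npos_cnorm_le[OF assms(1)])
  note c = nposD[OF assms(1)] nposD[OF assms(3)]
  have "(scal (cnorm A b) \<ominus> b) \<oplus> (b \<ominus> a) \<in> npos"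
    using assms npos_cnorm_diff[of b] c by (intro npos_add) auto
  also have "(scal (cnorm A b) \<ominus> b) \<oplus> (b \<ominus> a) = scal (cnorm A b) \<ominus> a"
  proof -
    have "scal (cnorm A b) \<in> carrier A" by auto
    then show ?thesis using c(1,3) by (algebra; simp)
  qed
  finally show "scal (cnorm A b) \<ominus> a \<in> npos" .
qed (use nposD[OF assms(3)] in auto)

text \<open>The norm \<open>M\<close> of \<open>a\<close> serves as the witness:
  \<open>M - a\<close> is positive, and so is \<open>(M + e) - (M - a) = a + e\<close>, hence the
  norm of \<open>M - a\<close> is at most \<open>M + e\<close> for every \<open>e\<close>. In effect
  the cone is closed.\<close>

lemma npos_limit:
  assumes a: "a \<in> carrier A" and pos: "\<And>e. e > 0 \<Longrightarrow> a \<oplus> scal e \<in> npos"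
  shows "a \<in> npos"
proof -
  have "\<one> \<oplus> a \<in> npos" using pos[of 1] a by (simp add: a_comm)
  then have "adj A (\<one> \<oplus> a) = \<one> \<oplus> a" using nposD by blast
  then have sa: "adj A a = a" using a by (simp add: adj_simps)
  let ?M = "cnorm A a"
  have "cnorm A (complex_of_real ?M \<odot> \<one> \<ominus> a) \<le> ?M + e" if e: "e > 0" for e
  proof (rule npos_cnorm_le)
    show "complex_of_real ?M \<odot> \<one> \<ominus> a \<in> npos" using npos_cnorm_diff[OF a sa] by simp
    have "complex_of_real ?M \<odot> \<one> \<in> carrier A" "scal e \<in> carrier A" by auto
    then have "(complex_of_real ?M \<odot> \<one> \<oplus> scal e) \<ominus> (complex_of_real ?M \<odot> \<one> \<ominus> a)
        = a \<oplus> scal e"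
      using a by (algebra; simp)
    then show "scal (?M + e) \<ominus> (complex_of_real ?M \<odot> \<one> \<ominus> a) \<in> npos"
      using pos[OF e] by (simp add: smult_add_left)
    show "?M + e \<ge> 0" using a e by simp
  qed
  then have "cnorm A (complex_of_real ?M \<odot> \<one> \<ominus> a) \<le> ?M" by (rule field_le_epsilon)
  then show ?thesis using a sa by (auto simp: npos_def intro!: exI[of _ ?M])
qed

end

section \<open>Positivity and the spectrum\<close>

context unital_cstar_algebra
begin

lemma smult_Units: "x \<in> Units A \<Longrightarrow> c \<noteq> 0 \<Longrightarrow> c \<odot> x \<in> Units A"
proof -
  assume x: "x \<in> Units A" and c: "c \<noteq> 0"
  then obtain y where y: "y \<in> carrier A" "y \<otimes> x = \<one>" "x \<otimes> y = \<one>" by (auto simp: Units_def)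
  have "((1/c) \<odot> y) \<otimes> (c \<odot> x) = \<one>" "(c \<odot> x) \<otimes> ((1/c) \<odot> y) = \<one>"
    using x y c by (auto simp: smult_mult_left smult_mult_right)
  then show ?thesis using x y unfolding Units_def by blast
qed

text \<open>The inverse \<open>z\<close> of the product yields a left inverse \<open>z y\<close> and
  a right inverse \<open>y z\<close> of \<open>x\<close>, and the two agree.\<close>

lemma Units_commuting_factor:
  assumes "x \<in> carrier A" "y \<in> carrier A" "x \<otimes> y = y \<otimes> x" "x \<otimes> y \<in> Units A"
  shows "x \<in> Units A"
proof -
  obtain z where z: "z \<in> carrier A" "z \<otimes> (x \<otimes> y) = \<one>" "(x \<otimes> y) \<otimes> z = \<one>"
    using assms(4) by (auto simp: Units_def)
  have l: "(z \<otimes> y) \<otimes> x = \<one>" using z assms(1-3) by (simp add: m_assoc)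
  have r: "x \<otimes> (y \<otimes> z) = \<one>" using z(1,3) assms(1,2) by (simp add: m_assoc)
  have "z \<otimes> y = (z \<otimes> y) \<otimes> (x \<otimes> (y \<otimes> z))" 
    using assms(1,2) z(1) by (simp only: r r_one m_closed)
  also have "\<dots> = ((z \<otimes> y) \<otimes> x) \<otimes> (y \<otimes> z)" using z(1) assms(1,2) by (simp add: m_assoc)
  also have "\<dots> = y \<otimes> z" using z(1) assms(1,2) by (simp only: l l_one m_closed)
  finally show ?thesis using l r z assms unfolding Units_def by auto
qed

text \<open>\<open>a + e\<close> equals \<open>(t + e) (1 - k)\<close> with
  \<open>k = (t - a)/(t + e)\<close>, whose norm is at most \<open>t/(t + e) < 1\<close>, so the
  Neumann series applies.\<close>

lemma npos_add_scalar_Units: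
  assumes a: "a \<in> npos" and e: "e > 0"
  shows "a \<oplus> scal e \<in> Units A"
proof -
  obtain t where t: "t \<ge> 0" "cnorm A (scal t \<ominus> a) \<le> t" and c: "a \<in> carrier A"
    using a by (auto simp: npos_def)
  let ?k = "complex_of_real (1 / (t + e)) \<odot> (scal t \<ominus> a)"
  have "cnorm A ?k = cnorm A (scal t \<ominus> a) / (t + e)"
    using t e c by (subst cnorm_smult) (simp_all del: of_real_divide)
  also have "\<dots> \<le> t / (t + e)" using t e by (intro divide_right_mono) auto
  also have "\<dots> < 1" using t e by simp
  finally have "complex_of_real (t + e) \<odot> (\<one> \<ominus> ?k) \<in> Units A"
    using c t e by (intro smult_Units neumann) (auto simp flip: of_real_add)
  also have "complex_of_real (t + e) \<odot> (\<one> \<ominus> ?k) = scal (t + e) \<ominus> (scal t \<ominus> a)"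
    using c t e by (simp add: smult_diff_right del: of_real_add of_real_divide flip: of_real_mult)
  also have "\<dots> = (scal t \<oplus> scal e) \<ominus> (scal t \<ominus> a)"
    by (simp add: smult_add_left)
  also have "\<dots> = a \<oplus> scal e"
  proof -
    have "scal t \<in> carrier A" "scal e \<in> carrier A" by auto
    then show ?thesis using c by (algebra; simp)
  qed
  finally show ?thesis .
qed

text \<open>With \<open>g = Re z - h\<close> and \<open>e = i Im z\<close>, the product
  \<open>(g + e) (g - e)\<close> is \<open>g^2 + (Im z)^2\<close>, a positive element plus a
  positive scalar and hence invertible. Its factors commute, so \<open>g + e = z - h\<close> is
  invertible too.\<close>

lemma self_adjoint_spectrum_real:
  assumes h: "h \<in> carrier A" "adj A h = h" and z: "Im z \<noteq> 0"
  shows "z \<odot> \<one> \<ominus> h \<in> Units A"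
proof -
  define g where "g = scal (Re z) \<ominus> h"
  define e where "e = (\<i> * complex_of_real (Im z)) \<odot> \<one>"
  have c: "g \<in> carrier A" "e \<in> carrier A" "adj A g = g"
    using h by (auto simp: g_def e_def adj_simps)
  have eg: "e \<otimes> g = g \<otimes> e" and ee: "e \<otimes> e = \<ominus> (scal ((Im z)\<^sup>2))"
    using c(1) by (simp_all add: e_def smult_mult_left smult_mult_right power2_eq_square
        algebra_simps flip: smult_minus_left)
  have "z \<odot> \<one> = scal (Re z) \<oplus> e"
    unfolding e_def by (subst smult_add_left[symmetric]) (simp_all flip: complex_eq)
  then have zh: "z \<odot> \<one> \<ominus> h = g \<oplus> e"
    using h c unfolding g_def by (simp add: minus_eq a_ac)
  have "(g \<oplus> e) \<otimes> (g \<ominus> e) = g \<otimes> g \<ominus> (g \<otimes> e \<ominus> e \<otimes> g) \<ominus> e \<otimes> e" using c(1,2) by (algebra; simp)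
  also have "\<dots> = g \<otimes> g \<oplus> scal ((Im z)\<^sup>2)"
    using c(1,2) unfolding eg ee by (simp add: minus_eq r_neg)
  also have "\<dots> \<in> Units A" using z c npos_square by (intro npos_add_scalar_Units) auto
  finally have u: "(g \<oplus> e) \<otimes> (g \<ominus> e) \<in> Units A" .
  have "(g \<oplus> e) \<otimes> (g \<ominus> e) = (g \<ominus> e) \<otimes> (g \<oplus> e) \<ominus> (g \<otimes> e \<ominus> e \<otimes> g) \<ominus> (g \<otimes> e \<ominus> e \<otimes> g)"
    using c(1,2) by (algebra; simp)
  also have "\<dots> = (g \<ominus> e) \<otimes> (g \<oplus> e)" using c(1,2) unfolding eg by (simp add: minus_eq r_neg)
  finally show ?thesis
    unfolding zh using Units_commuting_factor[OF a_closed minus_closed _ u] c(1,2) by blast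
qed

text \<open>Writing \<open>a = c^2\<close> and \<open>z = w^2\<close> factors \<open>z - a\<close>
  as \<open>(w - c) (w + c)\<close>. If \<open>z\<close> is not a nonnegative real, then
  \<open>w\<close> is not real, and both factors are invertible because \<open>c\<close> is
  self-adjoint.\<close>

lemma npos_imp_positive: "a \<in> npos \<Longrightarrow> a \<in> cstar_positive A"
proof -
  assume a: "a \<in> npos"
  then obtain c where "c \<in> npos" and ca: "c \<otimes> c = a" using npos_sqrt by blast
  then have c: "c \<in> carrier A" "adj A c = c" using nposD by auto
  have "z \<in> complex_of_real ` {0..}" if z: "z \<odot> \<one> \<ominus> a \<notin> Units A" for z
  proof (rule ccontr)
    assume nz: "z \<notin> complex_of_real ` {0..}"
    define w where "w = csqrt z"
    have zw: "z = w * w" by (simp add: w_def flip: power2_eq_square)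
    have "Im w \<noteq> 0"
    proof
      assume "Im w = 0"
      then have "z = complex_of_real (Re w * Re w)" by (simp add: zw complex_eq_iff)
      moreover have "Re w * Re w \<in> {0..}" by simp
      ultimately show False using nz by blast
    qed
    \<comment> \<open>The factor \<open>w + c\<close> is \<open>-(-w - c)\<close>, so the reality of
      the spectrum of \<open>c\<close> serves both factors.\<close>
    then have u: "w \<odot> \<one> \<ominus> c \<in> Units A" "\<ominus> ((- w) \<odot> \<one> \<ominus> c) \<in> Units A"
      using self_adjoint_spectrum_real[OF c] smult_Units[of "(- w) \<odot> \<one> \<ominus> c" "-1"] c
      by (auto simp: smult_minus_one)
    have "z \<odot> \<one> \<ominus> a = (w \<odot> \<one>) \<otimes> (w \<odot> \<one>) \<ominus> c \<otimes> c"
      by (simp add: ca smult_mult_left zw)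
    also have "\<dots> = (w \<odot> \<one> \<ominus> c) \<otimes> (w \<odot> \<one> \<oplus> c) \<ominus> ((w \<odot> \<one>) \<otimes> c \<ominus> c \<otimes> (w \<odot> \<one>))"
    proof -
      have "w \<odot> \<one> \<in> carrier A" by auto
      then show ?thesis using c(1) by (algebra; simp)
    qed
    also have "\<dots> = (w \<odot> \<one> \<ominus> c) \<otimes> (\<ominus> ((- w) \<odot> \<one> \<ominus> c))"
      using c(1) by (simp add: smult_mult_left smult_mult_right minus_eq r_neg minus_add smult_minus_left)
    also have "\<dots> \<in> Units A" using u by (rule Units_m_closed)
    finally show False using z by blast
  qed
  then show ?thesis using nposD[OF a] by (auto simp: cstar_positive_def self_adjoint_def cstar_spectrum_def)
qed

text \<open>Let \<open>r\<close> be the inverse of the root \<open>c\<close> of \<open>a\<close>,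
  and \<open>s\<close> a scalar above the norm of \<open>r^2\<close>. With \<open>g\<close> the root
  of \<open>s - r^2\<close>, which commutes with \<open>c\<close>, the square of \<open>c g\<close>
  is \<open>s a - 1\<close>. As the square of a self-adjoint element it is positive, so
  \<open>a\<close> is at least \<open>1/s\<close>.\<close>

lemma npos_Units_bounded_below:
  assumes a: "a \<in> npos" "a \<in> Units A"
  shows "\<exists>e>0. a \<ominus> scal e \<in> npos"
proof -
  obtain c where "c \<in> npos" and ca: "c \<otimes> c = a" using npos_sqrt a by blast
  then have c: "c \<in> carrier A" "adj A c = c" using nposD by auto
  have "c \<in> Units A" using Units_commuting_factor[OF c(1) c(1)] ca a by simp
  then obtain r where r: "r \<in> carrier A" "r \<otimes> c = \<one>" "c \<otimes> r = \<one>" by (auto simp: Units_def)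
  \<comment> \<open>Taking adjoints of \<open>r c = 1\<close> shows that \<open>adj A r\<close> is a
    right inverse of \<open>c\<close>, so it coincides with \<open>r\<close>.\<close>
  have "c \<otimes> adj A r = \<one>" using adj_mult[OF r(1) c(1)] c(2) by (simp add: r(2))
  then have "r = r \<otimes> (c \<otimes> adj A r)" using r by simp
  also have "\<dots> = (r \<otimes> c) \<otimes> adj A r" using r(1) c(1) by (simp add: m_assoc)
  also have "\<dots> = adj A r" using r by simp
  finally have ra: "adj A r = r" by simp
  define s where "s = cnorm A (r \<otimes> r) + 1"
  have s: "s > 0" using r by (simp add: s_def add_nonneg_pos)
  have "scal s \<ominus> r \<otimes> r \<in> npos"
    using npos_cnorm_diff[of "r \<otimes> r" s] r ra by (simp add: s_def adj_simps)
  then obtain g where g: "g \<in> npos" "g \<otimes> g = scal s \<ominus> r \<otimes> r"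
    "\<And>z. z \<in> carrier A \<Longrightarrow> (scal s \<ominus> r \<otimes> r) \<otimes> z = z \<otimes> (scal s \<ominus> r \<otimes> r)
      \<Longrightarrow> g \<otimes> z = z \<otimes> g"
    using npos_sqrt by blast
  then have gc: "g \<in> carrier A" "adj A g = g" using nposD by auto
  have rrc: "(r \<otimes> r) \<otimes> c = c \<otimes> (r \<otimes> r)" using r c by (metis l_one m_assoc r_one)
  have "(scal s \<ominus> r \<otimes> r) \<otimes> c = c \<otimes> (scal s \<ominus> r \<otimes> r)"
    using rrc r c by (simp add: minus_eq l_distr r_distr l_minus r_minus smult_mult_left smult_mult_right)
  then have gcom: "g \<otimes> c = c \<otimes> g" using g c by blast
  have "(c \<otimes> g) \<otimes> (c \<otimes> g) = c \<otimes> ((g \<otimes> c) \<otimes> g)" using gc c by (simp add: m_assoc)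
  also have "\<dots> = (c \<otimes> c) \<otimes> (g \<otimes> g)" unfolding gcom using gc c by (simp add: m_assoc)
  also have "\<dots> = complex_of_real s \<odot> (c \<otimes> c) \<ominus> c \<otimes> ((c \<otimes> r) \<otimes> r)"
    unfolding g(2) using r(1) c(1) by (simp add: minus_eq r_distr r_minus smult_mult_right m_assoc)
  also have "\<dots> = complex_of_real s \<odot> a \<ominus> \<one>" using r by (simp add: ca)
  finally have "complex_of_real s \<odot> a \<ominus> \<one> \<in> npos"
    using npos_square[of "c \<otimes> g"] c gc gcom by (simp add: adj_simps)
  then have "complex_of_real (1/s) \<odot> (complex_of_real s \<odot> a \<ominus> \<one>) \<in> npos"
    using s by (intro npos_smult) auto
  then have "a \<ominus> scal (1/s) \<in> npos"
    using s nposD[OF a(1)] by (simp add: smult_diff_right)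
  then show ?thesis using s by (intro exI[of _ "1/s"]) auto
qed

text \<open>The set of \<open>t \<ge> 0\<close> with \<open>a + t\<close> in the cone has an infimum
  \<open>t0\<close>, attained because the cone is closed. If \<open>t0 > 0\<close>, then
  \<open>- t0\<close> lies outside the spectrum, so \<open>a + t0\<close> is invertible, and by
  \<open>npos_Units_bounded_below\<close> some \<open>e > 0\<close> can still be subtracted, against
  minimality.\<close>

lemma positive_imp_npos: "a \<in> cstar_positive A \<Longrightarrow> a \<in> npos"
proof -
  assume "a \<in> cstar_positive A"
  then have a: "a \<in> carrier A" "adj A a = a"
    and sp: "\<And>z. z \<odot> \<one> \<ominus> a \<notin> Units A \<Longrightarrow> z \<in> complex_of_real ` {0..}"
    by (auto simp: cstar_positive_def self_adjoint_def cstar_spectrum_def)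
  let ?f = "\<lambda>t. a \<oplus> scal t"
  have fadd: "?f (s + t) = ?f s \<oplus> scal t" for s t
    using a by (simp add: smult_add_left a_assoc)
  define T where "T = {t. t \<ge> 0 \<and> ?f t \<in> npos}"
  have "scal (cnorm A a) \<ominus> (\<ominus> a) \<in> npos"
    using npos_cnorm_diff[of "\<ominus> a"] a by (simp add: adj_simps)
  then have ne: "cnorm A a \<in> T" using a by (simp add: T_def minus_eq a_comm)
  have bdd: "bdd_below T" by (auto simp: T_def bdd_below_def)
  define t0 where "t0 = Inf T"
  have t0: "t0 \<ge> 0" unfolding t0_def using ne by (intro cInf_greatest) (auto simp: T_def)
  have f0: "?f t0 \<in> npos"
  proof (rule npos_limit)
    fix e :: real assume "e > 0"
    then have "Inf T < t0 + e" by (simp add: t0_def)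
    then obtain t where t: "t \<in> T" "t < t0 + e" using ne bdd by (subst (asm) cInf_less_iff) auto
    then have "?f t \<in> npos" by (auto simp: T_def)
    from npos_add[OF this npos_scalar, of "t0 + e - t"] t
    have "?f t \<oplus> scal (t0 + e - t) \<in> npos" by simp
    then show "?f t0 \<oplus> scal e \<in> npos" by (simp only: fadd[symmetric]) simp
  qed (use a in auto)
  have "t0 = 0"
  proof (rule ccontr)
    assume "t0 \<noteq> 0"
    then have tp: "t0 > 0" using t0 by simp
    have "(- complex_of_real t0) \<odot> \<one> \<ominus> a \<in> Units A"
    proof (rule ccontr)
      assume "(- complex_of_real t0) \<odot> \<one> \<ominus> a \<notin> Units A"
      then obtain s where "- complex_of_real t0 = complex_of_real s" "s \<ge> 0" using sp by force
      then have "- t0 = s" by (metis of_real_eq_iff of_real_minus)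
      then show False using tp \<open>s \<ge> 0\<close> by simp
    qed
    then have "(-1) \<odot> ((- complex_of_real t0) \<odot> \<one> \<ominus> a) \<in> Units A" by (intro smult_Units) auto
    also have "(-1) \<odot> ((- complex_of_real t0) \<odot> \<one> \<ominus> a) = ?f t0"
      using a by (simp add: smult_minus_one smult_minus_left minus_add minus_eq a_comm)
    finally obtain e where e: "e > 0" "?f t0 \<ominus> scal e \<in> npos"
      using npos_Units_bounded_below[OF f0] by blast
    have "?f t0 \<ominus> scal e = ?f (t0 - e)"
      using a by (simp add: smult_diff_left minus_eq a_assoc)
    then have ft: "?f (t0 - e) \<in> npos" using e by simp
    \<comment> \<open>\<open>t0 - e\<close> may be negative, while \<open>T\<close> contains only
      nonnegative numbers.\<close>
    define t1 where "t1 = max 0 (t0 - e)"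
    have "?f (t0 - e) \<oplus> scal (t1 - (t0 - e)) \<in> npos"
      by (rule npos_add[OF ft npos_scalar]) (auto simp: t1_def)
    then have "?f t1 \<in> npos" by (simp only: fadd[symmetric]) simp
    then have "t1 \<in> T" by (auto simp: T_def t1_def)
    then have "t0 \<le> t1" unfolding t0_def using bdd by (rule cInf_lower)
    then show False using e tp by (auto simp: t1_def max_def split: if_splits)
  qed
  then show ?thesis using f0 a by simp
qed

lemma positive_eq_npos: "cstar_positive A = npos"
  using npos_imp_positive positive_imp_npos by blast

text \<open>With \<open>d = |h| - h\<close> one has \<open>d h d = - |h| d\<^sup>2\<close>; this avoids a functional calculus for the
  negative part of \<open>h\<close>.\<close>

lemma negative_part:
  assumes h: "h \<in> carrier A" "adj A h = h"
  shows "\<exists>d\<in>carrier A. \<exists>w\<in>carrier A. adj A d = d \<and> adj A w = w \<and>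
    d \<otimes> h \<otimes> d = \<ominus> (w \<otimes> w) \<and> (w = \<zero> \<longrightarrow> h \<in> npos)"
proof -
  obtain m where m: "m \<in> npos" "m \<otimes> m = h \<otimes> h"
    "\<And>z. z \<in> carrier A \<Longrightarrow> h \<otimes> h \<otimes> z = z \<otimes> (h \<otimes> h) \<Longrightarrow> m \<otimes> z = z \<otimes> m"
    using npos_sqrt[OF npos_square[OF h]] by blast
  have mc: "m \<in> carrier A" "adj A m = m" using m nposD by auto
  have mh: "m \<otimes> h = h \<otimes> m" using m(3)[OF h(1)] h by (simp add: m_assoc)
  \<comment> \<open>The root \<open>q\<close> of the modulus \<open>m\<close> turns
    \<open>m d^2\<close> into the square of the self-adjoint element \<open>q d\<close>.\<close>
  obtain q where q: "q \<in> npos" "q \<otimes> q = m"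
    "\<And>z. z \<in> carrier A \<Longrightarrow> m \<otimes> z = z \<otimes> m \<Longrightarrow> q \<otimes> z = z \<otimes> q"
    using npos_sqrt[OF m(1)] by blast
  have qc: "q \<in> carrier A" "adj A q = q" using q nposD by auto
  have qh: "q \<otimes> h = h \<otimes> q" using q(3)[OF h(1) mh] .
  have qm: "q \<otimes> m = m \<otimes> q" using q(3)[OF mc(1)] by simp
  define d where "d = m \<ominus> h"
  have dc: "d \<in> carrier A" "adj A d = d" using mc h by (auto simp: d_def adj_simps)
  have qd: "q \<otimes> d = d \<otimes> q"
    using qh qm qc mc h by (simp add: d_def minus_eq l_distr r_distr l_minus r_minus)
  have hd: "h \<otimes> d = \<ominus> (m \<otimes> d)"
  proof -
    have "h \<otimes> d = h \<otimes> m \<ominus> h \<otimes> h" unfolding d_def using mc(1) h(1) by (algebra; simp)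
    also have "\<dots> = m \<otimes> h \<ominus> m \<otimes> m" by (simp add: mh m(2))
    also have "\<dots> = \<ominus> (m \<otimes> d)" unfolding d_def using mc(1) h(1) by (algebra; simp)
    finally show ?thesis .
  qed
  have md: "m \<otimes> d = d \<otimes> m" using mh mc h by (simp add: d_def minus_eq l_distr r_distr l_minus r_minus)
  have dd: "d \<otimes> d = m \<otimes> d \<oplus> m \<otimes> d"
  proof -
    have "d \<otimes> d = m \<otimes> d \<ominus> h \<otimes> d" unfolding d_def using mc(1) h(1) by (algebra; simp)
    also have "\<dots> = m \<otimes> d \<oplus> m \<otimes> d" unfolding hd using mc(1) dc(1) by (algebra; simp)
    finally show ?thesis .
  qed
  define w where "w = q \<otimes> d"
  have wc: "w \<in> carrier A" "adj A w = w" using qc dc qd by (auto simp: w_def adj_simps)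
  have ww: "w \<otimes> w = m \<otimes> d \<otimes> d"
  proof -
    have "w \<otimes> w = q \<otimes> ((d \<otimes> q) \<otimes> d)" using qc dc by (simp add: w_def m_assoc)
    also have "\<dots> = (q \<otimes> q) \<otimes> d \<otimes> d" unfolding qd[symmetric] using qc dc by (simp add: m_assoc)
    finally show ?thesis by (simp add: q(2))
  qed
  have "d \<otimes> h \<otimes> d = d \<otimes> (h \<otimes> d)" using dc h by (simp add: m_assoc)
  also have "\<dots> = \<ominus> ((d \<otimes> m) \<otimes> d)" unfolding hd using dc mc by (simp add: r_minus m_assoc)
  finally have dhd: "d \<otimes> h \<otimes> d = \<ominus> (w \<otimes> w)" by (simp add: ww md)
  \<comment> \<open>Here \<open>d^3\<close> is twice \<open>m d^2 = w^2 = 0\<close>. The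
    C*-identity, used twice, passes from \<open>d^4 = 0\<close> to \<open>d = 0\<close>, so
    \<open>h\<close> equals its modulus \<open>m\<close>.\<close>
  have "h \<in> npos" if "w = \<zero>"
  proof -
    have z: "m \<otimes> d \<otimes> d = \<zero>" using ww that by simp
    have "d \<otimes> d \<otimes> d = m \<otimes> d \<otimes> d \<oplus> m \<otimes> d \<otimes> d" unfolding dd using mc dc by (simp add: l_distr)
    then have "d \<otimes> d \<otimes> d = \<zero>" by (simp add: z)
    then have "(d \<otimes> d) \<otimes> (d \<otimes> d) = \<zero>" using dc by (metis m_assoc m_closed r_null)
    then have "d \<otimes> d = \<zero>" using cstar_identity[of "d \<otimes> d"] dc by (simp add: adj_simps cnorm_eq_zero)
    then have "d = \<zero>" using cstar_identity[of d] dc by (simp add: cnorm_eq_zero)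
    then have "m = h" using diff_eq_zero mc h by (simp add: d_def)
    then show ?thesis using m by simp
  qed
  then show ?thesis using dc wc dhd by blast
qed

text \<open>If \<open>g\<close> inverts \<open>c - x y\<close>, then \<open>(1 + y g x)/c\<close>
  inverts \<open>c - y x\<close>. The identities \<open>g1\<close> and \<open>g2\<close> expand
  \<open>c g\<close> so that the remaining terms cancel on either side.\<close>

lemma spectrum_switch:
  assumes xy: "x \<in> carrier A" "y \<in> carrier A" and c: "c \<noteq> 0" and u: "c \<odot> \<one> \<ominus> x \<otimes> y \<in> Units A"
  shows "c \<odot> \<one> \<ominus> y \<otimes> x \<in> Units A"
proof -
  obtain g where g: "g \<in> carrier A" "g \<otimes> (c \<odot> \<one> \<ominus> x \<otimes> y) = \<one>" "(c \<odot> \<one> \<ominus> x \<otimes> y) \<otimes> g = \<one>"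
    using u by (auto simp: Units_def)
  have g1: "c \<odot> g = \<one> \<oplus> g \<otimes> (x \<otimes> y)"
  proof -
    have "c \<odot> g = g \<otimes> (c \<odot> \<one> \<ominus> x \<otimes> y) \<oplus> g \<otimes> (x \<otimes> y)"
      using g(1) xy by (simp add: minus_eq r_distr r_minus smult_mult_right a_assoc l_neg)
    then show ?thesis unfolding g(2) .
  qed
  have g2: "c \<odot> g = \<one> \<oplus> (x \<otimes> y) \<otimes> g"
  proof -
    have "c \<odot> g = (c \<odot> \<one> \<ominus> x \<otimes> y) \<otimes> g \<oplus> (x \<otimes> y) \<otimes> g"
      using g(1) xy by (simp add: minus_eq l_distr l_minus smult_mult_left a_assoc l_neg)
    then show ?thesis unfolding g(3) .
  qed
  have cancel: "u \<oplus> (p \<oplus> q) \<ominus> p \<ominus> q = u"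
    if "u \<in> carrier A" "p \<in> carrier A" "q \<in> carrier A" for u p q
    using that by algebra
  define k where "k = \<one> \<oplus> y \<otimes> g \<otimes> x"
  have kc: "k \<in> carrier A" using g xy by (simp add: k_def)
  have "(c \<odot> \<one> \<ominus> y \<otimes> x) \<otimes> k = c \<odot> \<one> \<oplus> y \<otimes> (c \<odot> g) \<otimes> x \<ominus> y \<otimes> x \<ominus> y \<otimes> ((x \<otimes> y) \<otimes> g) \<otimes> x"
    unfolding k_def using g(1) xy
    by (simp add: minus_eq l_distr r_distr l_minus r_minus smult_mult_left smult_mult_right
        smult_add_right m_assoc minus_add a_ac)
  also have "\<dots> = c \<odot> \<one>" unfolding g2
  proof -
    have "c \<odot> \<one> \<in> carrier A" by auto
    then show "c \<odot> \<one> \<oplus> y \<otimes> (\<one> \<oplus> x \<otimes> y \<otimes> g) \<otimes> x \<ominus> y \<otimes> x \<ominus> y \<otimes> (x \<otimes> y \<otimes> g) \<otimes> x = c \<odot> \<one>"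
      using g(1) xy cancel[of "c \<odot> \<one>" "y \<otimes> x"] by (simp add: l_distr r_distr)
  qed
  finally have r: "(c \<odot> \<one> \<ominus> y \<otimes> x) \<otimes> k = c \<odot> \<one>" .
  have "k \<otimes> (c \<odot> \<one> \<ominus> y \<otimes> x) = c \<odot> \<one> \<oplus> y \<otimes> (c \<odot> g) \<otimes> x \<ominus> y \<otimes> x \<ominus> y \<otimes> (g \<otimes> (x \<otimes> y)) \<otimes> x"
    unfolding k_def using g(1) xy
    by (simp add: minus_eq l_distr r_distr l_minus r_minus smult_mult_left smult_mult_right
        smult_add_right m_assoc minus_add a_ac)
  also have "\<dots> = c \<odot> \<one>" unfolding g1
  proof -
    have "c \<odot> \<one> \<in> carrier A" by auto
    then show "c \<odot> \<one> \<oplus> y \<otimes> (\<one> \<oplus> g \<otimes> (x \<otimes> y)) \<otimes> x \<ominus> y \<otimes> x \<ominus> y \<otimes> (g \<otimes> (x \<otimes> y)) \<otimes> x = c \<odot> \<one>"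
      using g(1) xy cancel[of "c \<odot> \<one>" "y \<otimes> x"] by (simp add: l_distr r_distr)
  qed
  finally have l: "k \<otimes> (c \<odot> \<one> \<ominus> y \<otimes> x) = c \<odot> \<one>" .
  have "((1/c) \<odot> k) \<otimes> (c \<odot> \<one> \<ominus> y \<otimes> x) = \<one>" "(c \<odot> \<one> \<ominus> y \<otimes> x) \<otimes> ((1/c) \<odot> k) = \<one>"
    using l r kc c xy by (simp_all add: smult_mult_left smult_mult_right)
  then show ?thesis using kc xy unfolding Units_def by blast
qed

text \<open>The spectra of the two products agree apart from 0, and 0 is an admissible spectral
  value. Here positivity is used in its spectral form.\<close>

lemma npos_mult_adj_switch:
  assumes z: "z \<in> carrier A" "z \<otimes> adj A z \<in> npos"
  shows "adj A z \<otimes> z \<in> npos"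
proof (rule positive_imp_npos)
  have sp: "c \<in> complex_of_real ` {0..}" if "c \<odot> \<one> \<ominus> z \<otimes> adj A z \<notin> Units A" for c
    using npos_imp_positive[OF z(2)] that by (auto simp: cstar_positive_def cstar_spectrum_def)
  have "c \<in> complex_of_real ` {0..}" if c: "c \<odot> \<one> \<ominus> adj A z \<otimes> z \<notin> Units A" for c
  proof (cases "c = 0")
    case False
    then show ?thesis using c spectrum_switch[of z "adj A z" c] z sp by blast
  qed auto
  then show "adj A z \<otimes> z \<in> cstar_positive A"
    using z by (auto simp: cstar_positive_def cstar_spectrum_def self_adjoint_def adj_simps)
qed

text \<open>Cutting \<open>x\<close> by the \<open>d\<close> of \<open>negative_part\<close> gives
  \<open>z = x d\<close> with \<open>adj z z = - w^2\<close>. Up to a positive factor,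
  \<open>z adj z + adj z z\<close> is the sum of the squares of the real and imaginary parts of
  \<open>z\<close>, so \<open>z adj z\<close> is positive. Switching the factors,
  \<open>- w^2\<close> is positive as well; hence \<open>w = 0\<close>, and \<open>adj x x\<close>
  has no negative part.\<close>

theorem npos_adj_mult:
  assumes x: "x \<in> carrier A"
  shows "adj A x \<otimes> x \<in> npos"
proof -
  define h where "h = adj A x \<otimes> x"
  have h: "h \<in> carrier A" "adj A h = h" using x by (auto simp: h_def adj_simps)
  obtain d w where d: "d \<in> carrier A" "adj A d = d" and w: "w \<in> carrier A" "adj A w = w"
    and dhd: "d \<otimes> h \<otimes> d = \<ominus> (w \<otimes> w)" and wz: "w = \<zero> \<longrightarrow> h \<in> npos"
    using negative_part[OF h] by blast
  define z where "z = x \<otimes> d"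
  have zc: "z \<in> carrier A" using x d by (simp add: z_def)
  define y where "y = adj A z"
  have yc: "y \<in> carrier A" "adj A y = z" "adj A z = y" using zc by (simp_all add: y_def)
  have yz: "y \<otimes> z = \<ominus> (w \<otimes> w)"
    using x d by (simp add: dhd[symmetric] y_def z_def h_def adj_simps m_assoc)
  \<comment> \<open>\<open>p\<close> is twice the real part of \<open>z\<close>, and
    \<open>q\<close> is minus twice its imaginary part.\<close>
  define p where "p = z \<oplus> y"
  define q where "q = \<i> \<odot> (z \<ominus> y)"
  have pq: "p \<in> carrier A" "adj A p = p" "q \<in> carrier A" "adj A q = q"
  proof -
    have "\<ominus> (y \<ominus> z) = z \<ominus> y" using zc yc by (algebra; simp)
    then show "p \<in> carrier A" "adj A p = p" "q \<in> carrier A" "adj A q = q"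
      using zc yc by (auto simp: p_def q_def adj_simps smult_minus_left smult_minus_right[symmetric] a_comm)
  qed
  have qq: "q \<otimes> q = \<ominus> ((z \<ominus> y) \<otimes> (z \<ominus> y))"
    using zc yc by (simp add: q_def smult_mult_left smult_mult_right smult_minus_one)
  have "p \<otimes> p \<oplus> q \<otimes> q = (z \<otimes> y \<oplus> z \<otimes> y) \<oplus> (y \<otimes> z \<oplus> y \<otimes> z)"
    unfolding qq unfolding p_def using zc yc(1) by (algebra; simp)
  then have "(p \<otimes> p \<oplus> q \<otimes> q) \<oplus> (w \<otimes> w \<oplus> w \<otimes> w)
      = (z \<otimes> y \<oplus> z \<otimes> y) \<oplus> (\<ominus> (w \<otimes> w) \<oplus> \<ominus> (w \<otimes> w)) \<oplus> (w \<otimes> w \<oplus> w \<otimes> w)"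
    by (simp add: yz)
  also have "\<dots> = z \<otimes> y \<oplus> z \<otimes> y" using zc yc(1) w(1) by (algebra; simp)
  also have "\<dots> = 2 \<odot> (z \<otimes> y)" using zc yc by (simp add: smult_two)
  finally have "2 \<odot> (z \<otimes> y) \<in> npos"
    using pq w by (metis npos_add npos_square)
  from npos_smult[OF this, of "1/2"] have "z \<otimes> y \<in> npos" using zc yc by simp
  then have "y \<otimes> z \<in> npos" using npos_mult_adj_switch[OF zc] by (simp add: y_def)
  then have "\<ominus> (w \<otimes> w) \<in> npos" by (simp add: yz)
  then have "w \<otimes> w = \<zero>" using npos_square[OF w] npos_antisym by blast
  then have "w = \<zero>" using cstar_identity[OF w(1)] w by (simp add: cnorm_eq_zero)
  then show ?thesis using wz by (simp add: h_def)
qed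

lemma npos_conj:
  assumes "a \<in> npos" "x \<in> carrier A"
  shows "adj A x \<otimes> a \<otimes> x \<in> npos"
proof -
  obtain c where c: "c \<in> npos" "c \<otimes> c = a" using npos_sqrt assms by blast
  then have cc: "c \<in> carrier A" "adj A c = c" using nposD by auto
  have "adj A x \<otimes> a \<otimes> x = adj A (c \<otimes> x) \<otimes> (c \<otimes> x)"
    using cc c(2)[symmetric] assms(2) by (simp add: adj_simps m_assoc)
  then show ?thesis using npos_adj_mult cc assms by simp
qed

end

section \<open>Columns and rectangular matrices\<close>

text \<open>\<open>mats\<close> covers square matrices, while the isometry of a compression has
  different numbers of rows and columns.\<close>

definition rmats :: "nat \<Rightarrow> nat \<Rightarrow> 'a set \<Rightarrow> (nat \<times> nat \<Rightarrow> 'a) set"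
  where "rmats p q E = ({..<p} \<times> {..<q}) \<rightarrow>\<^sub>E E"

lemma mats_eq_rmats: "mats m E = rmats m m E"
  by (simp add: mats_def rmats_def)

lemma rmatsD: "x \<in> rmats p q E \<Longrightarrow> i < p \<Longrightarrow> j < q \<Longrightarrow> x (i, j) \<in> E"
  by (auto simp: rmats_def PiE_iff)

lemma rmats_eqI:
  "x \<in> rmats p q E \<Longrightarrow> y \<in> rmats p q F \<Longrightarrow> (\<And>i j. i < p \<Longrightarrow> j < q \<Longrightarrow> x (i, j) = y (i, j)) \<Longrightarrow> x = y"
  unfolding rmats_def by (rule PiE_ext) (auto simp: PiE_iff)

lemma rmats_mono: "E \<subseteq> F \<Longrightarrow> rmats p q E \<subseteq> rmats p q F"
  unfolding rmats_def by (rule PiE_mono) auto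

context unital_cstar_algebra
begin

abbreviation Mat :: "nat \<Rightarrow> (nat \<times> nat \<Rightarrow> 'a) cstar"
  where "Mat m \<equiv> matrix_algebra m A"

abbreviation Rect :: "nat \<Rightarrow> nat \<Rightarrow> (nat \<times> nat \<Rightarrow> 'a) set"
  where "Rect p q \<equiv> rmats p q (carrier A)"

text \<open>The function space is not extensional, so that pointwise expressions in columns are
  columns again without a restriction.\<close>

abbreviation Cols :: "nat \<Rightarrow> (nat \<Rightarrow> 'a) set"
  where "Cols p \<equiv> {..<p} \<rightarrow> carrier A"

section \<open>Finite sums in the algebra\<close>

lemma finsum_swap:
  assumes "finite I" "finite J" "\<And>i j. i \<in> I \<Longrightarrow> j \<in> J \<Longrightarrow> f i j \<in> carrier A"
  shows "(\<Oplus>i\<in>I. \<Oplus>j\<in>J. f i j) = (\<Oplus>j\<in>J. \<Oplus>i\<in>I. f i j)"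
  using assms(1,3)
proof (induction I rule: finite_induct)
  case (insert x I)
  have c: "(\<lambda>j. f i j) \<in> J \<rightarrow> carrier A" if "i \<in> insert x I" for i using insert.prems that by auto
  have "(\<Oplus>i\<in>insert x I. \<Oplus>j\<in>J. f i j) = (\<Oplus>j\<in>J. f x j) \<oplus> (\<Oplus>i\<in>I. \<Oplus>j\<in>J. f i j)"
    using insert c by (intro finsum_insert) (auto intro!: finsum_closed)
  also have "(\<Oplus>i\<in>I. \<Oplus>j\<in>J. f i j) = (\<Oplus>j\<in>J. \<Oplus>i\<in>I. f i j)" using insert by auto
  also have "(\<Oplus>j\<in>J. f x j) \<oplus> \<dots> = (\<Oplus>j\<in>J. f x j \<oplus> (\<Oplus>i\<in>I. f i j))"
    using insert.prems by (intro finsum_addf[symmetric]) (auto intro!: finsum_closed)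
  also have "\<dots> = (\<Oplus>j\<in>J. \<Oplus>i\<in>insert x I. f i j)"
    using insert by (intro finsum_cong' finsum_insert[symmetric]) (auto intro!: finsum_closed)
  finally show ?case .
qed (simp add: finsum_zero)

lemma finsum_smult:
  assumes "finite I" "f \<in> I \<rightarrow> carrier A"
  shows "c \<odot> (\<Oplus>i\<in>I. f i) = (\<Oplus>i\<in>I. c \<odot> f i)"
  using assms by (induction I rule: finite_induct) (auto simp: smult_add_right Pi_iff)

lemma finsum_adj:
  assumes "finite I" "f \<in> I \<rightarrow> carrier A"
  shows "adj A (\<Oplus>i\<in>I. f i) = (\<Oplus>i\<in>I. adj A (f i))"
  using assms by (induction I rule: finite_induct) (auto simp: adj_add Pi_iff)

lemma cnorm_finsum_le:
  assumes "finite I" "f \<in> I \<rightarrow> carrier A"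
  shows "cnorm A (\<Oplus>i\<in>I. f i) \<le> (\<Sum>i\<in>I. cnorm A (f i))"
  using assms
proof (induction I rule: finite_induct)
  case (insert x I)
  then show ?case
    using cnorm_triangle[of "f x" "\<Oplus>i\<in>I. f i"] by (auto simp: Pi_iff finsum_insert)
qed simp

lemma npos_finsum:
  assumes "finite I" "f \<in> I \<rightarrow> npos"
  shows "(\<Oplus>i\<in>I. f i) \<in> npos"
  using assms
proof (induction I rule: finite_induct)
  case (insert x I)
  then show ?case using npos_add nposD(1) by (auto simp: Pi_iff finsum_insert)
qed (simp add: npos_zero)

lemma finsum_delta:
  assumes "finite I" "i \<in> I" "f \<in> I \<rightarrow> carrier A"
  shows "(\<Oplus>j\<in>I. if j = i then f j else \<zero>) = f i"
  using add.finprod_singleton_swap[of i I f] assms by simp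

text \<open>Associativity of matrix products, compatibility of the action on columns with products,
  and adjointness of \<open>x\<close> and \<open>radj p q x\<close> for the inner product all reduce
  to this exchange of sums.\<close>

lemma finsum_assoc:
  assumes "\<And>i. i < p \<Longrightarrow> a i \<in> carrier A" "\<And>i j. i < p \<Longrightarrow> j < q \<Longrightarrow> b i j \<in> carrier A"
    "\<And>j. j < q \<Longrightarrow> c j \<in> carrier A"
  shows "(\<Oplus>i\<in>{..<p::nat}. a i \<otimes> (\<Oplus>j\<in>{..<q::nat}. b i j \<otimes> c j))
    = (\<Oplus>j\<in>{..<q}. (\<Oplus>i\<in>{..<p}. a i \<otimes> b i j) \<otimes> c j)"
proof -
  have "(\<Oplus>i\<in>{..<p}. a i \<otimes> (\<Oplus>j\<in>{..<q}. b i j \<otimes> c j))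
      = (\<Oplus>i\<in>{..<p}. \<Oplus>j\<in>{..<q}. a i \<otimes> b i j \<otimes> c j)"
  proof (intro finsum_cong' refl)
    fix i assume i: "i \<in> {..<p}"
    have "a i \<otimes> (\<Oplus>j\<in>{..<q}. b i j \<otimes> c j) = (\<Oplus>j\<in>{..<q}. a i \<otimes> (b i j \<otimes> c j))"
      using assms i by (intro finsum_rdistr) auto
    also have "\<dots> = (\<Oplus>j\<in>{..<q}. a i \<otimes> b i j \<otimes> c j)"
      using assms i by (intro finsum_cong') (auto simp: m_assoc)
    finally show "a i \<otimes> (\<Oplus>j\<in>{..<q}. b i j \<otimes> c j) = (\<Oplus>j\<in>{..<q}. a i \<otimes> b i j \<otimes> c j)" .
  qed (use assms in \<open>auto intro!: finsum_closed\<close>)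
  also have "\<dots> = (\<Oplus>j\<in>{..<q}. \<Oplus>i\<in>{..<p}. a i \<otimes> b i j \<otimes> c j)"
    using assms by (intro finsum_swap) auto
  also have "\<dots> = (\<Oplus>j\<in>{..<q}. (\<Oplus>i\<in>{..<p}. a i \<otimes> b i j) \<otimes> c j)"
    using assms by (intro finsum_cong') (auto simp: finsum_ldistr intro!: finsum_closed)
  finally show ?thesis .
qed

text \<open>The shapes are arguments because a function on index pairs does not carry them.\<close>

definition rmul :: "nat \<Rightarrow> nat \<Rightarrow> nat \<Rightarrow> (nat \<times> nat \<Rightarrow> 'a) \<Rightarrow> (nat \<times> nat \<Rightarrow> 'a) \<Rightarrow> nat \<times> nat \<Rightarrow> 'a"
  where "rmul p q r x y = (\<lambda>(i, j)\<in>{..<p} \<times> {..<r}. \<Oplus>l\<in>{..<q}. x (i, l) \<otimes> y (l, j))"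

definition radj :: "nat \<Rightarrow> nat \<Rightarrow> (nat \<times> nat \<Rightarrow> 'a) \<Rightarrow> nat \<times> nat \<Rightarrow> 'a"
  where "radj p q x = (\<lambda>(i, j)\<in>{..<q} \<times> {..<p}. adj A (x (j, i)))"

definition ract :: "nat \<Rightarrow> nat \<Rightarrow> (nat \<times> nat \<Rightarrow> 'a) \<Rightarrow> (nat \<Rightarrow> 'a) \<Rightarrow> nat \<Rightarrow> 'a"
  where "ract p q x v = (\<lambda>i\<in>{..<p}. \<Oplus>j\<in>{..<q}. x (i, j) \<otimes> v j)"

definition rinner :: "nat \<Rightarrow> (nat \<Rightarrow> 'a) \<Rightarrow> (nat \<Rightarrow> 'a) \<Rightarrow> 'a"
  where "rinner p v w = (\<Oplus>i\<in>{..<p}. adj A (v i) \<otimes> w i)"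

lemma rmul_entry: "i < p \<Longrightarrow> j < r \<Longrightarrow> rmul p q r x y (i, j) = (\<Oplus>l\<in>{..<q}. x (i, l) \<otimes> y (l, j))"
  by (simp add: rmul_def)

lemma radj_entry [simp]: "i < q \<Longrightarrow> j < p \<Longrightarrow> radj p q x (i, j) = adj A (x (j, i))"
  by (simp add: radj_def)

lemma ract_entry: "i < p \<Longrightarrow> ract p q x v i = (\<Oplus>j\<in>{..<q}. x (i, j) \<otimes> v j)"
  by (simp add: ract_def)

lemma rmul_closed [simp, intro]:
  "x \<in> Rect p q \<Longrightarrow> y \<in> Rect q r \<Longrightarrow> rmul p q r x y \<in> Rect p r"
  by (auto simp: rmats_def rmul_def PiE_iff intro!: finsum_closed)

lemma radj_closed [simp, intro]: "x \<in> Rect p q \<Longrightarrow> radj p q x \<in> Rect q p"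
  by (auto simp: rmats_def radj_def PiE_iff)

lemma ract_closed [simp, intro]:
  "x \<in> Rect p q \<Longrightarrow> v \<in> Cols q \<Longrightarrow> ract p q x v \<in> Cols p"
  by (auto simp: rmats_def ract_def PiE_iff Pi_iff intro!: finsum_closed)

lemma rinner_closed [simp, intro]:
  "v \<in> Cols p \<Longrightarrow> w \<in> Cols p \<Longrightarrow> rinner p v w \<in> carrier A"
  by (auto simp: rinner_def Pi_iff intro!: finsum_closed)

lemma radj_radj [simp]: "x \<in> Rect p q \<Longrightarrow> radj q p (radj p q x) = x"
  by (rule rmats_eqI[of _ p q "carrier A" _ "carrier A"]) (auto simp: rmatsD)

lemma rmul_assoc:
  assumes "x \<in> Rect p q" "y \<in> Rect q r" "z \<in> Rect r s"
  shows "rmul p r s (rmul p q r x y) z = rmul p q s x (rmul q r s y z)"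
proof (rule rmats_eqI[of _ p s "carrier A" _ "carrier A"])
  fix i j assume ij: "i < p" "j < s"
  have "rmul p r s (rmul p q r x y) z (i, j)
      = (\<Oplus>l\<in>{..<r}. (\<Oplus>k\<in>{..<q}. x (i, k) \<otimes> y (k, l)) \<otimes> z (l, j))"
    using assms ij by (subst rmul_entry) (auto simp: rmul_entry rmatsD intro!: finsum_cong' finsum_closed)
  also have "\<dots> = (\<Oplus>k\<in>{..<q}. x (i, k) \<otimes> (\<Oplus>l\<in>{..<r}. y (k, l) \<otimes> z (l, j)))"
    using assms ij by (intro finsum_assoc[symmetric]) (auto simp: rmatsD)
  also have "\<dots> = rmul p q s x (rmul q r s y z) (i, j)"
    using assms ij by (subst rmul_entry) (auto simp: rmul_entry rmatsD intro!: finsum_cong' finsum_closed)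
  finally show "rmul p r s (rmul p q r x y) z (i, j) = rmul p q s x (rmul q r s y z) (i, j)" .
qed (use assms in auto)

lemma ract_ract:
  assumes "x \<in> Rect p q" "y \<in> Rect q r" "v \<in> Cols r"
  shows "ract p q x (ract q r y v) = ract p r (rmul p q r x y) v"
proof
  fix i
  show "ract p q x (ract q r y v) i = ract p r (rmul p q r x y) v i"
  proof (cases "i < p")
    case True
    have "ract p q x (ract q r y v) i = (\<Oplus>k\<in>{..<q}. x (i, k) \<otimes> (\<Oplus>l\<in>{..<r}. y (k, l) \<otimes> v l))"
      using assms True
      by (subst ract_entry) (auto simp: ract_entry rmatsD Pi_iff intro!: finsum_cong' finsum_closed)
    also have "\<dots> = (\<Oplus>l\<in>{..<r}. (\<Oplus>k\<in>{..<q}. x (i, k) \<otimes> y (k, l)) \<otimes> v l)"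
      using assms True by (intro finsum_assoc) (auto simp: rmatsD)
    also have "\<dots> = ract p r (rmul p q r x y) v i"
      using assms True
      by (subst ract_entry) (auto simp: rmul_entry rmatsD Pi_iff intro!: finsum_cong' finsum_closed)
    finally show ?thesis .
  qed (simp add: ract_def)
qed

lemma radj_rmul:
  assumes "x \<in> Rect p q" "y \<in> Rect q r"
  shows "radj p r (rmul p q r x y) = rmul r q p (radj q r y) (radj p q x)"
proof (rule rmats_eqI[of _ r p "carrier A" _ "carrier A"])
  fix i j assume ij: "i < r" "j < p"
  have "radj p r (rmul p q r x y) (i, j) = adj A (\<Oplus>l\<in>{..<q}. x (j, l) \<otimes> y (l, i))"
    using ij by (simp add: rmul_entry)
  also have "\<dots> = (\<Oplus>l\<in>{..<q}. adj A (x (j, l) \<otimes> y (l, i)))"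
    using assms ij by (intro finsum_adj) (auto simp: rmatsD)
  also have "\<dots> = (\<Oplus>l\<in>{..<q}. radj q r y (i, l) \<otimes> radj p q x (l, j))"
    using assms ij by (intro finsum_cong') (auto simp: rmatsD adj_mult)
  also have "\<dots> = rmul r q p (radj q r y) (radj p q x) (i, j)" using ij by (simp add: rmul_entry)
  finally show "radj p r (rmul p q r x y) (i, j) = rmul r q p (radj q r y) (radj p q x) (i, j)" .
qed (use assms in auto)

lemma rinner_ract:
  assumes "x \<in> Rect p q" "v \<in> Cols p" "w \<in> Cols q"
  shows "rinner p v (ract p q x w) = rinner q (ract q p (radj p q x) v) w"
proof -
  have "rinner p v (ract p q x w) = (\<Oplus>i\<in>{..<p}. adj A (v i) \<otimes> (\<Oplus>j\<in>{..<q}. x (i, j) \<otimes> w j))"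
    unfolding rinner_def using assms
    by (intro finsum_cong') (auto simp: ract_entry rmatsD Pi_iff intro!: finsum_closed)
  also have "\<dots> = (\<Oplus>j\<in>{..<q}. (\<Oplus>i\<in>{..<p}. adj A (v i) \<otimes> x (i, j)) \<otimes> w j)"
    using assms by (intro finsum_assoc) (auto simp: rmatsD)
  also have "\<dots> = rinner q (ract q p (radj p q x) v) w"
    unfolding rinner_def
  proof (intro finsum_cong' refl)
    fix j assume j: "j \<in> {..<q}"
    have "adj A (ract q p (radj p q x) v j) = adj A (\<Oplus>i\<in>{..<p}. adj A (x (i, j)) \<otimes> v i)"
      using j assms by (simp add: ract_entry) (intro arg_cong[of _ _ "adj A"] finsum_cong', auto simp: rmatsD)
    also have "\<dots> = (\<Oplus>i\<in>{..<p}. adj A (adj A (x (i, j)) \<otimes> v i))"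
      using j assms by (intro finsum_adj) (auto simp: rmatsD)
    also have "\<dots> = (\<Oplus>i\<in>{..<p}. adj A (v i) \<otimes> x (i, j))"
      using j assms by (intro finsum_cong') (auto simp: rmatsD adj_mult Pi_iff)
    finally show "(\<Oplus>i\<in>{..<p}. adj A (v i) \<otimes> x (i, j)) \<otimes> w j
        = adj A (ract q p (radj p q x) v j) \<otimes> w j" by simp
  next
    show "(\<lambda>i. adj A (ract q p (radj p q x) v i) \<otimes> w i) \<in> Cols q"
      using ract_closed[OF radj_closed[OF assms(1)] assms(2)] assms(3) by (auto simp: Pi_iff)
  qed
  finally show ?thesis .
qed

section \<open>The algebra-valued inner product and the column norm\<close>

lemma rinner_adj:
  assumes "v \<in> Cols p" "w \<in> Cols p"
  shows "adj A (rinner p v w) = rinner p w v"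
proof -
  have "adj A (rinner p v w) = (\<Oplus>i\<in>{..<p}. adj A (adj A (v i) \<otimes> w i))"
    unfolding rinner_def using assms by (intro finsum_adj) (auto simp: Pi_iff)
  also have "\<dots> = rinner p w v"
    unfolding rinner_def using assms by (intro finsum_cong') (auto simp: Pi_iff adj_mult)
  finally show ?thesis .
qed

lemma rinner_add_right:
  assumes "v \<in> Cols p" "w \<in> Cols p" "w' \<in> Cols p"
  shows "rinner p v (\<lambda>i. w i \<oplus> w' i) = rinner p v w \<oplus> rinner p v w'"
proof -
  have "rinner p v (\<lambda>i. w i \<oplus> w' i) = (\<Oplus>i\<in>{..<p}. adj A (v i) \<otimes> w i \<oplus> adj A (v i) \<otimes> w' i)"
    unfolding rinner_def using assms by (intro finsum_cong') (auto simp: Pi_iff r_distr)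
  also have "\<dots> = rinner p v w \<oplus> rinner p v w'"
    unfolding rinner_def using assms by (intro finsum_addf) (auto simp: Pi_iff)
  finally show ?thesis .
qed

lemma rinner_smult_right:
  assumes "v \<in> Cols p" "w \<in> Cols p"
  shows "rinner p v (\<lambda>i. c \<odot> w i) = c \<odot> rinner p v w"
proof -
  have "rinner p v (\<lambda>i. c \<odot> w i) = (\<Oplus>i\<in>{..<p}. c \<odot> (adj A (v i) \<otimes> w i))"
    unfolding rinner_def using assms by (intro finsum_cong') (auto simp: Pi_iff smult_mult_right)
  also have "\<dots> = c \<odot> rinner p v w"
    unfolding rinner_def using assms by (intro finsum_smult[symmetric]) (auto simp: Pi_iff)
  finally show ?thesis .
qed

lemma rinner_mult_right:
  assumes "v \<in> Cols p" "w \<in> Cols p" "a \<in> carrier A"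
  shows "rinner p v (\<lambda>i. w i \<otimes> a) = rinner p v w \<otimes> a"
proof -
  have "rinner p v (\<lambda>i. w i \<otimes> a) = (\<Oplus>i\<in>{..<p}. (adj A (v i) \<otimes> w i) \<otimes> a)"
    unfolding rinner_def using assms by (intro finsum_cong') (auto simp: Pi_iff m_assoc)
  also have "\<dots> = rinner p v w \<otimes> a"
    unfolding rinner_def using assms by (intro finsum_ldistr[symmetric]) (auto simp: Pi_iff)
  finally show ?thesis .
qed

lemma rinner_add_left:
  assumes "v \<in> Cols p" "v' \<in> Cols p" "w \<in> Cols p"
  shows "rinner p (\<lambda>i. v i \<oplus> v' i) w = rinner p v w \<oplus> rinner p v' w"
proof -
  have c: "(\<lambda>i. v i \<oplus> v' i) \<in> Cols p" using assms by (auto simp: Pi_iff)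
  have "rinner p (\<lambda>i. v i \<oplus> v' i) w = adj A (rinner p w (\<lambda>i. v i \<oplus> v' i))"
    using rinner_adj[OF assms(3) c] by simp
  also have "\<dots> = adj A (rinner p w v) \<oplus> adj A (rinner p w v')"
    using assms by (simp add: rinner_add_right adj_add)
  finally show ?thesis using assms by (simp add: rinner_adj)
qed

lemma rinner_smult_left:
  assumes "v \<in> Cols p" "w \<in> Cols p"
  shows "rinner p (\<lambda>i. c \<odot> v i) w = cnj c \<odot> rinner p v w"
proof -
  have c: "(\<lambda>i. c \<odot> v i) \<in> Cols p" using assms by (auto simp: Pi_iff)
  have "rinner p (\<lambda>i. c \<odot> v i) w = adj A (rinner p w (\<lambda>i. c \<odot> v i))"
    using rinner_adj[OF assms(2) c] by simp
  then show ?thesis using assms by (simp add: rinner_smult_right adj_smult rinner_adj)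
qed

lemma rinner_mult_left:
  assumes "v \<in> Cols p" "w \<in> Cols p" "a \<in> carrier A"
  shows "rinner p (\<lambda>i. v i \<otimes> a) w = adj A a \<otimes> rinner p v w"
proof -
  have c: "(\<lambda>i. v i \<otimes> a) \<in> Cols p" using assms by (auto simp: Pi_iff)
  have "rinner p (\<lambda>i. v i \<otimes> a) w = adj A (rinner p w (\<lambda>i. v i \<otimes> a))"
    using rinner_adj[OF assms(2) c] by simp
  then show ?thesis using assms by (simp add: rinner_mult_right adj_mult rinner_adj)
qed

lemma rinner_self_npos: "v \<in> Cols p \<Longrightarrow> rinner p v v \<in> npos"
  unfolding rinner_def by (intro npos_finsum) (auto simp: npos_adj_mult Pi_iff)

text \<open>Let \<open>a\<close>, \<open>V\<close>, \<open>W\<close> be the inner products of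
  \<open>v\<close> with \<open>w\<close>, \<open>v\<close> with \<open>v\<close>, \<open>w\<close>
  with \<open>w\<close>, and let \<open>V \<le> t\<close>. Positivity of the inner product of
  \<open>t w - v a\<close> with itself reads \<open>t^2 W - 2 t adj a a + adj a V a \<ge> 0\<close>.
  Replacing \<open>V\<close> by \<open>t\<close> leaves \<open>adj a a \<le> t W\<close>, and the
  norm is monotone on positive elements.\<close>

lemma Cauchy_Schwarz_rinner:
  assumes v: "v \<in> Cols p" and w: "w \<in> Cols p"
  shows "(cnorm A (rinner p v w))\<^sup>2 \<le> cnorm A (rinner p v v) * cnorm A (rinner p w w)"
proof -
  define a where "a = rinner p v w"
  define V where "V = rinner p v v"
  define W where "W = rinner p w w"
  have c: "a \<in> carrier A" "V \<in> carrier A" "W \<in> carrier A" using v w by (auto simp: a_def V_def W_def)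
  have Vp: "V \<in> npos" using rinner_self_npos[OF v] by (simp add: V_def)
  have Wp: "W \<in> npos" using rinner_self_npos[OF w] by (simp add: W_def)
  have wv: "rinner p w v = adj A a" using rinner_adj[OF v w] by (simp add: a_def)
  \<comment> \<open>\<open>t\<close> is kept positive so that it can be cancelled; the norm of
    \<open>V\<close> itself may be 0 and is reached in the limit.\<close>
  have bound: "(cnorm A a)\<^sup>2 \<le> t * cnorm A W" if t: "t > 0" "cnorm A V \<le> t" for t
  proof -
    let ?t = "complex_of_real t"
    let ?v' = "\<lambda>i. (- 1) \<odot> (v i \<otimes> a)" and ?w' = "\<lambda>i. ?t \<odot> w i"
    have cols: "?v' \<in> Cols p" "?w' \<in> Cols p" "(\<lambda>i. v i \<otimes> a) \<in> Cols p"
      "(\<lambda>i. ?w' i \<oplus> ?v' i) \<in> Cols p"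
      using v w c by (auto simp: Pi_iff)
    define P where "P = adj A a \<otimes> a"
    define Q where "Q = adj A a \<otimes> V \<otimes> a"
    have PQ: "P \<in> carrier A" "Q \<in> carrier A" using c by (auto simp: P_def Q_def)
    have "rinner p (\<lambda>i. ?w' i \<oplus> ?v' i) (\<lambda>i. ?w' i \<oplus> ?v' i)
        = (rinner p ?w' ?w' \<oplus> rinner p ?w' ?v') \<oplus> (rinner p ?v' ?w' \<oplus> rinner p ?v' ?v')"
      using cols by (subst rinner_add_left) (auto simp: rinner_add_right)
    also have "rinner p ?w' ?w' = ?t \<odot> (?t \<odot> W)"
      using cols v w by (simp add: rinner_smult_right rinner_smult_left W_def)
    also have "rinner p ?w' ?v' = \<ominus> (?t \<odot> P)"
      using cols v w c by (simp add: rinner_smult_right rinner_smult_left rinner_mult_right wv P_def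
          smult_minus_left smult_minus_right smult_mult_left)
    also have "rinner p ?v' ?w' = \<ominus> (?t \<odot> P)"
      using cols v w c by (simp add: rinner_smult_right rinner_smult_left rinner_mult_left
          a_def[symmetric] P_def smult_minus_left smult_minus_right smult_mult_left)
    also have "rinner p ?v' ?v' = Q"
      using cols v w c by (simp add: rinner_smult_right rinner_smult_left rinner_mult_left rinner_mult_right
          V_def[symmetric] Q_def m_assoc)
    finally have "(?t \<odot> (?t \<odot> W) \<oplus> \<ominus> (?t \<odot> P)) \<oplus> (\<ominus> (?t \<odot> P) \<oplus> Q) \<in> npos"
      using rinner_self_npos[OF cols(4)] by simp
    moreover have "?t \<odot> P \<ominus> Q \<in> npos"
    proof -
      have "adj A a \<otimes> (?t \<odot> \<one> \<ominus> V) \<otimes> a \<in> npos"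
        using npos_cnorm_diff[OF c(2) _ t(2)] nposD[OF Vp] c(1) by (intro npos_conj) auto
      also have "adj A a \<otimes> (?t \<odot> \<one> \<ominus> V) \<otimes> a = ?t \<odot> P \<ominus> Q"
        using c by (simp add: P_def Q_def minus_eq l_distr r_distr l_minus r_minus
            smult_mult_left smult_mult_right)
      finally show ?thesis .
    qed
    ultimately have "((?t \<odot> (?t \<odot> W) \<oplus> \<ominus> (?t \<odot> P)) \<oplus> (\<ominus> (?t \<odot> P) \<oplus> Q)) \<oplus> (?t \<odot> P \<ominus> Q) \<in> npos"
      by (rule npos_add)
    also have "((?t \<odot> (?t \<odot> W) \<oplus> \<ominus> (?t \<odot> P)) \<oplus> (\<ominus> (?t \<odot> P) \<oplus> Q)) \<oplus> (?t \<odot> P \<ominus> Q)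
        = ?t \<odot> (?t \<odot> W) \<ominus> ?t \<odot> P"
    proof -
      have "?t \<odot> (?t \<odot> W) \<in> carrier A" "?t \<odot> P \<in> carrier A" using PQ c by auto
      then show ?thesis using PQ by algebra
    qed
    finally have "?t \<odot> (?t \<odot> W \<ominus> P) \<in> npos" using PQ c by (subst smult_diff_right) auto
    from npos_smult[OF this, of "1/t"] have "?t \<odot> W \<ominus> P \<in> npos" using t PQ c by simp
    then have "cnorm A P \<le> cnorm A (?t \<odot> W)"
      using t npos_adj_mult[OF c(1)] Wp by (intro npos_cnorm_mono npos_smult) (auto simp: P_def)
    then show ?thesis using c t by (simp add: P_def cnorm_smult)
  qed
  show ?thesis
  proof (rule field_le_epsilon)
    fix e :: real assume e: "e > 0"
    \<comment> \<open>The added 1 keeps the denominator positive when \<open>W\<close> is 0.\<close>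
    define s where "s = e / (cnorm A W + 1)"
    have W0: "cnorm A W \<ge> 0" using c by simp
    have s: "s > 0" using e W0 by (simp add: s_def)
    have "s * cnorm A W \<le> e" using e W0 by (simp add: s_def field_simps)
    moreover have "(cnorm A a)\<^sup>2 \<le> (cnorm A V + s) * cnorm A W"
      using s c by (intro bound) (auto simp: add_nonneg_pos)
    ultimately show "(cnorm A (rinner p v w))\<^sup>2 \<le> cnorm A (rinner p v v) * cnorm A (rinner p w w) + e"
      by (simp add: a_def V_def W_def algebra_simps)
  qed
qed

lemma column_norm_rinner: "column_norm p A v = sqrt (cnorm A (rinner p v v))"
  by (simp add: column_norm_def rinner_def)

lemma column_norm_nonneg [simp]: "v \<in> Cols p \<Longrightarrow> 0 \<le> column_norm p A v"
  by (simp add: column_norm_rinner)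

lemma column_norm_sq: "v \<in> Cols p \<Longrightarrow> (column_norm p A v)\<^sup>2 = cnorm A (rinner p v v)"
  by (simp add: column_norm_rinner)

lemma cnorm_rinner_le:
  assumes "v \<in> Cols p" "w \<in> Cols p"
  shows "cnorm A (rinner p v w) \<le> column_norm p A v * column_norm p A w"
proof (rule power2_le_imp_le)
  show "(cnorm A (rinner p v w))\<^sup>2 \<le> (column_norm p A v * column_norm p A w)\<^sup>2"
    using Cauchy_Schwarz_rinner[OF assms]
    by (simp only: power_mult_distrib column_norm_sq[OF assms(1)] column_norm_sq[OF assms(2)])
  show "0 \<le> column_norm p A v * column_norm p A w"
    using assms by (intro mult_nonneg_nonneg column_norm_nonneg)
qed

lemma column_norm_add:
  assumes "v \<in> Cols p" "w \<in> Cols p"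
  shows "column_norm p A (\<lambda>i. v i \<oplus> w i) \<le> column_norm p A v + column_norm p A w"
proof (rule power2_le_imp_le)
  have c: "(\<lambda>i. v i \<oplus> w i) \<in> Cols p" using assms by (auto simp: Pi_iff)
  have "(column_norm p A (\<lambda>i. v i \<oplus> w i))\<^sup>2
      = cnorm A ((rinner p v v \<oplus> rinner p v w) \<oplus> (rinner p w v \<oplus> rinner p w w))"
    unfolding column_norm_sq[OF c] using c assms by (subst rinner_add_left) (auto simp: rinner_add_right)
  also have "\<dots> \<le> (cnorm A (rinner p v v) + cnorm A (rinner p v w))
      + (cnorm A (rinner p w v) + cnorm A (rinner p w w))"
    using assms by (intro order.trans[OF cnorm_triangle] add_mono cnorm_triangle) auto
  also have "\<dots> \<le> ((column_norm p A v)\<^sup>2 + column_norm p A v * column_norm p A w)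
      + (column_norm p A w * column_norm p A v + (column_norm p A w)\<^sup>2)"
    using assms by (intro add_mono cnorm_rinner_le) (auto simp: column_norm_sq)
  also have "\<dots> = (column_norm p A v + column_norm p A w)\<^sup>2" by (simp add: power2_eq_square algebra_simps)
  finally show "(column_norm p A (\<lambda>i. v i \<oplus> w i))\<^sup>2 \<le> (column_norm p A v + column_norm p A w)\<^sup>2" .
qed (use assms in auto)

lemma column_norm_smult:
  assumes "v \<in> Cols p"
  shows "column_norm p A (\<lambda>i. c \<odot> v i) = cmod c * column_norm p A v"
proof -
  have c: "(\<lambda>i. c \<odot> v i) \<in> Cols p" using assms by (auto simp: Pi_iff)
  have "rinner p (\<lambda>i. c \<odot> v i) (\<lambda>i. c \<odot> v i) = (cnj c * c) \<odot> rinner p v v"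
    using assms c by (simp add: rinner_smult_left rinner_smult_right)
  then show ?thesis using assms
    by (simp add: column_norm_rinner cnorm_smult norm_mult real_sqrt_mult)
qed

lemma column_norm_le_sum:
  assumes v: "v \<in> Cols p"
  shows "column_norm p A v \<le> (\<Sum>i<p. cnorm A (v i))"
proof (rule power2_le_imp_le)
  have "(column_norm p A v)\<^sup>2 \<le> (\<Sum>i<p. cnorm A (adj A (v i) \<otimes> v i))"
    unfolding column_norm_sq[OF v] rinner_def using v by (intro cnorm_finsum_le) (auto simp: Pi_iff)
  also have "\<dots> = (\<Sum>i<p. (cnorm A (v i))\<^sup>2)" using v by (intro sum.cong) (auto simp: Pi_iff)
  also have "\<dots> \<le> (\<Sum>i<p. cnorm A (v i))\<^sup>2"
    unfolding power2_eq_square sum_distrib_right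
  proof (intro sum_mono mult_left_mono)
    fix i assume i: "i \<in> {..<p}"
    show "cnorm A (v i) \<le> (\<Sum>i<p. cnorm A (v i))" using i v by (intro member_le_sum) (auto simp: Pi_iff)
  qed (use v in \<open>auto simp: Pi_iff\<close>)
  finally show "(column_norm p A v)\<^sup>2 \<le> (\<Sum>i<p. cnorm A (v i))\<^sup>2" .
qed (use v in \<open>auto intro!: sum_nonneg simp: Pi_iff\<close>)

text \<open>The summand at \<open>i\<close> is dominated in the order by the whole sum, the rest
  being positive, and the norm is monotone on the cone. With \<open>column_norm_le_sum\<close> the
  column norm becomes equivalent to the norms of the entries.\<close>

lemma cnorm_le_column_norm:
  assumes v: "v \<in> Cols p" and i: "i < p"
  shows "cnorm A (v i) \<le> column_norm p A v"
proof (rule power2_le_imp_le)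
  let ?f = "\<lambda>i. adj A (v i) \<otimes> v i"
  have c: "?f \<in> Cols p" using v by (auto simp: Pi_iff)
  have sp: "rinner p v v = ?f i \<oplus> (\<Oplus>j\<in>{..<p} - {i}. ?f j)"
  proof -
    have "{..<p} = insert i ({..<p} - {i})" using i by auto
    then have "rinner p v v = (\<Oplus>j\<in>insert i ({..<p} - {i}). ?f j)" unfolding rinner_def by simp
    also have "\<dots> = ?f i \<oplus> (\<Oplus>j\<in>{..<p} - {i}. ?f j)" using c i by (intro finsum_insert) (auto simp: Pi_iff)
    finally show ?thesis .
  qed
  have r: "(\<Oplus>j\<in>{..<p} - {i}. ?f j) \<in> npos" using v by (intro npos_finsum) (auto simp: npos_adj_mult Pi_iff)
  have fi: "?f i \<in> npos" "?f i \<in> carrier A" using v i by (auto simp: npos_adj_mult Pi_iff)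
  have "(x \<oplus> y) \<ominus> x = y" if "x \<in> carrier A" "y \<in> carrier A" for x y
    using that by algebra
  from this[OF fi(2) nposD(1)[OF r]] have "rinner p v v \<ominus> ?f i = (\<Oplus>j\<in>{..<p} - {i}. ?f j)"
    unfolding sp .
  then have "cnorm A (?f i) \<le> cnorm A (rinner p v v)"
    using r fi rinner_self_npos[OF v] by (intro npos_cnorm_mono) auto
  then show "(cnorm A (v i))\<^sup>2 \<le> (column_norm p A v)\<^sup>2"
    using v i by (auto simp: column_norm_sq Pi_iff)
qed (use v in auto)

end

section \<open>Matrix algebras are C*-algebras\<close>

lemma matrix_algebra_sel:
  "carrier (matrix_algebra m A) = rmats m m (carrier A)"
  "cnorm (matrix_algebra m A) = matrix_norm m A"
  by (simp_all add: matrix_algebra_def mats_eq_rmats)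

context unital_cstar_algebra
begin

lemma matrix_adj: "adj (Mat m) = radj m m"
  by (simp add: matrix_algebra_def radj_def[abs_def])

lemma matrix_mult: "monoid.mult (Mat m) = rmul m m m"
  by (simp add: matrix_algebra_def rmul_def[abs_def])

lemma matrix_entries:
  assumes "i < m" "j < m"
  shows "(x \<oplus>\<^bsub>Mat m\<^esub> y) (i, j) = x (i, j) \<oplus> y (i, j)"
    "(x \<otimes>\<^bsub>Mat m\<^esub> y) (i, j) = (\<Oplus>l\<in>{..<m}. x (i, l) \<otimes> y (l, j))"
    "(c \<odot>\<^bsub>Mat m\<^esub> x) (i, j) = c \<odot> x (i, j)"
    "\<zero>\<^bsub>Mat m\<^esub> (i, j) = \<zero>"
    "\<one>\<^bsub>Mat m\<^esub> (i, j) = (if i = j then \<one> else \<zero>)"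
    "adj (Mat m) x (i, j) = adj A (x (j, i))"
  using assms by (simp_all add: matrix_algebra_def)

lemma matrix_closed:
  shows "x \<in> Rect m m \<Longrightarrow> y \<in> Rect m m \<Longrightarrow>
      x \<oplus>\<^bsub>Mat m\<^esub> y \<in> Rect m m"
    "x \<in> Rect m m \<Longrightarrow> c \<odot>\<^bsub>Mat m\<^esub> x \<in> Rect m m"
    "\<zero>\<^bsub>Mat m\<^esub> \<in> Rect m m"
    "\<one>\<^bsub>Mat m\<^esub> \<in> Rect m m"
  by (auto simp: matrix_algebra_def rmats_def PiE_iff)

lemma mat_eqI:
  "x \<in> Rect m m \<Longrightarrow> y \<in> Rect m m \<Longrightarrow>
    (\<And>i j. i < m \<Longrightarrow> j < m \<Longrightarrow> x (i, j) = y (i, j)) \<Longrightarrow> x = y"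
  by (rule rmats_eqI)

lemma matrix_abelian_group: "abelian_group (Mat m)"
proof (rule abelian_groupI; unfold matrix_algebra_sel)
  fix x y z assume x: "x \<in> Rect m m" "y \<in> Rect m m" "z \<in> Rect m m"
  show "x \<oplus>\<^bsub>Mat m\<^esub> y \<oplus>\<^bsub>Mat m\<^esub> z
      = x \<oplus>\<^bsub>Mat m\<^esub> (y \<oplus>\<^bsub>Mat m\<^esub> z)"
    using x by (intro mat_eqI[of _ m]) (auto simp: matrix_entries matrix_closed rmatsD a_assoc)
next
  fix x y assume x: "x \<in> Rect m m" "y \<in> Rect m m"
  show "x \<oplus>\<^bsub>Mat m\<^esub> y = y \<oplus>\<^bsub>Mat m\<^esub> x"
    using x by (intro mat_eqI[of _ m]) (auto simp: matrix_entries matrix_closed rmatsD a_comm)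
next
  fix x assume x: "x \<in> Rect m m"
  show "\<zero>\<^bsub>Mat m\<^esub> \<oplus>\<^bsub>Mat m\<^esub> x = x"
    using x by (intro mat_eqI[of _ m]) (auto simp: matrix_entries matrix_closed rmatsD)
  have "(- 1) \<odot>\<^bsub>Mat m\<^esub> x \<oplus>\<^bsub>Mat m\<^esub> x = \<zero>\<^bsub>Mat m\<^esub>"
    using x by (intro mat_eqI[of _ m])
      (auto simp: matrix_entries matrix_closed rmatsD smult_minus_one l_neg)
  then show "\<exists>y\<in>Rect m m. y \<oplus>\<^bsub>Mat m\<^esub> x = \<zero>\<^bsub>Mat m\<^esub>"
    using x matrix_closed by blast
qed (auto simp: matrix_closed)

text \<open>Subtraction in the record is defined through inverses of its additive monoid; its
  entries become visible once \<open>- y\<close> is identified with \<open>(- 1) y\<close>.\<close>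

lemma matrix_minus_entry:
  assumes "x \<in> Rect m m" "y \<in> Rect m m" "i < m" "j < m"
  shows "(x \<ominus>\<^bsub>Mat m\<^esub> y) (i, j) = x (i, j) \<ominus> y (i, j)"
proof -
  interpret MA: abelian_group "Mat m" by (rule matrix_abelian_group)
  have "(- 1) \<odot>\<^bsub>Mat m\<^esub> y \<oplus>\<^bsub>Mat m\<^esub> y = \<zero>\<^bsub>Mat m\<^esub>"
    using assms by (intro mat_eqI[of _ m])
      (auto simp: matrix_entries matrix_closed rmatsD smult_minus_one l_neg)
  then have "\<ominus>\<^bsub>Mat m\<^esub> y = (- 1) \<odot>\<^bsub>Mat m\<^esub> y"
    using assms by (intro MA.minus_equality) (auto simp: matrix_closed matrix_algebra_sel)
  then show ?thesis using assms
    by (simp add: MA.minus_eq minus_eq matrix_entries smult_minus_one rmatsD)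
qed

lemma matrix_minus_closed:
  "x \<in> Rect m m \<Longrightarrow> y \<in> Rect m m \<Longrightarrow>
    x \<ominus>\<^bsub>Mat m\<^esub> y \<in> Rect m m"
  using abelian_group.minus_closed[OF matrix_abelian_group, of x m y] by (simp add: matrix_algebra_sel)

lemma rmul_one_left: "x \<in> Rect p q \<Longrightarrow> rmul p p q \<one>\<^bsub>Mat p\<^esub> x = x"
proof (rule rmats_eqI[of _ p q "carrier A" _ "carrier A"])
  fix i j assume x: "x \<in> Rect p q" and ij: "i < p" "j < q"
  have "rmul p p q \<one>\<^bsub>Mat p\<^esub> x (i, j) = (\<Oplus>l\<in>{..<p}. if l = i then x (l, j) else \<zero>)"
    using x ij unfolding rmul_entry[OF ij] by (intro finsum_cong') (auto simp: matrix_entries rmatsD)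
  also have "\<dots> = x (i, j)" using x ij by (intro finsum_delta) (auto simp: rmatsD)
  finally show "rmul p p q \<one>\<^bsub>Mat p\<^esub> x (i, j) = x (i, j)" .
qed (auto simp: matrix_closed)

lemma rmul_one_right: "x \<in> Rect p q \<Longrightarrow> rmul p q q x \<one>\<^bsub>Mat q\<^esub> = x"
proof (rule rmats_eqI[of _ p q "carrier A" _ "carrier A"])
  fix i j assume x: "x \<in> Rect p q" and ij: "i < p" "j < q"
  have "rmul p q q x \<one>\<^bsub>Mat q\<^esub> (i, j) = (\<Oplus>l\<in>{..<q}. if l = j then x (i, l) else \<zero>)"
    using x ij unfolding rmul_entry[OF ij] by (intro finsum_cong') (auto simp: matrix_entries rmatsD)
  also have "\<dots> = x (i, j)" using x ij by (intro finsum_delta) (auto simp: rmatsD)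
  finally show "rmul p q q x \<one>\<^bsub>Mat q\<^esub> (i, j) = x (i, j)" .
qed (auto simp: matrix_closed)

lemma rmul_add_left:
  assumes "x \<in> Rect p p" "y \<in> Rect p p" "z \<in> Rect p q"
    "i < p" "j < q"
  shows "rmul p p q (x \<oplus>\<^bsub>Mat p\<^esub> y) z (i, j) = rmul p p q x z (i, j) \<oplus> rmul p p q y z (i, j)"
proof -
  have "rmul p p q (x \<oplus>\<^bsub>Mat p\<^esub> y) z (i, j)
      = (\<Oplus>l\<in>{..<p}. x (i, l) \<otimes> z (l, j) \<oplus> y (i, l) \<otimes> z (l, j))"
    using assms unfolding rmul_entry[OF assms(4,5)]
    by (intro finsum_cong') (auto simp: matrix_entries rmatsD l_distr)
  also have "\<dots> = (\<Oplus>l\<in>{..<p}. x (i, l) \<otimes> z (l, j)) \<oplus> (\<Oplus>l\<in>{..<p}. y (i, l) \<otimes> z (l, j))"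
    using assms by (intro finsum_addf) (auto simp: rmatsD)
  finally show ?thesis using assms by (simp add: rmul_entry)
qed

lemma rmul_add_right:
  assumes "x \<in> Rect q p" "y \<in> Rect p p" "z \<in> Rect p p"
    "i < q" "j < p"
  shows "rmul q p p x (y \<oplus>\<^bsub>Mat p\<^esub> z) (i, j) = rmul q p p x y (i, j) \<oplus> rmul q p p x z (i, j)"
proof -
  have "rmul q p p x (y \<oplus>\<^bsub>Mat p\<^esub> z) (i, j)
      = (\<Oplus>l\<in>{..<p}. x (i, l) \<otimes> y (l, j) \<oplus> x (i, l) \<otimes> z (l, j))"
    using assms unfolding rmul_entry[OF assms(4,5)]
    by (intro finsum_cong') (auto simp: matrix_entries rmatsD r_distr)
  also have "\<dots> = (\<Oplus>l\<in>{..<p}. x (i, l) \<otimes> y (l, j)) \<oplus> (\<Oplus>l\<in>{..<p}. x (i, l) \<otimes> z (l, j))"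
    using assms by (intro finsum_addf) (auto simp: rmatsD)
  finally show ?thesis using assms by (simp add: rmul_entry)
qed

lemma rmul_smult_left:
  assumes "x \<in> Rect p p" "z \<in> Rect p q" "i < p" "j < q"
  shows "rmul p p q (c \<odot>\<^bsub>Mat p\<^esub> x) z (i, j) = c \<odot> rmul p p q x z (i, j)"
proof -
  have "rmul p p q (c \<odot>\<^bsub>Mat p\<^esub> x) z (i, j) = (\<Oplus>l\<in>{..<p}. c \<odot> (x (i, l) \<otimes> z (l, j)))"
    using assms by (subst rmul_entry) (auto simp: matrix_entries rmatsD smult_mult_left intro!: finsum_cong')
  also have "\<dots> = c \<odot> (\<Oplus>l\<in>{..<p}. x (i, l) \<otimes> z (l, j))"
    using assms by (intro finsum_smult[symmetric]) (auto simp: rmatsD)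
  finally show ?thesis using assms by (simp add: rmul_entry)
qed

lemma rmul_smult_right:
  assumes "x \<in> Rect q p" "z \<in> Rect p p" "i < q" "j < p"
  shows "rmul q p p x (c \<odot>\<^bsub>Mat p\<^esub> z) (i, j) = c \<odot> rmul q p p x z (i, j)"
proof -
  have "rmul q p p x (c \<odot>\<^bsub>Mat p\<^esub> z) (i, j) = (\<Oplus>l\<in>{..<p}. c \<odot> (x (i, l) \<otimes> z (l, j)))"
    using assms by (subst rmul_entry) (auto simp: matrix_entries rmatsD smult_mult_right intro!: finsum_cong')
  also have "\<dots> = c \<odot> (\<Oplus>l\<in>{..<p}. x (i, l) \<otimes> z (l, j))"
    using assms by (intro finsum_smult[symmetric]) (auto simp: rmatsD)
  finally show ?thesis using assms by (simp add: rmul_entry)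
qed

lemma matrix_ring: "ring (Mat m)"
proof (rule ringI[OF matrix_abelian_group])
  show "Group.monoid (Mat m)"
    by (rule monoidI; unfold matrix_algebra_sel matrix_mult)
      (auto simp: matrix_closed rmul_assoc rmul_one_left rmul_one_right)
qed (unfold matrix_algebra_sel matrix_mult,
    auto intro!: mat_eqI[of _ m] simp: matrix_closed rmul_add_left rmul_add_right matrix_entries)

lemma matrix_module: "module complex_ring (Mat m)"
proof (rule moduleI[OF _ matrix_abelian_group])
  show "cring complex_ring" by (rule cring_from_type_algebra)
qed (unfold matrix_algebra_sel complex_ring_simps,
    auto intro!: mat_eqI[of _ m]
      simp: matrix_closed matrix_entries rmatsD smult_add_left smult_add_right)

section \<open>The operator norm of matrices acting on columns\<close>

lemma column_norm_cong:
  "w \<in> Cols p \<Longrightarrow> (\<And>i. i < p \<Longrightarrow> v i = w i) \<Longrightarrow>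
    column_norm p A v = column_norm p A w"
  unfolding column_norm_def by (intro arg_cong[of _ _ "\<lambda>a. sqrt (cnorm A a)"] finsum_cong') (auto simp: Pi_iff)

lemma ract_bound:
  assumes x: "x \<in> Rect p q" and v: "v \<in> Cols q"
  shows "column_norm p A (ract p q x v) \<le> (\<Sum>i<p. \<Sum>j<q. cnorm A (x (i, j))) * column_norm q A v"
proof -
  have "column_norm p A (ract p q x v) \<le> (\<Sum>i<p. cnorm A (ract p q x v i))"
    using x v by (intro column_norm_le_sum) auto
  also have "\<dots> \<le> (\<Sum>i<p. \<Sum>j<q. cnorm A (x (i, j) \<otimes> v j))"
    using x v by (intro sum_mono) (auto simp: ract_entry rmatsD Pi_iff intro!: cnorm_finsum_le)
  also have "\<dots> \<le> (\<Sum>i<p. \<Sum>j<q. cnorm A (x (i, j)) * column_norm q A v)"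
    using x v by (intro sum_mono order.trans[OF cnorm_mult] mult_left_mono cnorm_le_column_norm)
      (auto simp: rmatsD Pi_iff)
  also have "\<dots> = (\<Sum>i<p. \<Sum>j<q. cnorm A (x (i, j))) * column_norm q A v"
    by (simp add: sum_distrib_right)
  finally show ?thesis .
qed

lemma matrix_norm_ract:
  "matrix_norm m A x = Sup {column_norm m A (ract m m x v) | v.
      v \<in> {..<m} \<rightarrow>\<^sub>E carrier A \<and> column_norm m A v \<le> 1}"
  by (simp add: matrix_norm_def ract_def)

lemma column_norm_zero [simp]: "column_norm m A (\<lambda>i. \<zero>) = 0"
  using column_norm_smult[of "\<lambda>i. \<zero>" m 0] by simp

lemma matrix_norm_le:
  assumes "K \<ge> 0" "\<And>v. v \<in> Cols m \<Longrightarrow> column_norm m A (ract m m x v) \<le> K * column_norm m A v"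
  shows "matrix_norm m A x \<le> K"
  unfolding matrix_norm_ract
proof (rule cSup_least)
  \<comment> \<open>The supremum of a set of reals can be bounded only if the set is nonempty; the
    zero column provides a member.\<close>
  have "column_norm m A (restrict (\<lambda>i. \<zero>) {..<m}) = column_norm m A (\<lambda>i. \<zero>)"
    by (rule column_norm_cong) auto
  then have "restrict (\<lambda>i. \<zero>) {..<m} \<in> {..<m} \<rightarrow>\<^sub>E carrier A \<and> column_norm m A (restrict (\<lambda>i. \<zero>) {..<m}) \<le> 1"
    by auto
  then show "{column_norm m A (ract m m x v) |v. v \<in> {..<m} \<rightarrow>\<^sub>E carrier A \<and> column_norm m A v \<le> 1} \<noteq> {}"
    by blast
  fix t assume "t \<in> {column_norm m A (ract m m x v) |v. v \<in> {..<m} \<rightarrow>\<^sub>E carrier A \<and> column_norm m A v \<le> 1}"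
  then obtain v where v: "t = column_norm m A (ract m m x v)" "v \<in> Cols m" "column_norm m A v \<le> 1"
    by (auto simp: PiE_iff)
  then have "t \<le> K * column_norm m A v" using assms by simp
  also have "\<dots> \<le> K * 1" using v assms by (intro mult_left_mono) auto
  finally show "t \<le> K" by simp
qed

lemma ract_smult_right:
  assumes "x \<in> Rect p q" "v \<in> Cols q" "i < p"
  shows "ract p q x (\<lambda>j. c \<odot> v j) i = c \<odot> ract p q x v i"
proof -
  have "ract p q x (\<lambda>j. c \<odot> v j) i = (\<Oplus>j\<in>{..<q}. c \<odot> (x (i, j) \<otimes> v j))"
    using assms by (subst ract_entry) (auto simp: rmatsD Pi_iff smult_mult_right intro!: finsum_cong')
  also have "\<dots> = c \<odot> (\<Oplus>j\<in>{..<q}. x (i, j) \<otimes> v j)"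
    using assms by (intro finsum_smult[symmetric]) (auto simp: rmatsD Pi_iff)
  finally show ?thesis using assms by (simp add: ract_entry)
qed

lemma ract_cong: "v \<in> Cols q \<Longrightarrow> x \<in> Rect p q \<Longrightarrow>
    (\<And>i. i < q \<Longrightarrow> v i = w i) \<Longrightarrow> ract p q x w = ract p q x v"
  by (rule ext) (auto simp: ract_def restrict_def rmatsD Pi_iff intro!: finsum_cong')

text \<open>The entrywise estimate \<open>ract_bound\<close> shows that the supremum in the norm is
  taken over a bounded set; scaling then carries the bound from the unit ball to all
  columns.\<close>

lemma matrix_norm_nonneg: "x \<in> Rect m m \<Longrightarrow> 0 \<le> matrix_norm m A x"
  and matrix_norm_column:
    "x \<in> Rect m m \<Longrightarrow> v \<in> Cols m \<Longrightarrow>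
      column_norm m A (ract m m x v) \<le> matrix_norm m A x * column_norm m A v"
proof -
  assume x: "x \<in> Rect m m"
  let ?K = "\<Sum>i<m. \<Sum>j<m. cnorm A (x (i, j))"
  let ?X = "{column_norm m A (ract m m x v) | v. v \<in> {..<m} \<rightarrow>\<^sub>E carrier A \<and> column_norm m A v \<le> 1}"
  have K: "?K \<ge> 0" using x by (auto intro!: sum_nonneg simp: rmatsD)
  have bdd: "bdd_above ?X"
  proof (rule bdd_aboveI[of _ ?K])
    fix t assume "t \<in> ?X"
    then obtain v where v: "t = column_norm m A (ract m m x v)" "v \<in> Cols m" "column_norm m A v \<le> 1"
      by (auto simp: PiE_iff)
    then have "t \<le> ?K * column_norm m A v" using ract_bound x by simp
    also have "\<dots> \<le> ?K * 1" using v K by (intro mult_left_mono) auto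
    finally show "t \<le> ?K" by simp
  qed
  have unit: "column_norm m A (ract m m x v) \<le> matrix_norm m A x"
    if v: "v \<in> Cols m" "column_norm m A v \<le> 1" for v
  proof -
    \<comment> \<open>\<open>matrix_norm\<close> ranges over extensional columns; restricting
      \<open>v\<close> changes neither its norm nor its image.\<close>
    have "ract m m x (restrict v {..<m}) = ract m m x v" using v x by (intro ract_cong) auto
    moreover have "column_norm m A (restrict v {..<m}) = column_norm m A v"
      using v by (intro column_norm_cong) auto
    moreover have "restrict v {..<m} \<in> {..<m} \<rightarrow>\<^sub>E carrier A" using v by auto
    ultimately have "column_norm m A (ract m m x v) \<in> ?X" using v by (metis (mono_tags, lifting) mem_Collect_eq)
    then show ?thesis unfolding matrix_norm_ract using bdd by (rule cSup_upper)
  qed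
  have "(\<lambda>i. \<zero>) \<in> Cols m" by auto
  then have "0 \<le> column_norm m A (ract m m x (\<lambda>i. \<zero>))" using x by (intro column_norm_nonneg) auto
  then show "0 \<le> matrix_norm m A x" using unit[of "\<lambda>i. \<zero>"] by auto
  assume v: "v \<in> Cols m"
  show "column_norm m A (ract m m x v) \<le> matrix_norm m A x * column_norm m A v"
  proof (cases "column_norm m A v = 0")
    \<comment> \<open>A column of norm 0 cannot be normalized, but \<open>ract_bound\<close> already
      gives its image norm 0.\<close>
    case True
    then show ?thesis using ract_bound[OF x v] by simp
  next
    case False
    define c where "c = column_norm m A v"
    have c: "c > 0" using False column_norm_nonneg[OF v] by (simp add: c_def)
    let ?w = "\<lambda>i. complex_of_real (1/c) \<odot> v i"
    have w: "?w \<in> Cols m" using v by (auto simp: Pi_iff)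
    have "column_norm m A ?w = (1/c) * c"
      using column_norm_smult[OF v, of "complex_of_real (1/c)"] c unfolding norm_of_real by (simp add: c_def)
    then have "column_norm m A ?w \<le> 1" using c by simp
    then have "column_norm m A (ract m m x ?w) \<le> matrix_norm m A x" using unit w by blast
    also have "column_norm m A (ract m m x ?w) = column_norm m A (\<lambda>i. complex_of_real (1/c) \<odot> ract m m x v i)"
      using ract_closed[OF x v] by (intro column_norm_cong ract_smult_right x v) (auto simp: Pi_iff)
    also have "\<dots> = (1/c) * column_norm m A (ract m m x v)"
      using column_norm_smult[OF ract_closed[OF x v], of "complex_of_real (1/c)"] c unfolding norm_of_real by simp
    finally show ?thesis using c by (simp add: c_def[symmetric] field_simps)
  qed
qed

lemma matrix_norm_le_sum:
  "x \<in> Rect m m \<Longrightarrow> matrix_norm m A x \<le> (\<Sum>i<m. \<Sum>j<m. cnorm A (x (i, j)))"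
  using ract_bound by (intro matrix_norm_le) (auto intro!: sum_nonneg simp: rmatsD)

text \<open>The entry is a coordinate of the image of the unit column at \<open>j\<close>, which has
  norm at most 1. Together with \<open>matrix_norm_le_sum\<close>, norm convergence of matrices is
  convergence of all entries.\<close>

lemma cnorm_entry_le:
  assumes x: "x \<in> Rect m m" and ij: "i < m" "j < m"
  shows "cnorm A (x (i, j)) \<le> matrix_norm m A x"
proof -
  let ?e = "\<lambda>k. if k = j then \<one> else \<zero>"
  have e: "?e \<in> Cols m" by auto
  have "column_norm m A ?e \<le> (\<Sum>k<m. cnorm A (?e k))" by (rule column_norm_le_sum[OF e])
  also have "\<dots> = (\<Sum>k<m. if k = j then cnorm A \<one> else 0)" by (intro sum.cong) auto
  also have "\<dots> \<le> 1" using ij cnorm_one_le by simp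
  finally have e1: "column_norm m A ?e \<le> 1" .
  have "ract m m x ?e i = (\<Oplus>k\<in>{..<m}. if k = j then x (i, k) else \<zero>)"
    using x ij by (subst ract_entry) (auto simp: rmatsD intro!: finsum_cong')
  also have "\<dots> = x (i, j)" using x ij by (intro finsum_delta) (auto simp: rmatsD)
  finally have "cnorm A (x (i, j)) = cnorm A (ract m m x ?e i)" by simp
  also have "\<dots> \<le> column_norm m A (ract m m x ?e)" using x e ij by (intro cnorm_le_column_norm) auto
  also have "\<dots> \<le> matrix_norm m A x * column_norm m A ?e" by (rule matrix_norm_column[OF x e])
  also have "\<dots> \<le> matrix_norm m A x * 1" using e1 matrix_norm_nonneg[OF x] by (rule mult_left_mono)
  finally show ?thesis by simp
qed

lemma matrix_norm_eq_zero:
  assumes x: "x \<in> Rect m m"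
  shows "matrix_norm m A x = 0 \<longleftrightarrow> x = \<zero>\<^bsub>Mat m\<^esub>"
proof
  assume 0: "matrix_norm m A x = 0"
  show "x = \<zero>\<^bsub>Mat m\<^esub>"
  proof (rule mat_eqI[OF x])
    fix i j assume ij: "i < m" "j < m"
    have "cnorm A (x (i, j)) = 0"
      using cnorm_entry_le[OF x ij] 0 cnorm_nonneg[OF rmatsD[OF x ij]] by simp
    then show "x (i, j) = \<zero>\<^bsub>Mat m\<^esub> (i, j)"
      using rmatsD[OF x ij] ij by (simp add: cnorm_eq_zero matrix_entries)
  qed (simp add: matrix_closed)
next
  assume "x = \<zero>\<^bsub>Mat m\<^esub>"
  then have "(\<Sum>i<m. \<Sum>j<m. cnorm A (x (i, j))) = 0" by (simp add: matrix_entries)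
  then show "matrix_norm m A x = 0" using matrix_norm_le_sum[OF x] matrix_norm_nonneg[OF x] by simp
qed

lemma matrix_norm_add:
  assumes x: "x \<in> Rect m m" and y: "y \<in> Rect m m"
  shows "matrix_norm m A (x \<oplus>\<^bsub>Mat m\<^esub> y) \<le> matrix_norm m A x + matrix_norm m A y"
proof (rule matrix_norm_le)
  fix v assume v: "v \<in> Cols m"
  have "column_norm m A (ract m m (x \<oplus>\<^bsub>Mat m\<^esub> y) v)
      = column_norm m A (\<lambda>i. ract m m x v i \<oplus> ract m m y v i)"
  proof (rule column_norm_cong)
    show "(\<lambda>i. ract m m x v i \<oplus> ract m m y v i) \<in> Cols m"
      using ract_closed[OF x v] ract_closed[OF y v] by (auto simp: Pi_iff)
    fix i assume i: "i < m"
    have "ract m m (x \<oplus>\<^bsub>Mat m\<^esub> y) v i = (\<Oplus>j\<in>{..<m}. x (i, j) \<otimes> v j \<oplus> y (i, j) \<otimes> v j)"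
      using i x y v unfolding ract_entry[OF i]
      by (intro finsum_cong') (auto simp: matrix_entries rmatsD Pi_iff l_distr)
    also have "\<dots> = (\<Oplus>j\<in>{..<m}. x (i, j) \<otimes> v j) \<oplus> (\<Oplus>j\<in>{..<m}. y (i, j) \<otimes> v j)"
      using i x y v by (intro finsum_addf) (auto simp: rmatsD Pi_iff)
    finally show "ract m m (x \<oplus>\<^bsub>Mat m\<^esub> y) v i = ract m m x v i \<oplus> ract m m y v i"
      using i by (simp add: ract_entry)
  qed
  also have "\<dots> \<le> column_norm m A (ract m m x v) + column_norm m A (ract m m y v)"
    using x y v by (intro column_norm_add) auto
  also have "\<dots> \<le> matrix_norm m A x * column_norm m A v + matrix_norm m A y * column_norm m A v"
    using x y v by (intro add_mono matrix_norm_column)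
  finally show "column_norm m A (ract m m (x \<oplus>\<^bsub>Mat m\<^esub> y) v)
      \<le> (matrix_norm m A x + matrix_norm m A y) * column_norm m A v" by (simp add: algebra_simps)
qed (use x y matrix_norm_nonneg in auto)

lemma matrix_norm_smult:
  assumes x: "x \<in> Rect m m"
  shows "matrix_norm m A (c \<odot>\<^bsub>Mat m\<^esub> x) = cmod c * matrix_norm m A x"
proof -
  have le: "matrix_norm m A (c \<odot>\<^bsub>Mat m\<^esub> x) \<le> cmod c * matrix_norm m A x"
    if x: "x \<in> Rect m m" for c x
  proof (rule matrix_norm_le)
    fix v assume v: "v \<in> Cols m"
    have "column_norm m A (ract m m (c \<odot>\<^bsub>Mat m\<^esub> x) v)
        = column_norm m A (\<lambda>i. c \<odot> ract m m x v i)"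
    proof (rule column_norm_cong)
      show "(\<lambda>i. c \<odot> ract m m x v i) \<in> Cols m"
        using ract_closed[OF x v] by (auto simp: Pi_iff)
      fix i assume i: "i < m"
      have "ract m m (c \<odot>\<^bsub>Mat m\<^esub> x) v i = (\<Oplus>j\<in>{..<m}. c \<odot> (x (i, j) \<otimes> v j))"
        using i x v by (subst ract_entry)
          (auto simp: matrix_entries rmatsD Pi_iff smult_mult_left intro!: finsum_cong')
      also have "\<dots> = c \<odot> (\<Oplus>j\<in>{..<m}. x (i, j) \<otimes> v j)"
        using i x v by (intro finsum_smult[symmetric]) (auto simp: rmatsD Pi_iff)
      finally show "ract m m (c \<odot>\<^bsub>Mat m\<^esub> x) v i = c \<odot> ract m m x v i"
        using i by (simp add: ract_entry)
    qed
    also have "\<dots> = cmod c * column_norm m A (ract m m x v)" using x v by (intro column_norm_smult) auto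
    also have "\<dots> \<le> cmod c * (matrix_norm m A x * column_norm m A v)"
      using x v by (intro mult_left_mono matrix_norm_column) auto
    finally show "column_norm m A (ract m m (c \<odot>\<^bsub>Mat m\<^esub> x) v)
        \<le> cmod c * matrix_norm m A x * column_norm m A v" by (simp add: mult.assoc)
  qed (use x matrix_norm_nonneg in auto)
  show ?thesis
  proof (cases "c = 0")
    case True
    then show ?thesis
      using le[OF x, of 0] matrix_norm_nonneg[OF matrix_closed(2)[OF x], of 0] by simp
  next
    case False
    have "(1/c) \<odot>\<^bsub>Mat m\<^esub> (c \<odot>\<^bsub>Mat m\<^esub> x) = x"
      using x False by (intro mat_eqI[of _ m]) (auto simp: matrix_closed matrix_entries rmatsD)
    then have "matrix_norm m A x \<le> cmod (1/c) * matrix_norm m A (c \<odot>\<^bsub>Mat m\<^esub> x)"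
      using le[OF matrix_closed(2)[OF x], of "1/c" c] by simp
    then show ?thesis using le[OF x, of c] False by (simp add: norm_divide field_simps)
  qed
qed

lemma matrix_norm_mult:
  assumes x: "x \<in> Rect m m" and y: "y \<in> Rect m m"
  shows "matrix_norm m A (rmul m m m x y) \<le> matrix_norm m A x * matrix_norm m A y"
proof (rule matrix_norm_le)
  fix v assume v: "v \<in> Cols m"
  have "column_norm m A (ract m m (rmul m m m x y) v) = column_norm m A (ract m m x (ract m m y v))"
    using x y v by (simp add: ract_ract)
  also have "\<dots> \<le> matrix_norm m A x * column_norm m A (ract m m y v)"
    using x y v by (intro matrix_norm_column) auto
  also have "\<dots> \<le> matrix_norm m A x * (matrix_norm m A y * column_norm m A v)"
    using x y v by (intro mult_left_mono matrix_norm_column matrix_norm_nonneg)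
  finally show "column_norm m A (ract m m (rmul m m m x y) v)
      \<le> matrix_norm m A x * matrix_norm m A y * column_norm m A v" by (simp add: mult.assoc)
qed (use x y matrix_norm_nonneg in auto)

text \<open>The squared norm of \<open>x v\<close> is the norm of the inner product of
  \<open>v\<close> with \<open>adj x x v\<close>, so by Cauchy-Schwarz the square of the norm of
  \<open>x\<close> is at most the norm of \<open>adj x x\<close>. Submultiplicativity then forces
  \<open>x\<close> and \<open>adj x\<close> to have equal norms, and with that gives the opposite
  inequality.\<close>

lemma matrix_norm_cstar:
  assumes x: "x \<in> Rect m m"
  shows "matrix_norm m A (rmul m m m (radj m m x) x) = (matrix_norm m A x)\<^sup>2"
proof -
  have sq: "(matrix_norm m A x)\<^sup>2 \<le> matrix_norm m A (rmul m m m (radj m m x) x)"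
    if x: "x \<in> Rect m m" for x
  proof -
    let ?xx = "rmul m m m (radj m m x) x"
    have xx: "?xx \<in> Rect m m" using x by auto
    have "matrix_norm m A x \<le> sqrt (matrix_norm m A ?xx)"
    proof (rule matrix_norm_le)
      fix v assume v: "v \<in> Cols m"
      have xv: "ract m m x v \<in> Cols m" using x v by auto
      have "(column_norm m A (ract m m x v))\<^sup>2 = cnorm A (rinner m (ract m m x v) (ract m m x v))"
        by (rule column_norm_sq[OF xv])
      also have "rinner m (ract m m x v) (ract m m x v) = rinner m v (ract m m ?xx v)"
        using rinner_ract[OF radj_closed[OF x] v xv] x v by (simp add: ract_ract)
      also have "cnorm A \<dots> \<le> column_norm m A v * column_norm m A (ract m m ?xx v)"
        using v xx by (intro cnorm_rinner_le) auto
      also have "\<dots> \<le> column_norm m A v * (matrix_norm m A ?xx * column_norm m A v)"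
        using v xx by (intro mult_left_mono matrix_norm_column) auto
      also have "\<dots> = (sqrt (matrix_norm m A ?xx) * column_norm m A v)\<^sup>2"
        using matrix_norm_nonneg[OF xx] by (simp add: power_mult_distrib power2_eq_square[of "column_norm m A v"])
      finally show "column_norm m A (ract m m x v) \<le> sqrt (matrix_norm m A ?xx) * column_norm m A v"
        by (rule power2_le_imp_le) (use v matrix_norm_nonneg[OF xx] in \<open>auto intro!: mult_nonneg_nonneg\<close>)
    qed (use matrix_norm_nonneg[OF xx] in simp)
    then have "(matrix_norm m A x)\<^sup>2 \<le> (sqrt (matrix_norm m A ?xx))\<^sup>2"
      using matrix_norm_nonneg[OF x] by (rule power_mono)
    then show ?thesis using matrix_norm_nonneg[OF xx] by simp
  qed
  have le: "matrix_norm m A x \<le> matrix_norm m A (radj m m x)" if x: "x \<in> Rect m m" for x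
  proof (cases "matrix_norm m A x = 0")
    case True
    then show ?thesis using matrix_norm_nonneg[of "radj m m x" m] x by simp
  next
    case False
    then have "matrix_norm m A x > 0" using matrix_norm_nonneg[OF x] by simp
    moreover have "matrix_norm m A x * matrix_norm m A x \<le> matrix_norm m A (radj m m x) * matrix_norm m A x"
      using sq[OF x] matrix_norm_mult[OF radj_closed[OF x] x] by (simp add: power2_eq_square)
    ultimately show ?thesis by simp
  qed
  have "matrix_norm m A (radj m m x) = matrix_norm m A x"
    using le[OF x] le[OF radj_closed[OF x]] x by simp
  then show ?thesis
    using sq[OF x] matrix_norm_mult[OF radj_closed[OF x] x] by (simp add: power2_eq_square)
qed

text \<open>The metric axioms come ahead of the C*-structure, because completeness is an axiom of
  that structure and its verification speaks about limits in this metric.\<close>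

lemma matrix_Metric_space:
  "Metric_space (carrier (Mat m)) (cdist (Mat m))"
proof -
  interpret MA: abelian_group "Mat m" by (rule matrix_abelian_group)
  let ?M = "Mat m"
  let ?C = "Rect m m"
  have sym: "matrix_norm m A (x \<ominus>\<^bsub>?M\<^esub> y) = matrix_norm m A (y \<ominus>\<^bsub>?M\<^esub> x)" if "x \<in> ?C" "y \<in> ?C" for x y
  proof -
    have "x \<ominus>\<^bsub>?M\<^esub> y = (-1) \<odot>\<^bsub>?M\<^esub> (y \<ominus>\<^bsub>?M\<^esub> x)"
      using that by (intro mat_eqI[of _ m])
        (auto simp: matrix_minus_closed matrix_closed matrix_entries matrix_minus_entry rmatsD
          smult_minus_one minus_eq minus_add a_comm)
    then show ?thesis using that by (simp add: matrix_norm_smult matrix_minus_closed)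
  qed
  have tri: "matrix_norm m A (x \<ominus>\<^bsub>?M\<^esub> z) \<le> matrix_norm m A (x \<ominus>\<^bsub>?M\<^esub> y) + matrix_norm m A (y \<ominus>\<^bsub>?M\<^esub> z)"
    if "x \<in> ?C" "y \<in> ?C" "z \<in> ?C" for x y z
  proof -
    have a: "a \<ominus> c = (a \<ominus> b) \<oplus> (b \<ominus> c)" if "a \<in> carrier A" "b \<in> carrier A" "c \<in> carrier A" for a b c
      using that by algebra
    have "x \<ominus>\<^bsub>?M\<^esub> z = (x \<ominus>\<^bsub>?M\<^esub> y) \<oplus>\<^bsub>?M\<^esub> (y \<ominus>\<^bsub>?M\<^esub> z)"
      using that by (intro mat_eqI[of _ m])
        (auto simp: matrix_minus_closed matrix_closed matrix_entries matrix_minus_entry rmatsD intro!: a)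
    then show ?thesis using that by (simp add: matrix_norm_add matrix_minus_closed)
  qed
  have zero: "matrix_norm m A (x \<ominus>\<^bsub>?M\<^esub> y) = 0 \<longleftrightarrow> x = y" if "x \<in> ?C" "y \<in> ?C" for x y
  proof -
    have "x \<ominus>\<^bsub>?M\<^esub> y = \<zero>\<^bsub>?M\<^esub> \<longleftrightarrow> x = y"
      using that MA.add.inv_solve_right[of "\<zero>\<^bsub>?M\<^esub>" x y]
      by (auto simp: MA.minus_eq matrix_algebra_sel matrix_closed MA.r_neg)
    then show ?thesis using that by (simp add: matrix_norm_eq_zero matrix_minus_closed)
  qed
  show ?thesis
    by unfold_locales
      (auto simp: cdist_def matrix_algebra_sel matrix_norm_nonneg matrix_minus_closed sym zero tri)
qed

text \<open>For completeness: a Cauchy sequence of matrices has Cauchy entries by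
  \<open>cnorm_entry_le\<close>, and the matrix of their limits is its limit because the sum of the
  entry norms dominates the matrix norm.\<close>

theorem matrix_cstar: "unital_cstar_algebra (Mat m)"
proof -
  let ?M = "Mat m"
  let ?C = "Rect m m"
  interpret MS: Metric_space "carrier ?M" "cdist ?M" by (rule matrix_Metric_space)
  have comp: "MS.mcomplete"
    unfolding MS.mcomplete_def
  proof (intro allI impI)
    fix s assume s: "MS.MCauchy s"
    then have sc: "s n \<in> ?C" for n
      unfolding MS.MCauchy_def by (auto simp: matrix_algebra_sel)
    have "\<exists>l. cconv (\<lambda>n. s n (i, j)) l" if ij: "i < m" "j < m" for i j
    proof (rule cconv_Cauchy)
      show "s n (i, j) \<in> carrier A" for n using sc rmatsD ij by blast
      fix e :: real assume "e > 0"
      then obtain N where N: "\<And>n n'. N \<le> n \<Longrightarrow> N \<le> n' \<Longrightarrow> cdist ?M (s n) (s n') < e"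
        using s unfolding MS.MCauchy_def by blast
      have "cnorm A (s n (i, j) \<ominus> s n' (i, j)) < e" if "N \<le> n" "N \<le> n'" for n n'
        using N[OF that] cnorm_entry_le[OF matrix_minus_closed[OF sc sc] ij, of n n'] sc ij
        by (simp add: cdist_def matrix_algebra_sel matrix_minus_entry)
      then show "\<exists>N. \<forall>n\<ge>N. \<forall>n'\<ge>N. cnorm A (s n (i, j) \<ominus> s n' (i, j)) < e" by blast
    qed
    then obtain L where L: "\<And>i j. i < m \<Longrightarrow> j < m \<Longrightarrow> cconv (\<lambda>n. s n (i, j)) (L i j)" by metis
    define l where "l = (\<lambda>(i, j)\<in>{..<m} \<times> {..<m}. L i j)"
    have le: "l (i, j) = L i j" if "i < m" "j < m" for i j using that by (simp add: l_def)
    have lc: "l \<in> ?C" using L by (auto simp: l_def rmats_def PiE_iff cconv_def)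
    have "(\<lambda>n. \<Sum>i<m. \<Sum>j<m. cnorm A (s n (i, j) \<ominus> L i j)) \<longlonglongrightarrow> (\<Sum>i<m. \<Sum>j<m. 0)"
      using L by (intro tendsto_sum) (auto simp: cconv_def)
    then have lim: "(\<lambda>n. \<Sum>i<m. \<Sum>j<m. cnorm A (s n (i, j) \<ominus> L i j)) \<longlonglongrightarrow> 0" by simp
    have "cdist ?M (s n) l \<le> (\<Sum>i<m. \<Sum>j<m. cnorm A (s n (i, j) \<ominus> L i j))" for n
      using matrix_norm_le_sum[OF matrix_minus_closed[OF sc lc], of n] sc lc
      by (simp add: cdist_def matrix_algebra_sel matrix_minus_entry le)
    then have "(\<lambda>n. cdist ?M (s n) l) \<longlonglongrightarrow> 0"
      by (intro tendsto_sandwich[OF _ _ tendsto_const lim] always_eventually allI) auto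
    then have "limitin MS.mtopology s l sequentially"
      unfolding MS.limitin_metric_dist_null using sc lc by (auto simp: matrix_algebra_sel)
    then show "\<exists>l. limitin MS.mtopology s l sequentially" by blast
  qed
  show ?thesis
    unfolding unital_cstar_algebra_def unital_cstar_algebra_axioms_def
  proof (intro conjI allI impI; (unfold matrix_algebra_sel)?)
    show "Metric_space.mcomplete (Rect m m) (cdist ?M)"
      using comp unfolding matrix_algebra_sel .
  qed (auto simp: matrix_module matrix_ring matrix_mult matrix_adj matrix_closed
      matrix_norm_eq_zero matrix_norm_add matrix_norm_smult matrix_norm_mult matrix_norm_cstar radj_rmul
      rmul_smult_left rmul_smult_right matrix_entries rmatsD adj_add adj_smult intro!: mat_eqI[of _ m])
qed

end

section \<open>Compressions of matrices\<close>

context unital_cstar_algebra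
begin

text \<open>In the block form of \<open>Z\<close> for \<open>q\<close> and \<open>p = 1 - q\<close>,
  the \<open>q\<close>-corner is at least \<open>2 e\<close>. One \<open>e\<close> is kept for the
  lower bound claimed. The other completes a square: for \<open>r = e q + q Z p\<close>, the
  positive element \<open>adj r r / e\<close> is \<open>e q + q Z p + p Z q + p Z q Z p / e\<close>.
  It absorbs the off-diagonal blocks at the cost of a fixed term in the \<open>p\<close>-corner,
  which \<open>t p\<close> dominates for large \<open>t\<close>.\<close>

lemma projection_lift:
  assumes q: "q \<in> carrier A" "adj A q = q" "q \<otimes> q = q" and Z: "Z \<in> carrier A" "adj A Z = Z"
    and e: "e > 0" and pos: "q \<otimes> Z \<otimes> q \<ominus> complex_of_real (2 * e) \<odot> q \<in> npos"
  shows "\<exists>t0. \<forall>t\<ge>t0. Z \<oplus> complex_of_real t \<odot> (\<one> \<ominus> q) \<ominus> scal e \<in> npos"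
proof -
  define p where "p = \<one> \<ominus> q"
  have p: "p \<in> carrier A" "adj A p = p" using q by (auto simp: p_def adj_simps)
  have pq1: "q \<oplus> p = \<one>" using q(1) unfolding p_def by algebra
  have qp: "q \<otimes> p = \<zero>" "p \<otimes> q = \<zero>" "p \<otimes> p = p"
    using q by (simp_all add: p_def minus_eq l_distr r_distr l_minus r_minus r_neg)
  \<comment> \<open>\<open>p G p\<close> is what \<open>t p\<close> has to dominate: the cost of the
    completed square minus the block \<open>p Z p\<close> already present.\<close>
  define G where "G = complex_of_real (1/e) \<odot> (Z \<otimes> q \<otimes> Z) \<ominus> Z"
  have G: "G \<in> carrier A" "adj A G = G" using q Z by (auto simp: G_def adj_simps m_assoc)
  show ?thesis
  proof (intro exI allI impI)
    fix t assume t: "t \<ge> cnorm A G + e"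
    define X1 where "X1 = q \<otimes> Z \<otimes> q"
    define X2 where "X2 = q \<otimes> Z \<otimes> p"
    define X3 where "X3 = p \<otimes> Z \<otimes> q"
    define X4 where "X4 = p \<otimes> Z \<otimes> p"
    define F where "F = complex_of_real (1/e) \<odot> (p \<otimes> Z \<otimes> q \<otimes> Z \<otimes> p)"
    define Q where "Q = complex_of_real e \<odot> q"
    define P where "P = complex_of_real e \<odot> p"
    define T where "T = complex_of_real t \<odot> p"
    note defs = X1_def X2_def X3_def X4_def F_def Q_def P_def T_def
    have c: "X1 \<in> carrier A" "X2 \<in> carrier A" "X3 \<in> carrier A" "X4 \<in> carrier A" "F \<in> carrier A"
      "Q \<in> carrier A" "P \<in> carrier A" "T \<in> carrier A"
      using q Z p by (auto simp: defs)
    have h1: "X1 \<ominus> (Q \<oplus> Q) \<in> npos"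
      using pos q(1) smult_add_left[of q "complex_of_real e" "complex_of_real e"]
      by (simp add: X1_def Q_def)
    define r where "r = Q \<oplus> X2"
    have ar: "adj A r = Q \<oplus> X3" using q Z p by (simp add: r_def Q_def X2_def X3_def adj_simps m_assoc)
    have QX: "Q \<otimes> Q = complex_of_real e \<odot> Q" "Q \<otimes> X2 = complex_of_real e \<odot> X2"
      "X3 \<otimes> Q = complex_of_real e \<odot> X3" "X3 \<otimes> X2 = complex_of_real e \<odot> F"
    proof -
      show "Q \<otimes> Q = complex_of_real e \<odot> Q"
        using q by (simp add: Q_def smult_mult_left smult_mult_right)
      have "q \<otimes> (q \<otimes> (Z \<otimes> p)) = q \<otimes> (Z \<otimes> p)" using q Z(1) p(1) by (metis m_assoc m_closed)
      then show "Q \<otimes> X2 = complex_of_real e \<odot> X2"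
        using q(1) Z(1) p(1) by (simp add: Q_def X2_def smult_mult_left m_assoc)
      show "X3 \<otimes> Q = complex_of_real e \<odot> X3"
        using q Z(1) p(1) by (simp add: Q_def X3_def smult_mult_right m_assoc)
      have "q \<otimes> (q \<otimes> (Z \<otimes> p)) = q \<otimes> (Z \<otimes> p)" using q Z(1) p(1) by (metis m_assoc m_closed)
      then show "X3 \<otimes> X2 = complex_of_real e \<odot> F"
        using q(1) Z(1) p(1) e by (simp add: X2_def X3_def F_def m_assoc)
    qed
    have "adj A r \<otimes> r = (Q \<otimes> Q \<oplus> Q \<otimes> X2) \<oplus> (X3 \<otimes> Q \<oplus> X3 \<otimes> X2)"
      unfolding ar unfolding r_def using c by (simp add: l_distr r_distr a_ac)
    also have "\<dots> = complex_of_real e \<odot> (Q \<oplus> X2 \<oplus> X3 \<oplus> F)"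
      unfolding QX using c by (simp add: smult_add_right a_assoc)
    finally have "complex_of_real e \<odot> (Q \<oplus> X2 \<oplus> X3 \<oplus> F) \<in> npos"
      using npos_adj_mult[of r] c by (simp add: r_def)
    from npos_smult[OF this, of "1/e"] have h2: "Q \<oplus> X2 \<oplus> X3 \<oplus> F \<in> npos" using e c by simp
    have "adj A p \<otimes> (scal (t - e) \<ominus> G) \<otimes> p \<in> npos"
      using t G p by (intro npos_conj npos_cnorm_diff) auto
    also have "adj A p \<otimes> (scal (t - e) \<ominus> G) \<otimes> p
        = complex_of_real (t - e) \<odot> p \<ominus> p \<otimes> G \<otimes> p"
      using G(1) p qp(3) by (simp add: minus_eq l_distr r_distr l_minus r_minus smult_mult_left smult_mult_right)
    also have "complex_of_real (t - e) \<odot> p = T \<ominus> P"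
      using p(1) by (simp add: T_def P_def smult_diff_left)
    also have "p \<otimes> G \<otimes> p = F \<ominus> X4"
      unfolding G_def F_def X4_def using q(1) Z(1) p(1)
      by (simp add: minus_eq l_distr r_distr l_minus r_minus smult_mult_left smult_mult_right m_assoc)
    finally have h3: "(T \<ominus> P) \<ominus> (F \<ominus> X4) \<in> npos" .
    have "Z = (q \<oplus> p) \<otimes> Z \<otimes> (q \<oplus> p)" unfolding pq1 using Z by simp
    also have "\<dots> = X1 \<oplus> X2 \<oplus> X3 \<oplus> X4"
      unfolding X1_def X2_def X3_def X4_def using q(1) p(1) Z(1) by (simp add: l_distr r_distr a_ac)
    finally have Ze: "Z = X1 \<oplus> X2 \<oplus> X3 \<oplus> X4" .
    have "scal e = Q \<oplus> P"
      unfolding pq1[symmetric] Q_def P_def using q(1) p(1) by (simp add: smult_add_right)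
    then have "Z \<oplus> complex_of_real t \<odot> (\<one> \<ominus> q) \<ominus> scal e
        = (X1 \<oplus> X2 \<oplus> X3 \<oplus> X4) \<oplus> T \<ominus> (Q \<oplus> P)"
      by (simp add: Ze T_def p_def)
    \<comment> \<open>The middle bracket is the completed square. \<open>Q\<close> is subtracted
      twice in the first bracket, once to pay for the square and once for the lower bound.\<close>
    also have "\<dots> = (X1 \<ominus> (Q \<oplus> Q)) \<oplus> (Q \<oplus> X2 \<oplus> X3 \<oplus> F) \<oplus> ((T \<ominus> P) \<ominus> (F \<ominus> X4))"
      using c by algebra
    also have "\<dots> \<in> npos" by (rule npos_add[OF npos_add[OF h1 h2] h3])
    finally show "Z \<oplus> complex_of_real t \<odot> (\<one> \<ominus> q) \<ominus> scal e \<in> npos" .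
  qed
qed

section \<open>The strict order and the lifting of bounds from a corner\<close>

lemma self_adjoint_iff: "x \<in> self_adjoint A \<longleftrightarrow> x \<in> carrier A \<and> adj A x = x"
  by (simp add: self_adjoint_def)

lemma strictly_below_npos:
  "strictly_below A x y \<longleftrightarrow> (\<exists>e>0. (y \<ominus> x) \<ominus> scal e \<in> npos)"
  by (simp add: strictly_below_def positive_eq_npos)

lemma strictly_below_uminus:
  assumes "x \<in> carrier A" "y \<in> carrier A"
  shows "strictly_below A (\<ominus> x) (\<ominus> y) \<longleftrightarrow> strictly_below A y x"
proof -
  have "\<ominus> y \<ominus> \<ominus> x = x \<ominus> y" using assms by (simp add: minus_eq a_comm)
  then show ?thesis by (simp add: strictly_below_def)
qed

text \<open>\<open>q b q = b\<close> says that \<open>b\<close> lives in the corner, and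
  \<open>projection_lift\<close> is applied to \<open>b - x\<close>. The conclusion is phrased for
  all large \<open>t\<close>, so that finitely many bounds can share one \<open>t\<close>.\<close>

lemma projection_lift_below:
  assumes q: "q \<in> carrier A" "adj A q = q" "q \<otimes> q = q" and x: "x \<in> carrier A" "adj A x = x"
    and b: "b \<in> carrier A" "adj A b = b" "q \<otimes> b \<otimes> q = b" and d: "d > 0"
    and pos: "b \<ominus> q \<otimes> x \<otimes> q \<ominus> complex_of_real d \<odot> q \<in> npos"
  shows "\<forall>\<^sub>F t in at_top. strictly_below A (x \<ominus> complex_of_real t \<odot> (\<one> \<ominus> q)) b"
proof -
  have "q \<otimes> (b \<ominus> x) \<otimes> q = q \<otimes> b \<otimes> q \<ominus> q \<otimes> x \<otimes> q" using q(1) x(1) b(1) by algebra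
  then have "q \<otimes> (b \<ominus> x) \<otimes> q \<ominus> complex_of_real (2 * (d / 2)) \<odot> q \<in> npos" using pos b(3) by simp
  from projection_lift[OF q _ _ _ this] x b d obtain t0 where t0:
    "\<And>t. t \<ge> t0 \<Longrightarrow> b \<ominus> x \<oplus> complex_of_real t \<odot> (\<one> \<ominus> q) \<ominus> scal (d / 2) \<in> npos"
    by (auto simp: adj_diff)
  show ?thesis
  proof (rule eventually_at_top_linorderI[of t0])
    fix t assume "t \<ge> t0"
    moreover have "b \<ominus> x \<oplus> complex_of_real t \<odot> (\<one> \<ominus> q) = b \<ominus> (x \<ominus> complex_of_real t \<odot> (\<one> \<ominus> q))"
      using q x b by (simp add: minus_eq minus_add a_assoc)
    ultimately show "strictly_below A (x \<ominus> complex_of_real t \<odot> (\<one> \<ominus> q)) b"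
      using t0[of t] d by (auto simp: strictly_below_npos intro!: exI[of _ "d / 2"])
  qed
qed

lemma projection_lift_above:
  assumes q: "q \<in> carrier A" "adj A q = q" "q \<otimes> q = q" and y: "y \<in> carrier A" "adj A y = y"
    and b: "b \<in> carrier A" "adj A b = b" "q \<otimes> b \<otimes> q = b" and d: "d > 0"
    and pos: "q \<otimes> y \<otimes> q \<ominus> b \<ominus> complex_of_real d \<odot> q \<in> npos"
  shows "\<forall>\<^sub>F t in at_top. strictly_below A b (y \<oplus> complex_of_real t \<odot> (\<one> \<ominus> q))"
proof -
  have "\<ominus> b \<ominus> q \<otimes> (\<ominus> y) \<otimes> q = q \<otimes> y \<otimes> q \<ominus> b"
    using q(1) y(1) b(1) by (simp add: minus_eq l_minus r_minus a_comm)
  then have "\<forall>\<^sub>F t in at_top. strictly_below A (\<ominus> y \<ominus> complex_of_real t \<odot> (\<one> \<ominus> q)) (\<ominus> b)"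
    using q y b d pos by (intro projection_lift_below[of _ _ _ d]) (auto simp: adj_uminus l_minus r_minus)
  then show ?thesis
  proof (rule eventually_mono)
    fix t
    have "\<ominus> y \<ominus> complex_of_real t \<odot> (\<one> \<ominus> q) = \<ominus> (y \<oplus> complex_of_real t \<odot> (\<one> \<ominus> q))"
      using q y by (simp add: minus_eq minus_add)
    then show "strictly_below A (\<ominus> y \<ominus> complex_of_real t \<odot> (\<one> \<ominus> q)) (\<ominus> b) \<Longrightarrow>
        strictly_below A b (y \<oplus> complex_of_real t \<odot> (\<one> \<ominus> q))"
      using strictly_below_uminus[of "y \<oplus> complex_of_real t \<odot> (\<one> \<ominus> q)" b] q y b by simp
  qed
qed

text \<open>Forward, \<open>z\<close> is a square, and the form becomes an inner product of a column
  with itself. Backward, \<open>negative_part\<close> gives \<open>d z d = - w^2\<close>; evaluating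
  the form at \<open>d v\<close> shows that \<open>w v\<close> has norm 0 for all \<open>v\<close>,
  so \<open>w = 0\<close>. The quadratic form describes positivity in a way that compares matrices
  of different sizes.\<close>

lemma matrix_positive_iff:
  "z \<in> cstar_positive (Mat m) \<longleftrightarrow> z \<in> Rect m m \<and> radj m m z = z \<and>
    (\<forall>v\<in>Cols m. rinner m v (ract m m z v) \<in> npos)"
proof -
  interpret MC: unital_cstar_algebra "Mat m" by (rule matrix_cstar)
  note sel = matrix_algebra_sel matrix_adj matrix_mult
  have quad: "rinner m v (ract m m (rmul m m m y y) v) = rinner m (ract m m y v) (ract m m y v)"
    if "y \<in> Rect m m" "radj m m y = y" "v \<in> Cols m" for y v
    using rinner_ract[OF that(1,3) ract_closed[OF that(1,3)]] that
    by (simp only: ract_ract[OF that(1,1,3)])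
  show ?thesis unfolding MC.positive_eq_npos
  proof (intro iffI conjI ballI)
    assume z: "z \<in> MC.npos"
    show "z \<in> Rect m m" "radj m m z = z" using MC.nposD[OF z] by (auto simp: sel)
    fix v assume v: "v \<in> Cols m"
    obtain y where "y \<in> MC.npos" "rmul m m m y y = z" using MC.npos_sqrt[OF z] by (auto simp: sel)
    then have y: "y \<in> Rect m m" "radj m m y = y" "rmul m m m y y = z"
      using MC.nposD by (auto simp: sel)
    show "rinner m v (ract m m z v) \<in> npos"
      using quad[OF y(1,2) v] rinner_self_npos[OF ract_closed[OF y(1) v]] y(3) by simp
  next
    assume "z \<in> Rect m m \<and> radj m m z = z \<and>
      (\<forall>v\<in>Cols m. rinner m v (ract m m z v) \<in> npos)"
    then have z: "z \<in> Rect m m" "radj m m z = z"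
      and pos: "\<And>v. v \<in> Cols m \<Longrightarrow> rinner m v (ract m m z v) \<in> npos" by auto
    obtain d w where d: "d \<in> Rect m m" "radj m m d = d"
      and w: "w \<in> Rect m m" "radj m m w = w"
      and dzd: "rmul m m m (rmul m m m d z) d = \<ominus>\<^bsub>Mat m\<^esub> (rmul m m m w w)"
      and wz: "w = \<zero>\<^bsub>Mat m\<^esub> \<longrightarrow> z \<in> MC.npos"
      using MC.negative_part[of z] z by (auto simp: sel)
    have "column_norm m A (ract m m w v) \<le> 0 * column_norm m A v" if v: "v \<in> Cols m" for v
    proof -
      let ?ww = "rmul m m m w w"
      have wwc: "?ww \<in> Rect m m" using w by auto
      have dv: "ract m m d v \<in> Cols m" using d v by auto
      have "rinner m (ract m m d v) (ract m m z (ract m m d v))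
          = rinner m v (ract m m d (ract m m z (ract m m d v)))"
        using rinner_ract[OF d(1) v ract_closed[OF z(1) dv]] d(2) by simp
      also have "ract m m d (ract m m z (ract m m d v)) = ract m m (rmul m m m (rmul m m m d z) d) v"
        using d z v by (simp add: ract_ract rmul_assoc)
      also have "rinner m v \<dots> = \<ominus> (rinner m v (ract m m ?ww v))"
      proof -
        have "\<ominus>\<^bsub>Mat m\<^esub> ?ww = (-1) \<odot>\<^bsub>Mat m\<^esub> ?ww"
          using wwc by (simp add: MC.smult_minus_one sel)
        moreover have "rinner m v (ract m m ((-1) \<odot>\<^bsub>Mat m\<^esub> ?ww) v)
            = rinner m v (\<lambda>i. (-1) \<odot> ract m m ?ww v i)"
          unfolding rinner_def
        proof (intro finsum_cong' refl)
          fix i assume i: "i \<in> {..<m}"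
          then have "ract m m ((-1) \<odot>\<^bsub>Mat m\<^esub> ?ww) v i = (\<Oplus>j\<in>{..<m}. (-1) \<odot> (?ww (i, j) \<otimes> v j))"
            using v wwc by (subst ract_entry)
              (auto simp: matrix_entries rmatsD[OF wwc] Pi_iff smult_mult_left intro!: finsum_cong')
          also have "\<dots> = (-1) \<odot> (\<Oplus>j\<in>{..<m}. ?ww (i, j) \<otimes> v j)"
            using i v by (intro finsum_smult[symmetric]) (auto simp: rmatsD[OF wwc] Pi_iff)
          also have "\<dots> = (-1) \<odot> ract m m ?ww v i" using i by (simp add: ract_entry)
          finally show "adj A (v i) \<otimes> ract m m ((-1) \<odot>\<^bsub>Mat m\<^esub> ?ww) v i
              = adj A (v i) \<otimes> ((-1) \<odot> ract m m ?ww v i)" by simp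
        qed (use v ract_closed[OF wwc v] in \<open>auto simp: Pi_iff\<close>)
        ultimately show ?thesis
          using v ract_closed[OF wwc v] by (simp add: dzd rinner_smult_right smult_minus_one)
      qed
      finally have "\<ominus> (rinner m v (ract m m ?ww v)) \<in> npos" using pos[OF dv] by simp
      moreover have "rinner m v (ract m m ?ww v) \<in> npos"
        using quad[OF w v] rinner_self_npos[OF ract_closed[OF w(1) v]] by simp
      ultimately have "rinner m (ract m m w v) (ract m m w v) = \<zero>"
        using npos_antisym quad[OF w v] by metis
      then show ?thesis by (simp add: column_norm_rinner)
    qed
    then have "matrix_norm m A w \<le> 0" by (intro matrix_norm_le) auto
    then have "w = \<zero>\<^bsub>Mat m\<^esub>"
      using matrix_norm_nonneg[OF w(1)] matrix_norm_eq_zero[OF w(1)] by simp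
    then show "z \<in> MC.npos" using wz by blast
  qed
qed

section \<open>Compression by a rectangular matrix\<close>

definition rconj :: "nat \<Rightarrow> nat \<Rightarrow> (nat \<times> nat \<Rightarrow> 'a) \<Rightarrow> (nat \<times> nat \<Rightarrow> 'a) \<Rightarrow> nat \<times> nat \<Rightarrow> 'a"
  where "rconj p q V Z = rmul q p q (radj p q V) (rmul p p q Z V)"

lemma rconj_closed [simp, intro]:
  "V \<in> Rect p q \<Longrightarrow> Z \<in> Rect p p \<Longrightarrow> rconj p q V Z \<in> Rect q q"
  unfolding rconj_def by auto

lemma rconj_adj:
  assumes "V \<in> Rect p q" "Z \<in> Rect p p"
  shows "radj q q (rconj p q V Z) = rconj p q V (radj p p Z)"
proof -
  have "radj q q (rconj p q V Z) = rmul q p q (rmul q p p (radj p q V) (radj p p Z)) (radj q p (radj p q V))"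
    unfolding rconj_def using assms by (subst radj_rmul[of _ q p _ q]) (auto simp: radj_rmul)
  then show ?thesis using assms by (simp add: rconj_def rmul_assoc)
qed

lemma rconj_rconj:
  assumes "V \<in> Rect p q" "W \<in> Rect q r" "Z \<in> Rect p p"
  shows "rconj q r W (rconj p q V Z) = rconj p r (rmul p q r V W) Z"
proof -
  have "rconj q r W (rconj p q V Z)
      = rmul r q r (radj q r W) (rmul q p r (radj p q V) (rmul p p r Z (rmul p q r V W)))"
    unfolding rconj_def using assms by (simp add: rmul_assoc[of _ q p _ q _ r] rmul_assoc[of _ p p _ q _ r])
  also have "\<dots> = rmul r p r (rmul r q p (radj q r W) (radj p q V)) (rmul p p r Z (rmul p q r V W))"
    using assms by (intro rmul_assoc[symmetric]) auto
  finally show ?thesis using assms by (simp add: rconj_def radj_rmul)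
qed

lemma rconj_add:
  assumes "V \<in> Rect p q" "Y \<in> Rect p p" "Z \<in> Rect p p"
  shows "rconj p q V (Y \<oplus>\<^bsub>Mat p\<^esub> Z) = rconj p q V Y \<oplus>\<^bsub>Mat q\<^esub> rconj p q V Z"
proof (rule mat_eqI[of _ q])
  fix i j assume ij: "i < q" "j < q"
  let ?V = "radj p q V"
  have V: "?V \<in> Rect q p" using assms by auto
  have "rconj p q V (Y \<oplus>\<^bsub>Mat p\<^esub> Z) (i, j)
      = (\<Oplus>l\<in>{..<p}. ?V (i, l) \<otimes> rmul p p q Y V (l, j) \<oplus> ?V (i, l) \<otimes> rmul p p q Z V (l, j))"
    unfolding rconj_def rmul_entry[OF ij] using assms ij V
    by (intro finsum_cong')
      (auto simp: rmul_add_left r_distr rmatsD[OF V] rmatsD[OF rmul_closed[OF assms(2,1)]]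
        rmatsD[OF rmul_closed[OF assms(3,1)]] simp del: radj_entry)
  also have "\<dots> = rconj p q V Y (i, j) \<oplus> rconj p q V Z (i, j)"
    unfolding rconj_def rmul_entry[OF ij] using assms ij V
    by (intro finsum_addf)
      (auto simp: rmatsD[OF V] rmatsD[OF rmul_closed[OF assms(2,1)]]
        rmatsD[OF rmul_closed[OF assms(3,1)]] simp del: radj_entry)
  finally show "rconj p q V (Y \<oplus>\<^bsub>Mat p\<^esub> Z) (i, j)
      = (rconj p q V Y \<oplus>\<^bsub>Mat q\<^esub> rconj p q V Z) (i, j)"
    using ij by (simp add: matrix_entries)
qed (use assms in \<open>auto simp: matrix_closed\<close>)

lemma rconj_smult:
  assumes "V \<in> Rect p q" "Z \<in> Rect p p"
  shows "rconj p q V (c \<odot>\<^bsub>Mat p\<^esub> Z) = c \<odot>\<^bsub>Mat q\<^esub> rconj p q V Z"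
proof (rule mat_eqI[of _ q])
  fix i j assume ij: "i < q" "j < q"
  let ?V = "radj p q V"
  have V: "?V \<in> Rect q p" using assms by auto
  have "rconj p q V (c \<odot>\<^bsub>Mat p\<^esub> Z) (i, j)
      = (\<Oplus>l\<in>{..<p}. c \<odot> (?V (i, l) \<otimes> rmul p p q Z V (l, j)))"
    unfolding rconj_def rmul_entry[OF ij] using assms ij V
    by (intro finsum_cong')
      (auto simp: rmul_smult_left smult_mult_right rmatsD[OF V] rmatsD[OF rmul_closed[OF assms(2,1)]]
        simp del: radj_entry)
  also have "\<dots> = c \<odot> rconj p q V Z (i, j)"
    unfolding rconj_def rmul_entry[OF ij] using assms ij V
    by (intro finsum_smult[symmetric])
      (auto simp: rmatsD[OF V] rmatsD[OF rmul_closed[OF assms(2,1)]] simp del: radj_entry)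
  finally show "rconj p q V (c \<odot>\<^bsub>Mat p\<^esub> Z) (i, j)
      = (c \<odot>\<^bsub>Mat q\<^esub> rconj p q V Z) (i, j)"
    using ij by (simp add: matrix_entries)
qed (use assms in \<open>auto simp: matrix_closed\<close>)

lemma rconj_minus:
  assumes "V \<in> Rect p q" "Y \<in> Rect p p" "Z \<in> Rect p p"
  shows "rconj p q V (Y \<ominus>\<^bsub>Mat p\<^esub> Z) = rconj p q V Y \<ominus>\<^bsub>Mat q\<^esub> rconj p q V Z"
proof -
  interpret P: unital_cstar_algebra "Mat p" by (rule matrix_cstar)
  interpret Q: unital_cstar_algebra "Mat q" by (rule matrix_cstar)
  show ?thesis
    using assms P.smult_minus_one[of Z] Q.smult_minus_one[of "rconj p q V Z"]
      rconj_add[OF assms(1,2) matrix_closed(2)[OF assms(3)], of "-1"] rconj_smult[OF assms(1,3), of "-1"]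
    by (simp add: P.minus_eq Q.minus_eq matrix_algebra_sel)
qed

lemma rconj_one: "V \<in> Rect p q \<Longrightarrow> rconj p q V \<one>\<^bsub>Mat p\<^esub> = rmul q p q (radj p q V) V"
  by (simp add: rconj_def rmul_one_left)

text \<open>The form of the compression at \<open>v\<close> is the form of \<open>Z\<close> at the
  column \<open>V v\<close>. As \<open>V\<close> need not be square, \<open>npos_conj\<close> inside
  a single matrix algebra does not cover this.\<close>

lemma rconj_positive:
  assumes V: "V \<in> Rect p q" and Z: "Z \<in> cstar_positive (Mat p)"
  shows "rconj p q V Z \<in> cstar_positive (Mat q)"
  unfolding matrix_positive_iff
proof (intro conjI ballI)
  have z: "Z \<in> Rect p p" "radj p p Z = Z"
    and pos: "\<And>v. v \<in> Cols p \<Longrightarrow> rinner p v (ract p p Z v) \<in> npos"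
    using Z unfolding matrix_positive_iff by auto
  show "rconj p q V Z \<in> Rect q q" using V z by auto
  show "radj q q (rconj p q V Z) = rconj p q V Z" using rconj_adj[OF V z(1)] z(2) by simp
  fix v assume v: "v \<in> Cols q"
  have Vv: "ract p q V v \<in> Cols p" using V v by auto
  have "ract q q (rconj p q V Z) v = ract q p (radj p q V) (ract p p Z (ract p q V v))"
    unfolding rconj_def using V z v by (simp add: ract_ract)
  then have "rinner q v (ract q q (rconj p q V Z) v)
      = rinner p (ract p q V v) (ract p p Z (ract p q V v))"
    using rinner_ract[OF radj_closed[OF V] v ract_closed[OF z(1) Vv]] V by simp
  then show "rinner q v (ract q q (rconj p q V Z) v) \<in> npos" using pos[OF Vv] by simp
qed

section \<open>Operator subsystems\<close>

lemma submodule_iff: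
  "submodule T complex_ring A \<longleftrightarrow> T \<subseteq> carrier A \<and> \<zero> \<in> T \<and> (\<forall>x\<in>T. \<forall>y\<in>T. x \<oplus> y \<in> T) \<and>
    (\<forall>c. \<forall>x\<in>T. c \<odot> x \<in> T)"
proof
  assume T: "submodule T complex_ring A"
  have "\<zero> \<in> T" using subgroup.one_closed[OF submodule.axioms(1)[OF T]] by simp
  then show "T \<subseteq> carrier A \<and> \<zero> \<in> T \<and> (\<forall>x\<in>T. \<forall>y\<in>T. x \<oplus> y \<in> T) \<and> (\<forall>c. \<forall>x\<in>T. c \<odot> x \<in> T)"
    using submoduleE[OF T] by auto
next
  assume T: "T \<subseteq> carrier A \<and> \<zero> \<in> T \<and> (\<forall>x\<in>T. \<forall>y\<in>T. x \<oplus> y \<in> T) \<and> (\<forall>c. \<forall>x\<in>T. c \<odot> x \<in> T)"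
  then have "\<ominus> x \<in> T" if "x \<in> T" for x
    using that smult_minus_one[of x] by (metis subsetD)
  then show "submodule T complex_ring A" using T by (intro submoduleI) auto
qed

lemma operator_subsystem_iff:
  "operator_subsystem A T \<longleftrightarrow> T \<subseteq> carrier A \<and> \<one> \<in> T \<and> (\<forall>x\<in>T. \<forall>y\<in>T. x \<oplus> y \<in> T) \<and>
    (\<forall>c. \<forall>x\<in>T. c \<odot> x \<in> T) \<and> (\<forall>x\<in>T. adj A x \<in> T)"
proof -
  have "\<zero> \<in> T" if "\<one> \<in> T" "\<forall>c. \<forall>x\<in>T. c \<odot> x \<in> T"
    using that smult_0[OF one_closed] by metis
  then show ?thesis unfolding operator_subsystem_def submodule_iff by auto
qed

lemma operator_subsystemD:
  assumes "operator_subsystem A T"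
  shows "x \<in> T \<Longrightarrow> x \<in> carrier A" "\<one> \<in> T" "x \<in> T \<Longrightarrow> y \<in> T \<Longrightarrow> x \<oplus> y \<in> T" "x \<in> T \<Longrightarrow> c \<odot> x \<in> T"
    "x \<in> T \<Longrightarrow> adj A x \<in> T" "\<zero> \<in> T" "x \<in> T \<Longrightarrow> y \<in> T \<Longrightarrow> x \<ominus> y \<in> T" "T \<subseteq> carrier A"
proof -
  have T: "T \<subseteq> carrier A" "\<one> \<in> T" "\<And>x y. x \<in> T \<Longrightarrow> y \<in> T \<Longrightarrow> x \<oplus> y \<in> T"
    "\<And>c x. x \<in> T \<Longrightarrow> c \<odot> x \<in> T" "\<And>x. x \<in> T \<Longrightarrow> adj A x \<in> T"
    using assms unfolding operator_subsystem_iff by auto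
  then show "x \<in> T \<Longrightarrow> x \<in> carrier A" "\<one> \<in> T" "x \<in> T \<Longrightarrow> y \<in> T \<Longrightarrow> x \<oplus> y \<in> T" "x \<in> T \<Longrightarrow> c \<odot> x \<in> T"
    "x \<in> T \<Longrightarrow> adj A x \<in> T" "T \<subseteq> carrier A" by auto
  show "\<zero> \<in> T" using T(4)[OF T(2), of 0] by simp
  assume "x \<in> T" "y \<in> T"
  then show "x \<ominus> y \<in> T" using T(3)[of x "(-1) \<odot> y"] T(4)[of y "-1"] T(1)
    by (metis minus_eq smult_minus_one subsetD)
qed

lemma matrix_operator_subsystem:
  assumes T: "operator_subsystem A T"
  shows "operator_subsystem (Mat m) (mats m T)"
proof -
  interpret MC: unital_cstar_algebra "Mat m" by (rule matrix_cstar)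
  note D = operator_subsystemD[OF T]
  show ?thesis
    unfolding MC.operator_subsystem_iff matrix_algebra_sel mats_eq_rmats
    using rmats_mono[OF D(8), of m m] D
    by (auto simp: matrix_algebra_def rmats_def PiE_iff)
qed

lemma self_adjoint_part:
  assumes T: "operator_subsystem A T" and x: "x \<in> T"
  shows "(1/2) \<odot> (x \<oplus> adj A x) \<in> T \<inter> self_adjoint A"
proof -
  have "x \<in> carrier A" using operator_subsystemD(1)[OF T x] .
  moreover have "(1/2) \<odot> (x \<oplus> adj A x) \<in> T" 
    by (intro operator_subsystemD(3,4,5)[OF T] x)
  ultimately show ?thesis by (simp add: self_adjoint_iff adj_simps a_comm)
qed

text \<open>\<open>?f\<close> embeds the small algebra as the corner of \<open>q = V adj V\<close>,
  and \<open>?g\<close> compresses back. The hypothesis on \<open>V adj V\<close> puts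
  \<open>p = 1 - q\<close> into the system upstairs, and \<open>?g p\<close> is 0, so bounds may be
  shifted by multiples of \<open>p\<close> before interpolating there. The hypothesis on
  \<open>F\<close> keeps the compressed interpolant in the target.\<close>

lemma interpolates_compress:
  assumes nk: "n \<ge> 1" "k \<ge> 1"
    and V: "V \<in> Rect N m" "rmul m N m (radj N m V) V = \<one>\<^bsub>Mat m\<^esub>"
    and T: "operator_subsystem A T" and VV: "rmul N m N V (radj N m V) \<in> mats N T"
    and int: "interpolates n k (Mat N) (mats N T) (mats N F)"
    and F: "\<And>Z. Z \<in> mats N F \<Longrightarrow> rconj N m V Z \<in> mats m F"
  shows "interpolates n k (Mat m) (rconj N m V ` mats N T) (mats m F)"
proof -
  let ?M = "Mat m"
  let ?N = "Mat N"
  let ?V' = "radj N m V"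
  interpret MC: unital_cstar_algebra ?M by (rule matrix_cstar)
  interpret NC: unital_cstar_algebra ?N by (rule matrix_cstar)
  note sel = matrix_algebra_sel matrix_adj matrix_mult
  let ?f = "rconj m N ?V'"
  let ?g = "rconj N m V"
  define q where "q = rmul N m N V ?V'"
  define p where "p = \<one>\<^bsub>?N\<^esub> \<ominus>\<^bsub>?N\<^esub> q"
  have V': "?V' \<in> Rect m N" using V by auto
  have oM: "\<one>\<^bsub>?M\<^esub> \<in> carrier ?M" and oN: "\<one>\<^bsub>?N\<^esub> \<in> carrier ?N" by auto
  have radj_one: "radj m m \<one>\<^bsub>?M\<^esub> = \<one>\<^bsub>?M\<^esub>" using MC.adj_one by (simp add: sel)
  have fc: "?f c \<in> carrier ?N" if "c \<in> carrier ?M" for c using that V' by (simp add: sel)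
  have gc: "?g Z \<in> carrier ?M" if "Z \<in> carrier ?N" for Z using that V(1) by (simp add: sel)
  have fadj: "adj ?N (?f c) = ?f (adj ?M c)" if "c \<in> carrier ?M" for c
    using that rconj_adj[OF V'] by (simp add: sel)
  have gadj: "adj ?M (?g Z) = ?g (adj ?N Z)" if "Z \<in> carrier ?N" for Z
    using that rconj_adj[OF V(1)] by (simp add: sel)
  have gf: "?g (?f c) = c" if "c \<in> carrier ?M" for c
  proof -
    have "?g (?f c) = rconj m m \<one>\<^bsub>?M\<^esub> c" using rconj_rconj[OF V' V(1)] that V(2) by (simp add: sel)
    then show ?thesis using that by (simp add: rconj_def radj_one sel rmul_one_left rmul_one_right)
  qed
  have g1: "?g \<one>\<^bsub>?N\<^esub> = \<one>\<^bsub>?M\<^esub>" using rconj_one[OF V(1)] V(2) by simp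
  have f1: "?f \<one>\<^bsub>?M\<^esub> = q" using rconj_one[OF V'] V(1) by (simp add: q_def)
  have q: "q \<in> carrier ?N" "adj ?N q = q"
    using fc[OF oM] fadj[OF oM] unfolding MC.adj_one f1 by simp_all
  have fg: "?f (?g Z) = q \<otimes>\<^bsub>?N\<^esub> Z \<otimes>\<^bsub>?N\<^esub> q" if Z: "Z \<in> carrier ?N" for Z
  proof -
    have "?f (?g Z) = rconj N N q Z" using rconj_rconj[OF V(1) V'] Z by (simp add: sel q_def)
    also have "\<dots> = q \<otimes>\<^bsub>?N\<^esub> (Z \<otimes>\<^bsub>?N\<^esub> q)" using q(2) by (simp add: rconj_def sel)
    finally show ?thesis using Z q NC.m_assoc by simp
  qed
  have qq: "q \<otimes>\<^bsub>?N\<^esub> q = q" using fg[OF oN] q g1 f1 by simp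
  have gp: "?g p = \<zero>\<^bsub>?M\<^esub>"
  proof -
    have "?g q = \<one>\<^bsub>?M\<^esub>" using gf[OF oM] f1 by simp
    then show ?thesis using rconj_minus[OF V(1), of "\<one>\<^bsub>?N\<^esub>" q] oN q g1 oM
      by (simp add: p_def sel MC.diff_eq_zero)
  qed
  have pc: "p \<in> carrier ?N" "adj ?N p = p" using q by (auto simp: p_def NC.adj_simps)
  have gminus: "?g (U \<ominus>\<^bsub>?N\<^esub> Y) = ?g U \<ominus>\<^bsub>?M\<^esub> ?g Y" if "U \<in> carrier ?N" "Y \<in> carrier ?N" for U Y
    using rconj_minus[OF V(1)] that by (simp add: sel)
  have fminus: "?f (U \<ominus>\<^bsub>?M\<^esub> Y) = ?f U \<ominus>\<^bsub>?N\<^esub> ?f Y" if "U \<in> carrier ?M" "Y \<in> carrier ?M" for U Y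
    using rconj_minus[OF V'] that by (simp add: sel)
  have gadd: "?g (U \<oplus>\<^bsub>?N\<^esub> Y) = ?g U \<oplus>\<^bsub>?M\<^esub> ?g Y" if "U \<in> carrier ?N" "Y \<in> carrier ?N" for U Y
    using rconj_add[OF V(1)] that by (simp add: sel)
  have gsmult: "?g (c \<odot>\<^bsub>?N\<^esub> U) = c \<odot>\<^bsub>?M\<^esub> ?g U" if "U \<in> carrier ?N" for U c
    using rconj_smult[OF V(1)] that by (simp add: sel)
  have fsmult: "?f (c \<odot>\<^bsub>?M\<^esub> U) = c \<odot>\<^bsub>?N\<^esub> ?f U" if "U \<in> carrier ?M" for U c
    using rconj_smult[OF V'] that by (simp add: sel)
  have gpos: "?g Z \<in> MC.npos" if "Z \<in> NC.npos" for Z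
    using rconj_positive[OF V(1)] that by (simp add: NC.positive_eq_npos MC.positive_eq_npos)
  have fpos: "?f Z \<in> NC.npos" if "Z \<in> MC.npos" for Z
    using rconj_positive[OF V'] that by (simp add: NC.positive_eq_npos MC.positive_eq_npos)
  have below: "\<forall>\<^sub>F t in at_top. strictly_below ?N (U \<ominus>\<^bsub>?N\<^esub> complex_of_real t \<odot>\<^bsub>?N\<^esub> p) (?f b)"
    if U: "U \<in> self_adjoint ?N" and b: "b \<in> self_adjoint ?M" and xb: "strictly_below ?M (?g U) b" for U b
  proof -
    have c: "U \<in> carrier ?N" "adj ?N U = U" "b \<in> carrier ?M" "adj ?M b = b"
      using U b by (auto simp: NC.self_adjoint_iff MC.self_adjoint_iff)
    obtain d where d: "d > 0" "b \<ominus>\<^bsub>?M\<^esub> ?g U \<ominus>\<^bsub>?M\<^esub> MC.scal d \<in> MC.npos"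
      using xb by (auto simp: MC.strictly_below_npos)
    show ?thesis
      unfolding p_def using fpos[OF d(2)] c fc gc fadj gf oM fg[of "?f b"]
      by (intro NC.projection_lift_below[OF q qq _ _ _ _ _ d(1)]) (auto simp: fminus fsmult f1 fg[symmetric])
  qed
  have above: "\<forall>\<^sub>F t in at_top. strictly_below ?N (?f b) (U \<oplus>\<^bsub>?N\<^esub> complex_of_real t \<odot>\<^bsub>?N\<^esub> p)"
    if U: "U \<in> self_adjoint ?N" and b: "b \<in> self_adjoint ?M" and xb: "strictly_below ?M b (?g U)" for U b
  proof -
    have c: "U \<in> carrier ?N" "adj ?N U = U" "b \<in> carrier ?M" "adj ?M b = b"
      using U b by (auto simp: NC.self_adjoint_iff MC.self_adjoint_iff)
    obtain d where d: "d > 0" "?g U \<ominus>\<^bsub>?M\<^esub> b \<ominus>\<^bsub>?M\<^esub> MC.scal d \<in> MC.npos"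
      using xb by (auto simp: MC.strictly_below_npos)
    show ?thesis
      unfolding p_def using fpos[OF d(2)] c fc gc fadj gf oM fg[of "?f b"]
      by (intro NC.projection_lift_above[OF q qq _ _ _ _ _ d(1)]) (auto simp: fminus fsmult f1 fg[symmetric])
  qed
  have descend: "strictly_below ?M (?g U) (?g Y)"
    if c: "U \<in> carrier ?N" "Y \<in> carrier ?N" and XY: "strictly_below ?N U Y" for U Y
  proof -
    obtain e where e: "e > 0" "Y \<ominus>\<^bsub>?N\<^esub> U \<ominus>\<^bsub>?N\<^esub> NC.scal e \<in> NC.npos"
      using XY by (auto simp: NC.strictly_below_npos)
    from gpos[OF e(2)] have "?g Y \<ominus>\<^bsub>?M\<^esub> ?g U \<ominus>\<^bsub>?M\<^esub> MC.scal e \<in> MC.npos"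
      using c by (simp add: gminus gsmult g1)
    then show ?thesis using e(1) by (auto simp: MC.strictly_below_npos)
  qed
  have TN: "operator_subsystem ?N (mats N T)" by (rule matrix_operator_subsystem[OF T])
  note TD = NC.operator_subsystemD[OF TN]
  have pT: "p \<in> mats N T" unfolding p_def using TD VV by (auto simp: q_def)
  \<comment> \<open>The preimage \<open>U\<close> of a self-adjoint element need not be
    self-adjoint, but its real part is again a preimage, since compression respects
    adjoints.\<close>
  have pre: "\<exists>U\<in>mats N T \<inter> self_adjoint ?N. ?g U = x" if x: "x \<in> ?g ` mats N T \<inter> self_adjoint ?M" for x
  proof -
    obtain U where U: "U \<in> mats N T" "x = ?g U" using x by auto
    have Xc: "U \<in> carrier ?N" using TD(1) U by blast
    have xs: "x \<in> carrier ?M" "adj ?M x = x" using x by (auto simp: MC.self_adjoint_iff)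
    have "?g ((1/2) \<odot>\<^bsub>?N\<^esub> (U \<oplus>\<^bsub>?N\<^esub> adj ?N U)) = (1/2) \<odot>\<^bsub>?M\<^esub> (x \<oplus>\<^bsub>?M\<^esub> adj ?M x)"
      using Xc U by (simp add: gsmult gadd gadj)
    also have "\<dots> = x" using xs by (simp add: MC.smult_half_add)
    finally show ?thesis using NC.self_adjoint_part[OF TN U(1)] by blast
  qed
  show ?thesis
    unfolding interpolates_def
  proof (intro allI impI)
    fix x y :: "nat \<Rightarrow> nat \<times> nat \<Rightarrow> 'a"
    assume x: "\<forall>i\<in>{1..n}. x i \<in> ?g ` mats N T \<inter> self_adjoint ?M"
      and y: "\<forall>j\<in>{1..k}. y j \<in> ?g ` mats N T \<inter> self_adjoint ?M"
      and "\<exists>b\<in>self_adjoint ?M. \<forall>i\<in>{1..n}. \<forall>j\<in>{1..k}. strictly_below ?M (x i) b \<and> strictly_below ?M b (y j)"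
    then obtain b where b: "b \<in> self_adjoint ?M"
      "\<And>i j. i \<in> {1..n} \<Longrightarrow> j \<in> {1..k} \<Longrightarrow> strictly_below ?M (x i) b \<and> strictly_below ?M b (y j)" by blast
    have "\<exists>U. \<forall>i\<in>{1..n}. U i \<in> mats N T \<inter> self_adjoint ?N \<and> ?g (U i) = x i"
      using pre x by (intro bchoice) blast
    then obtain U where U: "\<And>i. i \<in> {1..n} \<Longrightarrow> U i \<in> mats N T \<inter> self_adjoint ?N"
      "\<And>i. i \<in> {1..n} \<Longrightarrow> ?g (U i) = x i" by blast
    have "\<exists>Y. \<forall>j\<in>{1..k}. Y j \<in> mats N T \<inter> self_adjoint ?N \<and> ?g (Y j) = y j"
      using pre y by (intro bchoice) blast
    then obtain Y where Y: "\<And>j. j \<in> {1..k} \<Longrightarrow> Y j \<in> mats N T \<inter> self_adjoint ?N"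
      "\<And>j. j \<in> {1..k} \<Longrightarrow> ?g (Y j) = y j" by blast
    have "\<forall>\<^sub>F t in at_top. \<forall>i\<in>{1..n}. strictly_below ?N (U i \<ominus>\<^bsub>?N\<^esub> complex_of_real t \<odot>\<^bsub>?N\<^esub> p) (?f b)"
    proof (intro eventually_ball_finite ballI below)
      fix i assume i: "i \<in> {1..n}"
      show "U i \<in> self_adjoint ?N" using U(1)[OF i] by blast
      \<comment> \<open>The bounds on \<open>b\<close> come for pairs of indices; index 1 of the
        other family exists because \<open>k\<close> is positive.\<close>
      show "strictly_below ?M (?g (U i)) b" using b(2)[OF i, of 1] nk U(2)[OF i] by simp
    qed (use b(1) in simp_all)
    moreover have "\<forall>\<^sub>F t in at_top. \<forall>j\<in>{1..k}. strictly_below ?N (?f b) (Y j \<oplus>\<^bsub>?N\<^esub> complex_of_real t \<odot>\<^bsub>?N\<^esub> p)"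
    proof (intro eventually_ball_finite ballI above)
      fix j assume j: "j \<in> {1..k}"
      show "Y j \<in> self_adjoint ?N" using Y(1)[OF j] by blast
      show "strictly_below ?M b (?g (Y j))" using b(2)[OF _ j, of 1] nk Y(2)[OF j] by simp
    qed (use b(1) in simp_all)
    ultimately have "\<forall>\<^sub>F t in at_top. (\<forall>i\<in>{1..n}. strictly_below ?N (U i \<ominus>\<^bsub>?N\<^esub> complex_of_real t \<odot>\<^bsub>?N\<^esub> p) (?f b)) \<and>
        (\<forall>j\<in>{1..k}. strictly_below ?N (?f b) (Y j \<oplus>\<^bsub>?N\<^esub> complex_of_real t \<odot>\<^bsub>?N\<^esub> p))"
      by (rule eventually_conj)
    from eventually_happens'[OF trivial_limit_at_top_linorder this] obtain t where t: "\<And>i. i \<in> {1..n} \<Longrightarrow> strictly_below ?N (U i \<ominus>\<^bsub>?N\<^esub> complex_of_real t \<odot>\<^bsub>?N\<^esub> p) (?f b)"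
        "\<And>j. j \<in> {1..k} \<Longrightarrow> strictly_below ?N (?f b) (Y j \<oplus>\<^bsub>?N\<^esub> complex_of_real t \<odot>\<^bsub>?N\<^esub> p)"
      by blast
    define U' where "U' i = U i \<ominus>\<^bsub>?N\<^esub> complex_of_real t \<odot>\<^bsub>?N\<^esub> p" for i
    define Y' where "Y' j = Y j \<oplus>\<^bsub>?N\<^esub> complex_of_real t \<odot>\<^bsub>?N\<^esub> p" for j
    have U': "U' i \<in> mats N T \<inter> self_adjoint ?N" "?g (U' i) = x i" if i: "i \<in> {1..n}" for i
    proof -
      have c: "U i \<in> carrier ?N" "adj ?N (U i) = U i" using U(1)[OF i] by (auto simp: NC.self_adjoint_iff)
      then have "U' i \<in> carrier ?N" "adj ?N (U' i) = U' i" using pc by (auto simp: U'_def NC.adj_simps)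
      moreover have "U' i \<in> mats N T" unfolding U'_def using TD(4,7) pT U(1)[OF i] by blast
      ultimately show "U' i \<in> mats N T \<inter> self_adjoint ?N" by (simp add: NC.self_adjoint_iff)
      show "?g (U' i) = x i" using c pc U(2)[OF i] gc[OF c(1)]
        by (simp add: U'_def gminus gsmult gp MC.minus_eq)
    qed
    have Y': "Y' j \<in> mats N T \<inter> self_adjoint ?N" "?g (Y' j) = y j" if j: "j \<in> {1..k}" for j
    proof -
      have c: "Y j \<in> carrier ?N" "adj ?N (Y j) = Y j" using Y(1)[OF j] by (auto simp: NC.self_adjoint_iff)
      then have "Y' j \<in> carrier ?N" "adj ?N (Y' j) = Y' j" using pc by (auto simp: Y'_def NC.adj_simps)
      moreover have "Y' j \<in> mats N T" unfolding Y'_def using TD(3,4) pT Y(1)[OF j] by blast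
      ultimately show "Y' j \<in> mats N T \<inter> self_adjoint ?N" by (simp add: NC.self_adjoint_iff)
      show "?g (Y' j) = y j" using c pc Y(2)[OF j] gc[OF c(1)]
        by (simp add: Y'_def gadd gsmult gp)
    qed
    have "?f b \<in> self_adjoint ?N"
      using b fc fadj by (simp add: NC.self_adjoint_iff MC.self_adjoint_iff)
    then have "\<exists>b\<in>self_adjoint ?N. \<forall>i\<in>{1..n}. \<forall>j\<in>{1..k}. strictly_below ?N (U' i) b \<and> strictly_below ?N b (Y' j)"
      using t unfolding U'_def Y'_def by blast
    moreover have "\<forall>i\<in>{1..n}. U' i \<in> mats N T \<inter> self_adjoint ?N" "\<forall>j\<in>{1..k}. Y' j \<in> mats N T \<inter> self_adjoint ?N"
      using U'(1) Y'(1) by blast+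
    ultimately obtain a where a: "a \<in> mats N F \<inter> self_adjoint ?N"
      "\<And>i j. i \<in> {1..n} \<Longrightarrow> j \<in> {1..k} \<Longrightarrow> strictly_below ?N (U' i) a \<and> strictly_below ?N a (Y' j)"
      using spec[OF spec[OF int[unfolded interpolates_def], of U'], of Y'] by blast
    have ac: "a \<in> carrier ?N" "adj ?N a = a" using a(1) by (auto simp: NC.self_adjoint_iff)
    have "?g a \<in> mats m F \<inter> self_adjoint ?M"
      using F a ac gc gadj by (simp add: MC.self_adjoint_iff)
    moreover have "strictly_below ?M (x i) (?g a) \<and> strictly_below ?M (?g a) (y j)"
      if "i \<in> {1..n}" "j \<in> {1..k}" for i j
    proof -
      have "U' i \<in> carrier ?N" "Y' j \<in> carrier ?N" using U'(1) Y'(1) that TD(1) by blast+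
      then show ?thesis
        using descend[of "U' i" a] descend[of a "Y' j"] a(2)[OF that] ac U'(2)[OF that(1)] Y'(2)[OF that(2)]
        by simp
    qed
    ultimately show "\<exists>a\<in>mats m F \<inter> self_adjoint ?M. \<forall>i\<in>{1..n}. \<forall>j\<in>{1..k}.
        strictly_below ?M (x i) a \<and> strictly_below ?M a (y j)" by blast
  qed
qed

end

section \<open>Subalgebras and generation\<close>

lemma interpolates_mono:
  "interpolates n k B E F \<Longrightarrow> E' \<subseteq> E \<Longrightarrow> interpolates n k B E' F"
  unfolding interpolates_def by blast

context unital_cstar_algebra
begin

lemma closedin_iff:
  "closedin (Metric_space.mtopology (carrier A) (cdist A)) K \<longleftrightarrow> K \<subseteq> carrier A \<and>
    (\<forall>a\<in>carrier A. (\<forall>e>0. \<exists>x\<in>K. cnorm A (a \<ominus> x) < e) \<longrightarrow> a \<in> K)"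
proof -
  interpret MS: Metric_space "carrier A" "cdist A" by (rule Metric)
  have "(\<exists>r>0. disjnt K (MS.mball a r)) \<longleftrightarrow> \<not> (\<forall>e>0. \<exists>x\<in>K. cnorm A (a \<ominus> x) < e)"
    if "a \<in> carrier A" "K \<subseteq> carrier A" for a
    using that by (fastforce simp: disjnt_iff cdist_def)
  then show ?thesis unfolding MS.closedin_metric by blast
qed

lemma cstar_subalgebra_iff:
  "cstar_subalgebra A K \<longleftrightarrow> K \<subseteq> carrier A \<and> \<zero> \<in> K \<and> (\<forall>x\<in>K. \<forall>y\<in>K. x \<oplus> y \<in> K) \<and>
    (\<forall>c. \<forall>x\<in>K. c \<odot> x \<in> K) \<and> (\<forall>x\<in>K. \<forall>y\<in>K. x \<otimes> y \<in> K) \<and> (\<forall>x\<in>K. adj A x \<in> K) \<and>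
    (\<forall>a\<in>carrier A. (\<forall>e>0. \<exists>x\<in>K. cnorm A (a \<ominus> x) < e) \<longrightarrow> a \<in> K)"
  unfolding cstar_subalgebra_def submodule_iff closedin_iff
  by (intro iffI; elim conjE; intro conjI; assumption)

lemma cstar_subalgebraD:
  assumes "cstar_subalgebra A K"
  shows "K \<subseteq> carrier A" "x \<in> K \<Longrightarrow> x \<in> carrier A" "\<zero> \<in> K" "x \<in> K \<Longrightarrow> y \<in> K \<Longrightarrow> x \<oplus> y \<in> K"
    "x \<in> K \<Longrightarrow> c \<odot> x \<in> K" "x \<in> K \<Longrightarrow> y \<in> K \<Longrightarrow> x \<otimes> y \<in> K" "x \<in> K \<Longrightarrow> adj A x \<in> K"
    "a \<in> carrier A \<Longrightarrow> (\<And>e. e > 0 \<Longrightarrow> \<exists>x\<in>K. cnorm A (a \<ominus> x) < e) \<Longrightarrow> a \<in> K"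
  using assms unfolding cstar_subalgebra_iff by blast+

lemma finsum_mem:
  assumes "K \<subseteq> carrier A" "\<zero> \<in> K" "\<And>x y. x \<in> K \<Longrightarrow> y \<in> K \<Longrightarrow> x \<oplus> y \<in> K"
    "finite I" "\<And>i. i \<in> I \<Longrightarrow> f i \<in> K"
  shows "(\<Oplus>i\<in>I. f i) \<in> K"
  using assms(4,5)
proof (induction I rule: finite_induct)
  case (insert i I)
  have "(\<Oplus>i\<in>insert i I. f i) = f i \<oplus> (\<Oplus>i\<in>I. f i)"
    using insert assms(1) by (intro finsum_insert) auto
  then show ?case using insert assms(3) by auto
qed (simp add: assms(2))

lemma cstar_subalgebra_carrier: "cstar_subalgebra A (carrier A)"
  unfolding cstar_subalgebra_iff by auto

lemma cstar_generated_superset: "E \<subseteq> cstar_generated A E"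
  unfolding cstar_generated_def by blast

lemma cstar_generated_least: "cstar_subalgebra A K \<Longrightarrow> E \<subseteq> K \<Longrightarrow> cstar_generated A E \<subseteq> K"
  unfolding cstar_generated_def by blast

lemma cstar_subalgebra_generated:
  assumes E: "E \<subseteq> carrier A"
  shows "cstar_subalgebra A (cstar_generated A E)"
proof -
  let ?G = "cstar_generated A E"
  have mem: "x \<in> ?G \<longleftrightarrow> (\<forall>K. cstar_subalgebra A K \<longrightarrow> E \<subseteq> K \<longrightarrow> x \<in> K)" for x
    unfolding cstar_generated_def by blast
  show ?thesis unfolding cstar_subalgebra_iff
  proof (intro conjI)
    show "?G \<subseteq> carrier A" using cstar_generated_least[OF cstar_subalgebra_carrier E] .
    show "\<forall>a\<in>carrier A. (\<forall>e>0. \<exists>x\<in>?G. cnorm A (a \<ominus> x) < e) \<longrightarrow> a \<in> ?G"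
    proof (intro ballI impI)
      fix a assume a: "a \<in> carrier A" "\<forall>e>0. \<exists>x\<in>?G. cnorm A (a \<ominus> x) < e"
      show "a \<in> ?G"
        unfolding mem
      proof (intro allI impI)
        fix K assume K: "cstar_subalgebra A K" "E \<subseteq> K"
        then show "a \<in> K"
          using a cstar_generated_least[OF K] by (intro cstar_subalgebraD(8)[OF K(1)]) blast+
      qed
    qed
  qed ((intro ballI allI)?; unfold mem; blast intro: cstar_subalgebraD(3-7))+
qed

text \<open>Closedness passes to matrices because an approximation in the matrix norm approximates
  every entry, by \<open>cnorm_entry_le\<close>.\<close>

lemma mats_cstar_subalgebra:
  assumes K: "cstar_subalgebra A K"
  shows "cstar_subalgebra (Mat m) (mats m K)"
proof -
  interpret MC: unital_cstar_algebra "Mat m" by (rule matrix_cstar)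
  note D = cstar_subalgebraD[OF K]
  have sub: "rmats m m K \<subseteq> Rect m m" by (rule rmats_mono[OF D(1)])
  show ?thesis
    unfolding MC.cstar_subalgebra_iff mats_eq_rmats matrix_algebra_sel
  proof (intro conjI)
    show "\<forall>x\<in>rmats m m K. \<forall>y\<in>rmats m m K. x \<otimes>\<^bsub>Mat m\<^esub> y \<in> rmats m m K"
    proof (intro ballI)
      fix x y assume xy: "x \<in> rmats m m K" "y \<in> rmats m m K"
      have "(\<Oplus>l\<in>{..<m}. x (i, l) \<otimes> y (l, j)) \<in> K" if "i < m" "j < m" for i j
        by (rule finsum_mem[OF D(1,3,4)]) (use that xy D(6) in \<open>auto simp: rmatsD\<close>)
      then show "x \<otimes>\<^bsub>Mat m\<^esub> y \<in> rmats m m K"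
        by (auto simp: matrix_algebra_def rmats_def)
    qed
    show "\<forall>a\<in>Rect m m.
        (\<forall>e>0. \<exists>x\<in>rmats m m K. matrix_norm m A (a \<ominus>\<^bsub>Mat m\<^esub> x) < e) \<longrightarrow> a \<in> rmats m m K"
    proof (intro ballI impI)
      fix a assume a: "a \<in> Rect m m"
        and ap: "\<forall>e>0. \<exists>x\<in>rmats m m K. matrix_norm m A (a \<ominus>\<^bsub>Mat m\<^esub> x) < e"
      have "a (i, j) \<in> K" if ij: "i < m" "j < m" for i j
      proof (rule D(8))
        show "a (i, j) \<in> carrier A" using rmatsD[OF a ij] .
        fix e :: real assume "e > 0"
        then obtain x where x: "x \<in> rmats m m K" "matrix_norm m A (a \<ominus>\<^bsub>Mat m\<^esub> x) < e"
          using ap by blast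
        have xc: "x \<in> Rect m m" using sub x by blast
        have "cnorm A (a (i, j) \<ominus> x (i, j)) < e"
          using cnorm_entry_le[OF matrix_minus_closed[OF a xc] ij] x(2) a xc ij by (simp add: matrix_minus_entry)
        then show "\<exists>x\<in>K. cnorm A (a (i, j) \<ominus> x) < e" using rmatsD[OF x(1) ij] by blast
      qed
      then show "a \<in> rmats m m K" using a by (auto simp: rmats_def PiE_iff)
    qed
  qed (use sub D(2-7) in \<open>auto simp: matrix_algebra_def rmats_def PiE_iff\<close>)
qed

lemma matrix_finsum_entry:
  assumes "finite I" "\<And>k. k \<in> I \<Longrightarrow> f k \<in> Rect m m" "i < m" "j < m"
  shows "finsum (Mat m) f I (i, j) = (\<Oplus>k\<in>I. f k (i, j))"
  using assms(1,2)
proof (induction I rule: finite_induct)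
  case empty
  interpret MC: abelian_group "Mat m" by (rule matrix_abelian_group)
  show ?case using assms(3,4) by (simp add: matrix_entries)
next
  case (insert k I)
  interpret MC: abelian_group "Mat m" by (rule matrix_abelian_group)
  have "finsum (Mat m) f (insert k I) = f k \<oplus>\<^bsub>Mat m\<^esub> finsum (Mat m) f I"
    using insert by (intro MC.finsum_insert) (auto simp: matrix_algebra_sel)
  moreover have "(\<Oplus>k\<in>insert k I. f k (i, j)) = f k (i, j) \<oplus> (\<Oplus>k\<in>I. f k (i, j))"
  proof -
    have "f l (i, j) \<in> carrier A" if "l \<in> insert k I" for l
      using rmatsD[OF insert.prems[OF that] assms(3,4)] .
    then show ?thesis using insert.hyps by (intro finsum_insert) auto
  qed
  ultimately show ?case using insert assms(3,4) by (simp add: matrix_entries)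
qed

text \<open>The harder inclusion rests on the elements \<open>a\<close> for which every matrix
  \<open>E i j a\<close> with single entry \<open>a\<close> lies in the generated algebra. They form
  a C*-subalgebra containing \<open>S\<close>, hence contain \<open>?G\<close>, and every matrix is
  the sum of its single-entry matrices.\<close>

lemma cstar_generated_mats:
  assumes S: "operator_subsystem A S"
  shows "cstar_generated (Mat m) (mats m S) = mats m (cstar_generated A S)"
proof
  interpret MC: unital_cstar_algebra "Mat m" by (rule matrix_cstar)
  note SD = operator_subsystemD[OF S]
  let ?G = "cstar_generated A S"
  have G: "cstar_subalgebra A ?G" by (rule cstar_subalgebra_generated[OF SD(8)])
  note GD = cstar_subalgebraD[OF G]
  have "mats m S \<subseteq> mats m ?G" unfolding mats_eq_rmats by (rule rmats_mono[OF cstar_generated_superset])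
  then show "cstar_generated (Mat m) (mats m S) \<subseteq> mats m ?G"
    by (rule MC.cstar_generated_least[OF mats_cstar_subalgebra[OF G]])
  let ?H = "cstar_generated (Mat m) (mats m S)"
  have "mats m S \<subseteq> carrier (Mat m)"
    unfolding mats_eq_rmats matrix_algebra_sel by (rule rmats_mono[OF SD(8)])
  then have H: "cstar_subalgebra (Mat m) ?H" by (rule MC.cstar_subalgebra_generated)
  note HD = MC.cstar_subalgebraD[OF H]
  define E where "E i j a = (\<lambda>(k, l)\<in>{..<m} \<times> {..<m}. if k = i \<and> l = j then a else \<zero>)" for i j a
  have Eent: "E i j a (k, l) = (if k = i \<and> l = j then a else \<zero>)" if "k < m" "l < m" for i j a k l
    using that by (simp add: E_def)
  have Ec: "E i j a \<in> Rect m m" if "a \<in> carrier A" for i j a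
    using that by (auto simp: E_def rmats_def PiE_iff)
  let ?K = "{a \<in> carrier A. \<forall>i<m. \<forall>j<m. E i j a \<in> ?H}"
  have K: "cstar_subalgebra A ?K" unfolding cstar_subalgebra_iff
  proof (intro conjI ballI impI allI)
    have "E i j \<zero> = \<zero>\<^bsub>Mat m\<^esub>" for i j
      by (rule mat_eqI[of _ m]) (auto simp: Ec Eent matrix_entries matrix_closed)
    then show "\<zero> \<in> ?K" using HD(3) by auto
  next
    fix x y assume xy: "x \<in> ?K" "y \<in> ?K"
    have "E i j (x \<oplus> y) = E i j x \<oplus>\<^bsub>Mat m\<^esub> E i j y" for i j
      using xy by (intro mat_eqI[of _ m]) (auto simp: Ec Eent matrix_entries matrix_closed)
    then show "x \<oplus> y \<in> ?K" using xy HD(4) by auto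
    \<comment> \<open>This is the product rule for matrix units, with \<open>i\<close> chosen as the
      middle index.\<close>
    have "E i j (x \<otimes> y) = E i i x \<otimes>\<^bsub>Mat m\<^esub> E i j y" if ij: "i < m" "j < m" for i j
    proof (rule mat_eqI[of _ m])
      fix k l assume kl: "k < m" "l < m"
      have "(E i i x \<otimes>\<^bsub>Mat m\<^esub> E i j y) (k, l)
          = (\<Oplus>h\<in>{..<m}. if h = i then (if k = i \<and> l = j then x \<otimes> y else \<zero>) else \<zero>)"
        unfolding matrix_entries(2)[OF kl] using xy kl by (intro finsum_cong') (auto simp: Eent)
      also have "\<dots> = (if k = i \<and> l = j then x \<otimes> y else \<zero>)"
        using xy ij by (intro finsum_delta) auto
      finally show "E i j (x \<otimes> y) (k, l) = (E i i x \<otimes>\<^bsub>Mat m\<^esub> E i j y) (k, l)"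
        using kl by (simp add: Eent)
    qed (use xy in \<open>auto simp: Ec matrix_mult\<close>)
    then show "x \<otimes> y \<in> ?K" using xy HD(6) by auto
  next
    fix x c assume x: "x \<in> ?K"
    have "E i j (c \<odot> x) = c \<odot>\<^bsub>Mat m\<^esub> E i j x" for i j
      using x by (intro mat_eqI[of _ m]) (auto simp: Ec Eent matrix_entries matrix_closed)
    then show "c \<odot> x \<in> ?K" using x HD(5) by auto
    have "E i j (adj A x) = adj (Mat m) (E j i x)" for i j
      using x by (intro mat_eqI[of _ m]) (auto simp: Ec Eent matrix_adj)
    then show "adj A x \<in> ?K" using x HD(7) by auto
  next
    fix a assume a: "a \<in> carrier A" and ap: "\<forall>e>0. \<exists>x\<in>?K. cnorm A (a \<ominus> x) < e"
    have "E i j a \<in> ?H" if ij: "i < m" "j < m" for i j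
    proof (rule HD(8))
      show "E i j a \<in> carrier (Mat m)" using Ec[OF a] by (simp add: matrix_algebra_sel)
      fix e :: real assume "e > 0"
      then obtain x where x: "x \<in> ?K" "cnorm A (a \<ominus> x) < e" using ap by blast
      have xc: "x \<in> carrier A" using x by blast
      let ?d = "E i j a \<ominus>\<^bsub>Mat m\<^esub> E i j x"
      have "matrix_norm m A ?d \<le> (\<Sum>k<m. \<Sum>l<m. cnorm A (?d (k, l)))"
        by (intro matrix_norm_le_sum matrix_minus_closed Ec a xc)
      also have "\<dots> = (\<Sum>k<m. \<Sum>l<m. if l = j then (if k = i then cnorm A (a \<ominus> x) else 0) else 0)"
        using a xc by (intro sum.cong refl) (auto simp: matrix_minus_entry Ec Eent diff_eq_zero[THEN iffD2])
      also have "\<dots> = cnorm A (a \<ominus> x)" using ij by simp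
      finally show "\<exists>y\<in>?H. cnorm (Mat m) (E i j a \<ominus>\<^bsub>Mat m\<^esub> y) < e"
        using x ij by (intro bexI[of _ "E i j x"]) (auto simp: matrix_algebra_sel)
    qed
    then show "a \<in> ?K" using a by auto
  qed auto
  have "S \<subseteq> ?K"
  proof
    fix s assume s: "s \<in> S"
    \<comment> \<open>The remaining entries are 0, which an operator system contains.\<close>
    have "E i j s \<in> mats m S" for i j using s SD(6) by (auto simp: E_def mats_def PiE_iff)
    then show "s \<in> ?K" using MC.cstar_generated_superset[of "mats m S"] SD(1)[OF s] by auto
  qed
  then have GK: "?G \<subseteq> ?K" by (rule cstar_generated_least[OF K])
  show "mats m ?G \<subseteq> ?H"
  proof
    fix z assume "z \<in> mats m ?G"
    then have z: "z \<in> rmats m m ?G" by (simp add: mats_eq_rmats)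
    have zc: "z \<in> Rect m m" using z rmats_mono[OF GD(1)] by blast
    let ?I = "{..<m} \<times> {..<m}"
    let ?f = "\<lambda>kl. E (fst kl) (snd kl) (z kl)"
    have zk: "z (k, l) \<in> ?K" if "k < m" "l < m" for k l using rmatsD[OF z that] GK by blast
    have fm: "finsum (Mat m) ?f ?I \<in> ?H"
      by (rule MC.finsum_mem[OF HD(1,3,4)]) (use zk in auto)
    have "finsum (Mat m) ?f ?I = z"
    proof (rule mat_eqI[of _ m])
      fix i j assume ij: "i < m" "j < m"
      have "finsum (Mat m) ?f ?I (i, j) = (\<Oplus>kl\<in>?I. ?f kl (i, j))"
        using zc ij by (intro matrix_finsum_entry) (auto simp: Ec rmatsD)
      also have "\<dots> = (\<Oplus>kl\<in>?I. if kl = (i, j) then z kl else \<zero>)"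
        using zc ij by (intro finsum_cong') (auto simp: Eent rmatsD)
      also have "\<dots> = z (i, j)" using zc ij by (intro finsum_delta) (auto simp: rmatsD)
      finally show "finsum (Mat m) ?f ?I (i, j) = z (i, j)" .
    qed (use fm HD(2) zc in \<open>auto simp: matrix_algebra_sel\<close>)
    then show "z \<in> ?H" using fm by simp
  qed
qed

section \<open>Closed subalgebras as C*-algebras, and closures of *-algebras\<close>

lemma subalgebra_minus:
  assumes K: "cstar_subalgebra A K" and x: "x \<in> K" "y \<in> K"
  shows "x \<ominus>\<^bsub>A\<lparr>carrier := K\<rparr>\<^esub> y = x \<ominus> y"
proof -
  note D = cstar_subalgebraD[OF K]
  have inv: "\<ominus> y \<in> K" using D(5)[OF x(2), of "-1"] D(2)[OF x(2)] by (simp add: smult_minus_one)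
  \<comment> \<open>Subtraction refers to inverses within the carrier, so it changes as a term when
    the carrier does; the inverse is recomputed in the restricted additive monoid.\<close>
  have "m_inv (add_monoid (A\<lparr>carrier := K\<rparr>)) y = \<ominus> y"
    unfolding m_inv_def
  proof (rule the_equality)
    show "\<ominus> y \<in> carrier (add_monoid (A\<lparr>carrier := K\<rparr>)) \<and>
        y \<otimes>\<^bsub>add_monoid (A\<lparr>carrier := K\<rparr>)\<^esub> \<ominus> y = \<one>\<^bsub>add_monoid (A\<lparr>carrier := K\<rparr>)\<^esub> \<and>
        \<ominus> y \<otimes>\<^bsub>add_monoid (A\<lparr>carrier := K\<rparr>)\<^esub> y = \<one>\<^bsub>add_monoid (A\<lparr>carrier := K\<rparr>)\<^esub>"
      using inv D(2)[OF x(2)] by (simp add: r_neg l_neg)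
    fix z assume "z \<in> carrier (add_monoid (A\<lparr>carrier := K\<rparr>)) \<and>
        y \<otimes>\<^bsub>add_monoid (A\<lparr>carrier := K\<rparr>)\<^esub> z = \<one>\<^bsub>add_monoid (A\<lparr>carrier := K\<rparr>)\<^esub> \<and>
        z \<otimes>\<^bsub>add_monoid (A\<lparr>carrier := K\<rparr>)\<^esub> y = \<one>\<^bsub>add_monoid (A\<lparr>carrier := K\<rparr>)\<^esub>"
    then have "z \<in> K" "z \<oplus> y = \<zero>" by auto
    then show "z = \<ominus> y" using minus_equality[of z y] D(2) x(2) by simp
  qed
  then show ?thesis by (simp add: a_minus_def a_inv_def)
qed

text \<open>The unitarity hypothesis is stated in the record with carrier
  \<open>cstar_generated A S\<close>; this makes the facts of the locale available there.
  Completeness is inherited because \<open>K\<close> is closed.\<close>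

lemma subalgebra_cstar:
  assumes K: "cstar_subalgebra A K" and one: "\<one> \<in> K"
  shows "unital_cstar_algebra (A\<lparr>carrier := K\<rparr>)"
proof -
  note D = cstar_subalgebraD[OF K]
  let ?B = "A\<lparr>carrier := K\<rparr>"
  have ab: "abelian_group ?B"
  proof (rule abelian_groupI)
    fix x assume x: "x \<in> carrier ?B"
    then show "\<exists>y\<in>carrier ?B. y \<oplus>\<^bsub>?B\<^esub> x = \<zero>\<^bsub>?B\<^esub>"
      using D(2)[of x] D(5)[of x "-1"] by (intro bexI[of _ "(-1) \<odot> x"]) (auto simp: smult_minus_one l_neg)
  qed (use D(2-7) in \<open>auto simp: a_ac\<close>)
  have mo: "Group.monoid ?B" by (rule monoidI) (use D(2-7) one in \<open>auto simp: m_assoc\<close>)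
  have ri: "ring ?B" by (rule ringI[OF ab mo]) (use D(2-7) in \<open>auto simp: l_distr r_distr\<close>)
  have md: "module complex_ring ?B"
    by (rule moduleI[OF cring_from_type_algebra ab])
      (use D(2-7) in \<open>auto simp: smult_add_left smult_add_right\<close>)
  have minus: "x \<ominus>\<^bsub>?B\<^esub> y = x \<ominus> y" if "x \<in> K" "y \<in> K" for x y using subalgebra_minus[OF K that] .
  have dist: "cdist ?B x y = (if x \<in> K \<and> y \<in> K then cnorm A (x \<ominus> y) else 0)" for x y
    by (auto simp: cdist_def minus)
  have MS: "Metric_space K (cdist ?B)"
    by unfold_locales
      (use D(2) in \<open>auto simp: dist cnorm_diff_commute cnorm_eq_zero diff_eq_zero cnorm_diff_triangle\<close>)
  interpret MS: Metric_space K "cdist ?B" by (rule MS)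
  have comp: "MS.mcomplete"
    unfolding MS.mcomplete_def
  proof (intro allI impI)
    fix s assume s: "MS.MCauchy s"
    then have sK: "s n \<in> K" for n unfolding MS.MCauchy_def by auto
    have "\<exists>l. cconv s l"
    proof (rule cconv_Cauchy)
      show "s n \<in> carrier A" for n using sK D(2) by blast
      fix e :: real assume "e > 0"
      then show "\<exists>N. \<forall>m\<ge>N. \<forall>n\<ge>N. cnorm A (s m \<ominus> s n) < e"
        using s sK unfolding MS.MCauchy_def by (simp add: dist)
    qed
    then obtain l where l: "l \<in> carrier A" "(\<lambda>n. cnorm A (s n \<ominus> l)) \<longlonglongrightarrow> 0"
      by (auto simp: cconv_def)
    have lK: "l \<in> K"
    proof (rule D(8)[OF l(1)])
      fix e :: real assume "e > 0"
      then obtain n where "cnorm A (s n \<ominus> l) < e"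
        using order_tendstoD(2)[OF l(2)] by (auto simp: eventually_sequentially)
      then show "\<exists>x\<in>K. cnorm A (l \<ominus> x) < e"
        using sK D(2) l(1) by (intro bexI[of _ "s n"]) (auto simp: cnorm_diff_commute)
    qed
    have "limitin MS.mtopology s l sequentially"
      unfolding MS.limitin_metric_dist_null using sK lK l by (auto simp: dist)
    then show "\<exists>l. limitin MS.mtopology s l sequentially" by blast
  qed
  show ?thesis
    unfolding unital_cstar_algebra_def unital_cstar_algebra_axioms_def
  proof (intro conjI allI impI)
    show "Metric_space.mcomplete (carrier ?B) (cdist ?B)" using comp by simp
  qed (use md ri D(2-7) in \<open>auto simp: smult_mult_left smult_mult_right adj_simps cnorm_eq_zero cnorm_triangle
      cnorm_smult cnorm_mult\<close>)
qed

lemma approximable_iff_cconv: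
  assumes L: "L \<subseteq> carrier A" and a: "a \<in> carrier A"
  shows "(\<forall>e>0. \<exists>x\<in>L. cnorm A (a \<ominus> x) < e) \<longleftrightarrow> (\<exists>y. (\<forall>n. y n \<in> L) \<and> cconv y a)"
proof
  assume ap: "\<forall>e>0. \<exists>x\<in>L. cnorm A (a \<ominus> x) < e"
  have "\<exists>x\<in>L. cnorm A (a \<ominus> x) < inverse (real (Suc n))" for n
    using ap[rule_format, of "inverse (real (Suc n))"] by simp
  then obtain y where y: "\<And>n. y n \<in> L" "\<And>n. cnorm A (a \<ominus> y n) < inverse (real (Suc n))" by metis
  have "cconv y a"
  proof (rule cconvI[OF _ a])
    show yc: "y n \<in> carrier A" for n using y(1) L by blast
    show "cnorm A (y n \<ominus> a) \<le> inverse (real (Suc n))" for n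
      using y(2)[of n] yc[of n] a by (simp add: cnorm_diff_commute[of "y n"])
    show "(\<lambda>n. inverse (real (Suc n))) \<longlonglongrightarrow> 0" by (rule LIMSEQ_inverse_real_of_nat)
  qed
  then show "\<exists>y. (\<forall>n. y n \<in> L) \<and> cconv y a" using y(1) by blast
next
  assume "\<exists>y. (\<forall>n. y n \<in> L) \<and> cconv y a"
  then obtain y where y: "\<And>n. y n \<in> L" "cconv y a" by blast
  show "\<forall>e>0. \<exists>x\<in>L. cnorm A (a \<ominus> x) < e"
  proof (intro allI impI)
    fix e :: real assume "e > 0"
    then have "\<forall>\<^sub>F n in sequentially. cnorm A (y n \<ominus> a) < e"
      using y(2) unfolding cconv_def by (intro order_tendstoD(2)) auto
    then obtain n where "cnorm A (y n \<ominus> a) < e"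
      using eventually_happens'[OF sequentially_bot] by blast
    then show "\<exists>x\<in>L. cnorm A (a \<ominus> x) < e"
      using y(1) L a by (intro bexI[of _ "y n"]) (auto simp: cnorm_diff_commute[OF a] subset_iff)
  qed
qed

text \<open>The algebraic operations pass to limits of sequences from \<open>L\<close>, and
  closedness is the usual halving of the error.\<close>

lemma closure_cstar_subalgebra:
  assumes L: "L \<subseteq> carrier A" "\<zero> \<in> L" "\<And>x y. x \<in> L \<Longrightarrow> y \<in> L \<Longrightarrow> x \<oplus> y \<in> L"
    "\<And>c x. x \<in> L \<Longrightarrow> c \<odot> x \<in> L" "\<And>x y. x \<in> L \<Longrightarrow> y \<in> L \<Longrightarrow> x \<otimes> y \<in> L" "\<And>x. x \<in> L \<Longrightarrow> adj A x \<in> L"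
  shows "cstar_subalgebra A {a \<in> carrier A. \<forall>e>0. \<exists>x\<in>L. cnorm A (a \<ominus> x) < e}"
proof -
  let ?K = "{a \<in> carrier A. \<forall>e>0. \<exists>x\<in>L. cnorm A (a \<ominus> x) < e}"
  have mem: "a \<in> ?K \<longleftrightarrow> (\<exists>y. (\<forall>n. y n \<in> L) \<and> cconv y a)" for a
    using approximable_iff_cconv[OF L(1), of a] by (auto simp: cconv_def)
  show ?thesis unfolding cstar_subalgebra_iff
  proof (intro conjI ballI allI impI)
    show "\<zero> \<in> ?K" unfolding mem using L(2) cconv_const[of \<zero>] by (intro exI[of _ "\<lambda>_. \<zero>"]) auto
  next
    fix a b assume "a \<in> ?K" "b \<in> ?K"
    then obtain y z where yz: "\<And>n. y n \<in> L" "cconv y a" "\<And>n. z n \<in> L" "cconv z b" unfolding mem by blast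
    show "a \<oplus> b \<in> ?K" unfolding mem
      using L(3) yz(1,3) cconv_add[OF yz(2,4)] by (intro exI[of _ "\<lambda>n. y n \<oplus> z n"]) auto
    show "a \<otimes> b \<in> ?K" unfolding mem
      using L(5) yz(1,3) cconv_mult[OF yz(2,4)] by (intro exI[of _ "\<lambda>n. y n \<otimes> z n"]) auto
  next
    fix a c assume "a \<in> ?K"
    then obtain y where y: "\<And>n. y n \<in> L" "cconv y a" unfolding mem by blast
    show "c \<odot> a \<in> ?K" unfolding mem
      using L(4) y(1) cconv_smult[OF y(2)] by (intro exI[of _ "\<lambda>n. c \<odot> y n"]) auto
    show "adj A a \<in> ?K" unfolding mem
      using L(6) y(1) cconv_adj[OF y(2)] by (intro exI[of _ "\<lambda>n. adj A (y n)"]) auto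
  next
    fix a assume a: "a \<in> carrier A" and ap: "\<forall>e>0. \<exists>x\<in>?K. cnorm A (a \<ominus> x) < e"
    have "\<exists>x\<in>L. cnorm A (a \<ominus> x) < e" if e: "e > 0" for e
    proof -
      obtain b where b: "b \<in> carrier A" "cnorm A (a \<ominus> b) < e / 2" "\<forall>e>0. \<exists>x\<in>L. cnorm A (b \<ominus> x) < e"
        using ap e half_gt_zero by blast
      then obtain x where x: "x \<in> L" "cnorm A (b \<ominus> x) < e / 2" using e half_gt_zero by blast
      then have "cnorm A (a \<ominus> x) < e"
        using cnorm_diff_triangle[OF a b(1), of x] b(2) L(1) by (simp add: subset_iff)
      then show ?thesis using x by blast
    qed
    then show "a \<in> ?K" using a by blast
  qed auto
qed

end

section \<open>Adjoining words in unitaries\<close>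

context unital_cstar_algebra
begin

text \<open>For the block matrix with rows \<open>a, c\<close> and \<open>b, d\<close>, the four
  summands are the terms of the row \<open>(1, u)\<close> times this matrix times the column
  \<open>(1, adj u)\<close>.\<close>

definition dilate :: "'a \<Rightarrow> 'a set \<Rightarrow> 'a set"
  where "dilate u T = {a \<oplus> u \<otimes> b \<oplus> c \<otimes> adj A u \<oplus> u \<otimes> d \<otimes> adj A u | a b c d.
    a \<in> T \<and> b \<in> T \<and> c \<in> T \<and> d \<in> T}"

lemma dilateI:
  "a \<in> T \<Longrightarrow> b \<in> T \<Longrightarrow> c \<in> T \<Longrightarrow> d \<in> T \<Longrightarrow>
    a \<oplus> u \<otimes> b \<oplus> c \<otimes> adj A u \<oplus> u \<otimes> d \<otimes> adj A u \<in> dilate u T"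
  unfolding dilate_def by blast

lemma dilate_mono: "T \<subseteq> T' \<Longrightarrow> dilate u T \<subseteq> dilate u T'"
  unfolding dilate_def by blast

lemma dilate_superset:
  assumes T: "operator_subsystem A T" and u: "u \<in> carrier A"
  shows "T \<subseteq> dilate u T" "b \<in> T \<Longrightarrow> u \<otimes> b \<in> dilate u T"
proof -
  note D = operator_subsystemD[OF T]
  show "T \<subseteq> dilate u T"
  proof
    fix a assume "a \<in> T"
    then show "a \<in> dilate u T" using dilateI[of a T \<zero> \<zero> \<zero> u] D(1,6) u by simp
  qed
  show "u \<otimes> b \<in> dilate u T" if "b \<in> T"
    using dilateI[of \<zero> T b \<zero> \<zero> u] D(1,6) u that by simp
qed

lemma dilate_operator_subsystem:
  assumes T: "operator_subsystem A T" and u: "u \<in> carrier A"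
  shows "operator_subsystem A (dilate u T)"
  unfolding operator_subsystem_iff
proof (intro conjI ballI allI)
  note D = operator_subsystemD[OF T]
  show "dilate u T \<subseteq> carrier A" using D(1) u unfolding dilate_def by auto
  show "\<one> \<in> dilate u T" using dilate_superset(1)[OF T u] D(2) by blast
  fix x assume "x \<in> dilate u T"
  then obtain a b c d where t: "a \<in> T" "b \<in> T" "c \<in> T" "d \<in> T"
    and x: "x = a \<oplus> u \<otimes> b \<oplus> c \<otimes> adj A u \<oplus> u \<otimes> d \<otimes> adj A u" unfolding dilate_def by blast
  have tc: "a \<in> carrier A" "b \<in> carrier A" "c \<in> carrier A" "d \<in> carrier A" using t D(1) by auto
  define w where "w = adj A u"
  have w: "w \<in> carrier A" "adj A w = u" using u by (auto simp: w_def)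
  note x' = x[folded w_def]
  show "e \<odot> x \<in> dilate u T" for e
  proof -
    have "e \<odot> x = e \<odot> a \<oplus> u \<otimes> (e \<odot> b) \<oplus> (e \<odot> c) \<otimes> w \<oplus> u \<otimes> (e \<odot> d) \<otimes> w"
      unfolding x' using tc u w by (simp add: smult_add_right smult_mult_left smult_mult_right)
    then show ?thesis using dilateI[of "e \<odot> a" T "e \<odot> b" "e \<odot> c" "e \<odot> d" u] t D(4) by (simp add: w_def)
  qed
  show "adj A x \<in> dilate u T"
  proof -
    have "adj A x = adj A a \<oplus> u \<otimes> adj A c \<oplus> adj A b \<otimes> w \<oplus> u \<otimes> adj A d \<otimes> w"
      unfolding x' using tc u w by (simp add: adj_simps w_def[symmetric] m_assoc a_ac)
    then show ?thesis using dilateI[of "adj A a" T "adj A c" "adj A b" "adj A d" u] t D(5) by (simp add: w_def)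
  qed
  fix y assume "y \<in> dilate u T"
  then obtain a' b' c' d' where s: "a' \<in> T" "b' \<in> T" "c' \<in> T" "d' \<in> T"
    and y: "y = a' \<oplus> u \<otimes> b' \<oplus> c' \<otimes> w \<oplus> u \<otimes> d' \<otimes> w" unfolding dilate_def w_def by blast
  have sc: "a' \<in> carrier A" "b' \<in> carrier A" "c' \<in> carrier A" "d' \<in> carrier A" using s D(1) by auto
  have "x \<oplus> y = (a \<oplus> a') \<oplus> u \<otimes> (b \<oplus> b') \<oplus> (c \<oplus> c') \<otimes> w \<oplus> u \<otimes> (d \<oplus> d') \<otimes> w"
    unfolding x' y using tc sc u w(1) by (simp add: l_distr r_distr a_ac)
  then show "x \<oplus> y \<in> dilate u T"
    using dilateI[of "a \<oplus> a'" T "b \<oplus> b'" "c \<oplus> c'" "d \<oplus> d'" u] t s D(3) by (simp add: w_def)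
qed

lemma rmul_mem:
  assumes K: "cstar_subalgebra A K" and x: "x \<in> rmats p q K" "y \<in> rmats q r K"
  shows "rmul p q r x y \<in> rmats p r K"
proof -
  note D = cstar_subalgebraD[OF K]
  have "(\<Oplus>l\<in>{..<q}. x (i, l) \<otimes> y (l, j)) \<in> K" if "i < p" "j < r" for i j
    by (rule finsum_mem[OF D(1,3,4)]) (use that x D(6) in \<open>auto simp: rmatsD\<close>)
  then show ?thesis by (auto simp: rmul_def rmats_def)
qed

lemma radj_mem: "cstar_subalgebra A K \<Longrightarrow> x \<in> rmats p q K \<Longrightarrow> radj p q x \<in> rmats q p K"
  using cstar_subalgebraD(7)[of K] by (auto simp: radj_def rmats_def PiE_iff)

lemma interpolates_dilate:
  assumes nk: "n \<ge> 1" "k \<ge> 1" and K: "cstar_subalgebra A K"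
    and T: "operator_subsystem A T" "T \<subseteq> K" and u: "u \<in> T" "u \<in> unitaries A"
    and int: "interpolates n k (Mat (2 * m)) (mats (2 * m) T) (mats (2 * m) K)"
  shows "interpolates n k (Mat m) (mats m (dilate u T)) (mats m K)"
proof -
  note D = operator_subsystemD[OF T(1)]
  define w where "w = adj A u"
  have uw: "u \<in> carrier A" "w \<in> carrier A" "w \<in> T" "adj A w = u" "adj A u = w" "u \<otimes> w = \<one>" "w \<otimes> u = \<one>"
    using u D(5) by (auto simp: w_def unitaries_def)
  define h where "h = complex_of_real (1 / sqrt 2)"
  have hh: "h * h = 1/2" by (simp add: h_def flip: of_real_mult)
  have ch: "cnj h = h" by (simp add: h_def)
  \<comment> \<open>Row \<open>k\<close> of \<open>V\<close> has its only possibly nonzero entry in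
    column \<open>r k\<close>; rows \<open>i\<close> and \<open>m + i\<close> are the two that meet
    column \<open>i\<close>.\<close>
  define r where "r k = (if k < m then k else k - m)" for k
  define v where "v k = (if k < m then h \<odot> \<one> else h \<odot> w)" for k
  define V where "V = (\<lambda>(k, j)\<in>{..<2 * m} \<times> {..<m}. if j = r k then v k else \<zero>)"
  have vT: "v k \<in> T" for k using D(2,4) uw(3) by (auto simp: v_def)
  have vc: "v k \<in> carrier A" for k using vT D(1) by blast
  have Vent: "V (k, j) = (if j = r k then v k else \<zero>)" if "k < 2 * m" "j < m" for k j
    using that by (simp add: V_def)
  have VT: "V \<in> rmats (2 * m) m T" using vT D(6) by (auto simp: V_def rmats_def)
  have Vc: "V \<in> Rect (2 * m) m" using VT rmats_mono[OF D(8)] by blast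
  have VK: "V \<in> rmats (2 * m) m K" using VT rmats_mono[OF T(2)] by blast
  let ?V' = "radj (2 * m) m V"
  have V'ent: "?V' (j, k) = (if j = r k then adj A (v k) else \<zero>)" if "k < 2 * m" "j < m" for k j
    using that by (simp add: Vent)
  have rk: "r k < m" if "k < 2 * m" for k using that by (auto simp: r_def)
  have sums: "(\<Oplus>k\<in>{..<2 * m}. if i = r k then f k else \<zero>) = f i \<oplus> f (m + i)"
    if i: "i < m" and f: "\<And>k. k < 2 * m \<Longrightarrow> f k \<in> carrier A" for f i
  proof -
    have "(\<Oplus>k\<in>{..<2 * m}. if i = r k then f k else \<zero>)
        = (\<Oplus>k\<in>{..<2 * m}. (if k = i then f k else \<zero>) \<oplus> (if k = m + i then f k else \<zero>))"
      using i f by (intro finsum_cong') (auto simp: r_def)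
    also have "\<dots> = (\<Oplus>k\<in>{..<2 * m}. if k = i then f k else \<zero>) \<oplus> (\<Oplus>k\<in>{..<2 * m}. if k = m + i then f k else \<zero>)"
      using f by (intro finsum_addf) auto
    also have "\<dots> = f i \<oplus> f (m + i)"
      using i f finsum_delta[of "{..<2 * m}" i f] finsum_delta[of "{..<2 * m}" "m + i" f] by auto
    finally show ?thesis .
  qed
  have vl: "v i = h \<odot> \<one>" "v (m + i) = h \<odot> w" "adj A (v i) = h \<odot> \<one>" "adj A (v (m + i)) = h \<odot> u"
    if "i < m" for i using that uw by (auto simp: v_def adj_simps ch)
  have left: "(\<Oplus>k\<in>{..<2 * m}. ?V' (i, k) \<otimes> f k) = h \<odot> (f i \<oplus> u \<otimes> f (m + i))"
    if i: "i < m" and f: "\<And>k. k < 2 * m \<Longrightarrow> f k \<in> carrier A" for f i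
  proof -
    have "(\<Oplus>k\<in>{..<2 * m}. ?V' (i, k) \<otimes> f k) = (\<Oplus>k\<in>{..<2 * m}. if i = r k then adj A (v k) \<otimes> f k else \<zero>)"
      using i f vc by (intro finsum_cong') (auto simp: V'ent simp del: radj_entry)
    also have "\<dots> = adj A (v i) \<otimes> f i \<oplus> adj A (v (m + i)) \<otimes> f (m + i)"
      using i f vc by (intro sums) auto
    also have "\<dots> = h \<odot> (f i \<oplus> u \<otimes> f (m + i))"
      unfolding vl(3,4)[OF i] using i f[of i] f[of "m + i"] uw by (simp add: smult_mult_left smult_add_right)
    finally show ?thesis .
  qed
  have right: "(\<Oplus>k\<in>{..<2 * m}. f k \<otimes> V (k, j)) = h \<odot> (f j \<oplus> f (m + j) \<otimes> w)"
    if j: "j < m" and f: "\<And>k. k < 2 * m \<Longrightarrow> f k \<in> carrier A" for f j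
  proof -
    have "(\<Oplus>k\<in>{..<2 * m}. f k \<otimes> V (k, j)) = (\<Oplus>k\<in>{..<2 * m}. if j = r k then f k \<otimes> v k else \<zero>)"
      using j f vc by (intro finsum_cong') (auto simp: Vent)
    also have "\<dots> = f j \<otimes> v j \<oplus> f (m + j) \<otimes> v (m + j)"
      using j f vc by (intro sums) auto
    also have "\<dots> = h \<odot> (f j \<oplus> f (m + j) \<otimes> w)"
      using j f[of j] f[of "m + j"] uw by (simp add: vl smult_mult_right smult_add_right)
    finally show ?thesis .
  qed
  \<comment> \<open>This uses \<open>u w = 1\<close>: the two blocks contribute
    \<open>h^2 = 1/2\<close> each.\<close>
  have V'V: "rmul m (2 * m) m ?V' V = \<one>\<^bsub>Mat m\<^esub>"
  proof (rule mat_eqI[of _ m])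
    fix i j assume ij: "i < m" "j < m"
    have "rmul m (2 * m) m ?V' V (i, j) = h \<odot> (V (i, j) \<oplus> u \<otimes> V (m + i, j))"
      unfolding rmul_entry[OF ij] using ij Vc by (intro left) (auto intro: rmatsD)
    also have "\<dots> = (if i = j then \<one> else \<zero>)"
    proof (cases "i = j")
      case True
      then have "V (i, j) = h \<odot> \<one>" "V (m + i, j) = h \<odot> w"
        using ij by (simp_all add: Vent r_def v_def)
      then have "h \<odot> (V (i, j) \<oplus> u \<otimes> V (m + i, j)) = (h * h) \<odot> \<one> \<oplus> (h * h) \<odot> \<one>"
        using uw by (simp add: smult_mult_right smult_add_right)
      also have "\<dots> = (h * h + h * h) \<odot> \<one>" by (rule smult_add_left[symmetric]) simp
      finally show ?thesis using True by (simp add: hh)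
    next
      case False
      then have "V (i, j) = \<zero>" "V (m + i, j) = \<zero>" using ij by (auto simp: Vent r_def)
      then show ?thesis using False uw by simp
    qed
    finally show "rmul m (2 * m) m ?V' V (i, j) = \<one>\<^bsub>Mat m\<^esub> (i, j)"
      using ij by (simp add: matrix_entries)
  qed (use Vc in \<open>auto simp: matrix_closed\<close>)
  \<comment> \<open>The entries are 0 or \<open>h^2\<close> times one of 1, \<open>u\<close>,
    \<open>w\<close> and \<open>w u = 1\<close>. Unitarity removes the one product that might leave
    \<open>T\<close>.\<close>
  have VV': "rmul (2 * m) m (2 * m) V ?V' \<in> mats (2 * m) T"
  proof -
    have "(\<Oplus>j\<in>{..<m}. V (k, j) \<otimes> ?V' (j, l)) \<in> T" if kl: "k < 2 * m" "l < 2 * m" for k l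
    proof -
      have "(\<Oplus>j\<in>{..<m}. V (k, j) \<otimes> ?V' (j, l))
          = (\<Oplus>j\<in>{..<m}. if j = r k then (if r k = r l then v k \<otimes> adj A (v l) else \<zero>) else \<zero>)"
        using kl vc by (intro finsum_cong') (auto simp: Vent V'ent simp del: radj_entry)
      also have "\<dots> = (if r k = r l then v k \<otimes> adj A (v l) else \<zero>)"
        using rk[OF kl(1)] vc by (intro finsum_delta) auto
      also have "\<dots> \<in> T"
      proof -
        have "v k \<otimes> adj A (v l) \<in> T"
          using uw u(1) D(2,4) by (auto simp: v_def adj_simps ch smult_mult_left smult_mult_right)
        then show ?thesis using D(6) by simp
      qed
      finally show ?thesis .
    qed
    then show ?thesis by (auto simp: rmul_def mats_def simp del: radj_entry)
  qed
  have F: "rconj (2 * m) m V Z \<in> mats m K" if Z: "Z \<in> mats (2 * m) K" for Z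
    using Z VK unfolding rconj_def mats_eq_rmats
    by (intro rmul_mem[OF K] radj_mem[OF K])
  have "mats m (dilate u T) \<subseteq> rconj (2 * m) m V ` mats (2 * m) T"
  proof
    fix x assume "x \<in> mats m (dilate u T)"
    then have x: "x \<in> rmats m m (dilate u T)" by (simp add: mats_eq_rmats)
    have "\<exists>a b c d. a \<in> T \<and> b \<in> T \<and> c \<in> T \<and> d \<in> T \<and> x (i, j) = a \<oplus> u \<otimes> b \<oplus> c \<otimes> w \<oplus> u \<otimes> d \<otimes> w"
      if "i < m" "j < m" for i j
      using rmatsD[OF x that] unfolding dilate_def w_def by blast
    then obtain a b c d where t: "\<And>i j. i < m \<Longrightarrow> j < m \<Longrightarrow> a i j \<in> T \<and> b i j \<in> T \<and> c i j \<in> T \<and> d i j \<in> T \<and>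
        x (i, j) = a i j \<oplus> u \<otimes> b i j \<oplus> c i j \<otimes> w \<oplus> u \<otimes> d i j \<otimes> w" by metis
    \<comment> \<open>The factor 2 cancels \<open>h^2\<close>. The blocks are placed so that left
      multiplication by \<open>u\<close> meets the lower rows and right multiplication by
      \<open>w\<close> the right columns.\<close>
    define Z where "Z = (\<lambda>(k, l)\<in>{..<2 * m} \<times> {..<2 * m}. 2 \<odot>
      (if k < m then (if l < m then a k l else c k (l - m)) else (if l < m then b (k - m) l else d (k - m) (l - m))))"
    have ZT: "Z \<in> mats (2 * m) T" using t D(4) by (auto simp: Z_def mats_def)
    have Zc: "Z \<in> Rect (2 * m) (2 * m)"
      using ZT rmats_mono[OF D(8)] unfolding mats_eq_rmats by blast
    have "rconj (2 * m) m V Z = x"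
    proof (rule mat_eqI[of _ m])
      show "x \<in> Rect m m"
        using x rmats_mono[OF operator_subsystemD(8)[OF dilate_operator_subsystem[OF T(1) uw(1)]]] by blast
      fix i j assume ij: "i < m" "j < m"
      have tc: "a i j \<in> carrier A" "b i j \<in> carrier A" "c i j \<in> carrier A" "d i j \<in> carrier A"
        using t[OF ij] D(1) by auto
      have Ze: "Z (i, j) = 2 \<odot> a i j" "Z (i, m + j) = 2 \<odot> c i j"
        "Z (m + i, j) = 2 \<odot> b i j" "Z (m + i, m + j) = 2 \<odot> d i j"
        using ij by (simp_all add: Z_def)
      have ZV: "rmul (2 * m) (2 * m) m Z V (k, j) = h \<odot> (Z (k, j) \<oplus> Z (k, m + j) \<otimes> w)" if k: "k < 2 * m" for k
        unfolding rmul_entry[OF k ij(2)] using k ij Zc by (intro right) (auto intro: rmatsD)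
      have "rconj (2 * m) m V Z (i, j)
          = h \<odot> (rmul (2 * m) (2 * m) m Z V (i, j) \<oplus> u \<otimes> rmul (2 * m) (2 * m) m Z V (m + i, j))"
        unfolding rconj_def rmul_entry[OF ij] using ij rmul_closed[OF Zc Vc]
        by (intro left) (auto intro: rmatsD)
      also have "\<dots> = h \<odot> (h \<odot> (2 \<odot> a i j \<oplus> (2 \<odot> c i j) \<otimes> w) \<oplus> u \<otimes> (h \<odot> (2 \<odot> b i j \<oplus> (2 \<odot> d i j) \<otimes> w)))"
        using ij by (simp add: ZV Ze)
      also have "\<dots> = (2 * (h * h)) \<odot> (a i j \<oplus> u \<otimes> b i j \<oplus> c i j \<otimes> w \<oplus> u \<otimes> d i j \<otimes> w)"
        using tc uw by (simp add: smult_add_right smult_mult_left smult_mult_right r_distr m_assoc a_ac mult_ac)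
      also have "\<dots> = x (i, j)" using t[OF ij] tc uw by (simp add: hh)
      finally show "rconj (2 * m) m V Z (i, j) = x (i, j)" .
    qed (use Vc Zc in auto)
    then show "x \<in> rconj (2 * m) m V ` mats (2 * m) T" using ZT by blast
  qed
  then show ?thesis
    using interpolates_mono[OF interpolates_compress[OF nk Vc V'V T(1) VV' int F]] by blast
qed

section \<open>Iterated dilations along words of unitaries\<close>

primrec tower :: "'a set \<Rightarrow> 'a list \<Rightarrow> 'a set"
  where "tower S [] = S" | "tower S (u # us) = dilate u (tower S us)"

lemma tower_operator_subsystem:
  assumes S: "operator_subsystem A S" and us: "set us \<subseteq> S"
  shows "operator_subsystem A (tower S us)" "S \<subseteq> tower S us"
proof -
  have "operator_subsystem A (tower S us) \<and> S \<subseteq> tower S us"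
    using us
  proof (induction us)
    case (Cons u us)
    have u: "u \<in> carrier A" using Cons.prems operator_subsystemD(1)[OF S] by simp
    show ?case using Cons dilate_operator_subsystem[OF _ u] dilate_superset(1)[OF _ u] by fastforce
  qed (simp add: S)
  then show "operator_subsystem A (tower S us)" "S \<subseteq> tower S us" by auto
qed

lemma tower_subset:
  assumes K: "cstar_subalgebra A K" "S \<subseteq> K" and us: "set us \<subseteq> K"
  shows "tower S us \<subseteq> K"
  using us
proof (induction us)
  case (Cons u us)
  have "a \<oplus> u \<otimes> b \<oplus> c \<otimes> adj A u \<oplus> u \<otimes> d \<otimes> adj A u \<in> K"
    if "a \<in> K" "b \<in> K" "c \<in> K" "d \<in> K" for a b c d
    using that Cons.prems by (intro cstar_subalgebraD(4,6,7)[OF K(1)]) auto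
  then have "dilate u K \<subseteq> K" unfolding dilate_def by blast
  moreover have "dilate u (tower S us) \<subseteq> dilate u K" using Cons by (intro dilate_mono) auto
  ultimately show ?case by auto
qed (simp add: K)

text \<open>A longer tail enlarges the base of the dilations, which are monotone, and a longer head
  only adds dilations. So any two words have a common upper bound, and the towers are
  directed.\<close>

lemma tower_append:
  assumes S: "operator_subsystem A S" and us: "set us \<subseteq> S" "set vs \<subseteq> S"
  shows "tower S us \<subseteq> tower S (us @ vs)" "tower S vs \<subseteq> tower S (us @ vs)"
proof -
  show "tower S us \<subseteq> tower S (us @ vs)"
    by (induction us) (use tower_operator_subsystem(2)[OF S us(2)] in \<open>auto dest: dilate_mono[THEN subsetD]\<close>)
  show "tower S vs \<subseteq> tower S (us @ vs)"
    using us(1)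
  proof (induction us)
    case (Cons u us)
    have "operator_subsystem A (tower S (us @ vs))"
      using Cons.prems us(2) by (intro tower_operator_subsystem[OF S]) auto
    then have "tower S (us @ vs) \<subseteq> dilate u (tower S (us @ vs))"
      using Cons.prems operator_subsystemD(1)[OF S] by (intro dilate_superset(1)) auto
    then show ?case using Cons by auto
  qed simp
qed

text \<open>Each letter at size \<open>m\<close> uses the level below at size \<open>2 m\<close>, so
  the induction generalizes \<open>m\<close>. The target \<open>K\<close> stays fixed while the
  system of bounds grows.\<close>

lemma tower_interpolates:
  assumes nk: "n \<ge> 1" "k \<ge> 1" and S: "operator_subsystem A S" and K: "cstar_subalgebra A K" "S \<subseteq> K"
    and int: "\<And>m. m \<ge> 1 \<Longrightarrow> interpolates n k (Mat m) (mats m S) (mats m K)"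
    and us: "set us \<subseteq> unitaries A \<inter> S" and m: "m \<ge> 1"
  shows "interpolates n k (Mat m) (mats m (tower S us)) (mats m K)"
  using us m
proof (induction us arbitrary: m)
  case Nil
  then show ?case using int by simp
next
  case (Cons u us)
  have us: "set us \<subseteq> S" "set us \<subseteq> K" using Cons.prems K(2) by auto
  have "interpolates n k (Mat m) (mats m (dilate u (tower S us))) (mats m K)"
    using Cons tower_operator_subsystem[OF S us(1)] tower_subset[OF K us(2)]
    by (intro interpolates_dilate[OF nk K(1)]) auto
  then show ?case by simp
qed

section \<open>Strict inequalities under small perturbations\<close>

lemma strictly_below_perturb:
  assumes x: "x \<in> self_adjoint A" and b: "b \<in> carrier A" and xb: "strictly_below A x b"
  shows "\<exists>e>0. \<forall>x'\<in>self_adjoint A. cnorm A (x \<ominus> x') < e \<longrightarrow>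
    strictly_below A (x' \<oplus> scal e) b \<and>
    (\<forall>a\<in>carrier A. strictly_below A (x' \<oplus> scal e) a \<longrightarrow> strictly_below A x a)"
proof -
  obtain d where d: "d > 0" "b \<ominus> x \<ominus> scal d \<in> npos" using xb by (auto simp: strictly_below_npos)
  \<comment> \<open>The gap \<open>d\<close> is divided into thirds: one for the distance from
    \<open>x\<close> to \<open>y\<close>, one for the shift that puts \<open>y + e\<close> above
    \<open>x\<close>, and one that remains below \<open>b\<close>.\<close>
  define e where "e = d / 3"
  define w where "w = scal e"
  have w: "w \<in> carrier A" by (simp add: w_def)
  have e: "e > 0" "scal d = w \<oplus> w \<oplus> w"
    using d by (simp_all add: e_def w_def flip: smult_add_left)
  have xc: "x \<in> carrier A" "adj A x = x" using x by (auto simp: self_adjoint_iff)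
  show ?thesis
  proof (intro exI[of _ e] conjI ballI impI e(1); fold w_def)
    fix y assume y: "y \<in> self_adjoint A" and xy: "cnorm A (x \<ominus> y) < e"
    have yc: "y \<in> carrier A" "adj A y = y" using y by (auto simp: self_adjoint_iff)
    have p: "w \<ominus> (y \<ominus> x) \<in> npos" "w \<ominus> (x \<ominus> y) \<in> npos"
      using xc yc xy unfolding w_def by (intro npos_cnorm_diff; simp add: adj_simps cnorm_diff_commute)+
    have "b \<ominus> (y \<oplus> w) \<ominus> w = (b \<ominus> x \<ominus> (w \<oplus> w \<oplus> w)) \<oplus> (w \<ominus> (y \<ominus> x))"
      using b xc(1) yc(1) w by algebra
    then have "b \<ominus> (y \<oplus> w) \<ominus> w \<in> npos" using npos_add[OF d(2) p(1)] by (simp add: e(2))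
    then show "strictly_below A (y \<oplus> w) b" using e(1) by (auto simp: strictly_below_npos w_def)
    fix a assume a: "a \<in> carrier A" "strictly_below A (y \<oplus> w) a"
    then obtain g where g: "g > 0" "a \<ominus> (y \<oplus> w) \<ominus> scal g \<in> npos" by (auto simp: strictly_below_npos)
    have "scal g \<in> carrier A" by simp
    then have "(a \<ominus> (y \<oplus> w) \<ominus> scal g) \<oplus> (w \<ominus> (x \<ominus> y)) = a \<ominus> x \<ominus> scal g"
      using a(1) xc(1) yc(1) w by algebra
    then show "strictly_below A x a" using npos_add[OF g(2) p(2)] g(1) by (auto simp: strictly_below_npos)
  qed
qed

text \<open>Passing to the self-adjoint part of an approximant \<open>z\<close> does not increase
  the distance, because its difference from \<open>x\<close> is the self-adjoint part of
  \<open>x - z\<close>. Shifting by \<open>e\<close> then gives a bound in \<open>T\<close> that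
  implies the original one.\<close>

lemma approximate_below:
  assumes T: "operator_subsystem A T" and x: "x \<in> self_adjoint A"
    and dense: "\<And>e. e > 0 \<Longrightarrow> \<exists>x'\<in>T. cnorm A (x \<ominus> x') < e"
    and b: "b \<in> carrier A" "strictly_below A x b"
  shows "\<exists>y\<in>T \<inter> self_adjoint A. strictly_below A y b \<and>
    (\<forall>a\<in>carrier A. strictly_below A y a \<longrightarrow> strictly_below A x a)"
proof -
  have xc: "x \<in> carrier A" "adj A x = x" using x by (auto simp: self_adjoint_iff)
  obtain e where e: "e > 0" "\<And>x'. x' \<in> self_adjoint A \<Longrightarrow> cnorm A (x \<ominus> x') < e \<Longrightarrow>
      strictly_below A (x' \<oplus> scal e) b \<and>
      (\<forall>a\<in>carrier A. strictly_below A (x' \<oplus> scal e) a \<longrightarrow> strictly_below A x a)"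
    using strictly_below_perturb[OF x b] by blast
  obtain z where z: "z \<in> T" "cnorm A (x \<ominus> z) < e" using dense[OF e(1)] by blast
  have zc: "z \<in> carrier A" using operator_subsystemD(1)[OF T z(1)] .
  define y where "y = (1/2) \<odot> (z \<oplus> adj A z)"
  have y: "y \<in> T" "y \<in> self_adjoint A" using self_adjoint_part[OF T z(1)] by (auto simp: y_def)
  have "x \<ominus> y = (1/2) \<odot> ((x \<ominus> z) \<oplus> adj A (x \<ominus> z))"
  proof -
    have "x \<ominus> y = (1/2) \<odot> (x \<oplus> x) \<ominus> y" using xc by (simp add: smult_half_add)
    also have "\<dots> = (1/2) \<odot> ((x \<oplus> x) \<ominus> (z \<oplus> adj A z))" using xc zc by (simp add: y_def smult_diff_right)
    also have "(x \<oplus> x) \<ominus> (z \<oplus> adj A z) = (x \<ominus> z) \<oplus> (x \<ominus> adj A z)"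
      using xc zc by (simp add: minus_eq minus_add a_ac)
    finally show ?thesis using xc zc by (simp add: adj_simps)
  qed
  then have "cnorm A (x \<ominus> y) \<le> cnorm A (x \<ominus> z)"
    using cnorm_triangle[of "x \<ominus> z" "adj A (x \<ominus> z)"] xc zc by (simp add: cnorm_smult)
  then have n: "cnorm A (x \<ominus> y) < e" using z(2) by simp
  have "y \<oplus> scal e \<in> T \<inter> self_adjoint A"
  proof
    show "y \<oplus> scal e \<in> T" by (intro operator_subsystemD(3,4,2)[OF T] y)
    show "y \<oplus> scal e \<in> self_adjoint A" using y(2) by (simp add: self_adjoint_iff adj_simps)
  qed
  then show ?thesis using e(2)[OF y(2) n] by blast
qed

text \<open>Negation turns upper bounds into lower ones and preserves \<open>T\<close>.\<close>

lemma approximate_above: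
  assumes T: "operator_subsystem A T" and x: "x \<in> self_adjoint A"
    and dense: "\<And>e. e > 0 \<Longrightarrow> \<exists>x'\<in>T. cnorm A (x \<ominus> x') < e"
    and b: "b \<in> carrier A" "strictly_below A b x"
  shows "\<exists>y\<in>T \<inter> self_adjoint A. strictly_below A b y \<and>
    (\<forall>a\<in>carrier A. strictly_below A a y \<longrightarrow> strictly_below A a x)"
proof -
  have xc: "x \<in> carrier A" "adj A x = x" using x by (auto simp: self_adjoint_iff)
  have neg: "\<ominus> t \<in> T" if "t \<in> T" for t
    using operator_subsystemD(1,4)[OF T that] smult_minus_one[of t] by metis
  have dense': "\<exists>x'\<in>T. cnorm A (\<ominus> x \<ominus> x') < e" if e: "e > 0" for e
  proof -
    obtain z where z: "z \<in> T" "cnorm A (x \<ominus> z) < e" using dense[OF e] by blast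
    have zc: "z \<in> carrier A" using operator_subsystemD(1)[OF T z(1)] .
    have "\<ominus> x \<ominus> \<ominus> z = z \<ominus> x" using xc(1) zc by (simp add: minus_eq a_comm)
    then show ?thesis using z neg xc(1) zc by (intro bexI[of _ "\<ominus> z"]) (auto simp: cnorm_diff_commute)
  qed
  have "\<ominus> x \<in> self_adjoint A" using xc by (simp add: self_adjoint_iff adj_simps)
  from approximate_below[OF T this dense', of "\<ominus> b"] b xc(1)
  obtain y where y: "y \<in> T" "y \<in> self_adjoint A" "strictly_below A y (\<ominus> b)"
    "\<And>a. a \<in> carrier A \<Longrightarrow> strictly_below A y a \<Longrightarrow> strictly_below A (\<ominus> x) a"
    by (auto simp: strictly_below_uminus)
  have yc: "y \<in> carrier A" "adj A y = y" using y(2) by (auto simp: self_adjoint_iff)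
  have "strictly_below A b (\<ominus> y)"
    using strictly_below_uminus[of "\<ominus> y" b] y(3) yc(1) b(1) by simp
  moreover have "strictly_below A a x" if a: "a \<in> carrier A" "strictly_below A a (\<ominus> y)" for a
    using y(4)[of "\<ominus> a"] strictly_below_uminus[of "\<ominus> y" a] strictly_below_uminus[of x a] a yc(1) xc(1) by simp
  moreover have "\<ominus> y \<in> T \<inter> self_adjoint A" using neg[OF y(1)] yc by (simp add: self_adjoint_iff adj_simps)
  ultimately show ?thesis by blast
qed

text \<open>Every bound is replaced by one in \<open>T\<close> that still lies on its side of
  \<open>b\<close> and implies the old bound for every competitor. An interpolant for the new bounds
  therefore serves the old ones; the interpolant itself is never approximated.\<close>

lemma interpolates_dense:
  assumes nk: "n \<ge> 1" "k \<ge> 1" and T: "operator_subsystem A T"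
    and dense: "\<And>x e. x \<in> E \<Longrightarrow> e > 0 \<Longrightarrow> \<exists>x'\<in>T. cnorm A (x \<ominus> x') < e"
    and int: "interpolates n k A T F"
  shows "interpolates n k A E F"
  unfolding interpolates_def
proof (intro allI impI)
  fix x y :: "nat \<Rightarrow> 'a"
  assume x: "\<forall>i\<in>{1..n}. x i \<in> E \<inter> self_adjoint A" and y: "\<forall>j\<in>{1..k}. y j \<in> E \<inter> self_adjoint A"
    and "\<exists>b\<in>self_adjoint A. \<forall>i\<in>{1..n}. \<forall>j\<in>{1..k}. strictly_below A (x i) b \<and> strictly_below A b (y j)"
  then obtain b where b: "b \<in> self_adjoint A"
    "\<And>i j. i \<in> {1..n} \<Longrightarrow> j \<in> {1..k} \<Longrightarrow> strictly_below A (x i) b \<and> strictly_below A b (y j)" by blast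
  have bc: "b \<in> carrier A" using b by (simp add: self_adjoint_iff)
  have "\<exists>z. \<forall>i\<in>{1..n}. z i \<in> T \<inter> self_adjoint A \<and> strictly_below A (z i) b \<and>
      (\<forall>a\<in>carrier A. strictly_below A (z i) a \<longrightarrow> strictly_below A (x i) a)"
  proof (rule bchoice, rule ballI)
    fix i assume i: "i \<in> {1..n}"
    have "x i \<in> E" "x i \<in> self_adjoint A" "strictly_below A (x i) b" using x i b(2)[OF i, of 1] nk by auto
    then show "\<exists>z. z \<in> T \<inter> self_adjoint A \<and> strictly_below A z b \<and>
      (\<forall>a\<in>carrier A. strictly_below A z a \<longrightarrow> strictly_below A (x i) a)"
      using approximate_below[OF T _ dense bc, of "x i"] by blast
  qed
  then obtain z where z: "\<forall>i\<in>{1..n}. z i \<in> T \<inter> self_adjoint A" "\<forall>i\<in>{1..n}. strictly_below A (z i) b"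
    "\<And>i a. i \<in> {1..n} \<Longrightarrow> a \<in> carrier A \<Longrightarrow> strictly_below A (z i) a \<Longrightarrow> strictly_below A (x i) a" by blast
  have "\<exists>w. \<forall>j\<in>{1..k}. w j \<in> T \<inter> self_adjoint A \<and> strictly_below A b (w j) \<and>
      (\<forall>a\<in>carrier A. strictly_below A a (w j) \<longrightarrow> strictly_below A a (y j))"
  proof (rule bchoice, rule ballI)
    fix j assume j: "j \<in> {1..k}"
    have "y j \<in> E" "y j \<in> self_adjoint A" "strictly_below A b (y j)" using y j b(2)[OF _ j, of 1] nk by auto
    then show "\<exists>w. w \<in> T \<inter> self_adjoint A \<and> strictly_below A b w \<and>
      (\<forall>a\<in>carrier A. strictly_below A a w \<longrightarrow> strictly_below A a (y j))"
      using approximate_above[OF T _ dense bc, of "y j"] by blast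
  qed
  then obtain w where w: "\<forall>j\<in>{1..k}. w j \<in> T \<inter> self_adjoint A" "\<forall>j\<in>{1..k}. strictly_below A b (w j)"
    "\<And>j a. j \<in> {1..k} \<Longrightarrow> a \<in> carrier A \<Longrightarrow> strictly_below A a (w j) \<Longrightarrow> strictly_below A a (y j)" by blast
  obtain a where a: "a \<in> F \<inter> self_adjoint A"
    "\<And>i j. i \<in> {1..n} \<Longrightarrow> j \<in> {1..k} \<Longrightarrow> strictly_below A (z i) a \<and> strictly_below A a (w j)"
    using spec[OF spec[OF int[unfolded interpolates_def], of z], of w] z(1,2) w(1,2) b(1) by blast
  have "a \<in> carrier A" using a(1) by (simp add: self_adjoint_iff)
  then show "\<exists>a\<in>F \<inter> self_adjoint A. \<forall>i\<in>{1..n}. \<forall>j\<in>{1..k}. strictly_below A (x i) a \<and> strictly_below A a (y j)"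
    using a z(3) w(3) by (intro bexI[of _ a]) blast+
qed

section \<open>The union of the towers and its density\<close>

definition tower_union :: "'a set \<Rightarrow> 'a set"
  where "tower_union S = (\<Union>us\<in>lists (unitaries A \<inter> S). tower S us)"

text \<open>Directedness of the towers is applied once for each element. This is how finitely many
  matrix entries are placed in a single level.\<close>

lemma finite_subset_tower:
  assumes S: "operator_subsystem A S" and P: "finite P" "P \<subseteq> tower_union S"
  shows "\<exists>us\<in>lists (unitaries A \<inter> S). P \<subseteq> tower S us"
  using P
proof (induction P rule: finite_induct)
  case empty
  then show ?case by (intro bexI[of _ "[]"]) auto
next
  case (insert p P)
  then obtain us vs where "us \<in> lists (unitaries A \<inter> S)" "P \<subseteq> tower S us"
    "vs \<in> lists (unitaries A \<inter> S)" "p \<in> tower S vs" unfolding tower_union_def by auto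
  then show ?case using tower_append[OF S, of us vs]
    by (intro bexI[of _ "us @ vs"]) (auto simp: lists_eq_set)
qed

lemma tower_union_operator_subsystem:
  assumes S: "operator_subsystem A S"
  shows "operator_subsystem A (tower_union S)"
proof -
  have sub: "\<exists>us. operator_subsystem A (tower S us) \<and> P \<subseteq> tower S us \<and> tower S us \<subseteq> tower_union S"
    if P: "finite P" "P \<subseteq> tower_union S" for P
  proof -
    obtain us where us: "us \<in> lists (unitaries A \<inter> S)" "P \<subseteq> tower S us" using finite_subset_tower[OF S P] by blast
    then have "set us \<subseteq> S" by (auto simp: lists_eq_set)
    then show ?thesis using us tower_operator_subsystem[OF S] unfolding tower_union_def by blast
  qed
  show ?thesis
    unfolding operator_subsystem_iff
  proof (intro conjI ballI allI subsetI)
    show "\<one> \<in> tower_union S" using sub[of "{}"] operator_subsystemD(2) by blast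
  next
    fix x assume x: "x \<in> tower_union S"
    then obtain us where us: "operator_subsystem A (tower S us)" "x \<in> tower S us" "tower S us \<subseteq> tower_union S"
      using sub[of "{x}"] by auto
    show "x \<in> carrier A" "adj A x \<in> tower_union S" "c \<odot> x \<in> tower_union S" for c
      using operator_subsystemD(1,5,4)[OF us(1,2)] us(3) by blast+
    fix y assume "y \<in> tower_union S"
    then obtain vs where "operator_subsystem A (tower S vs)" "x \<in> tower S vs" "y \<in> tower S vs" "tower S vs \<subseteq> tower_union S"
      using sub[of "{x, y}"] x by auto
    then show "x \<oplus> y \<in> tower_union S" using operator_subsystemD(3) by blast
  qed
qed

text \<open>The elements whose left multiplications, together with those of their adjoints, preserve the
  tower form a *-algebra; it contains the unitaries of \<open>S\<close> and lies in the tower as \<open>1\<close> does.\<close>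

lemma tower_union_dense:
  assumes S: "operator_subsystem A S"
    and gen: "unitary_operator_subsystem (A\<lparr>carrier := cstar_generated A S\<rparr>) S"
    and a: "a \<in> cstar_generated A S" and e: "e > 0"
  shows "\<exists>d\<in>tower_union S. cnorm A (a \<ominus> d) < e"
proof -
  note SD = operator_subsystemD[OF S]
  let ?K = "cstar_generated A S"
  let ?B = "A\<lparr>carrier := ?K\<rparr>"
  let ?D = "tower_union S"
  have K: "cstar_subalgebra A ?K" by (rule cstar_subalgebra_generated[OF SD(8)])
  note KD = cstar_subalgebraD[OF K]
  have SK: "S \<subseteq> ?K" by (rule cstar_generated_superset)
  interpret BB: unital_cstar_algebra ?B using SK SD(2) by (intro subalgebra_cstar[OF K]) blast
  have D: "operator_subsystem A ?D" by (rule tower_union_operator_subsystem[OF S])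
  note DD = operator_subsystemD[OF D]
  have DK: "?D \<subseteq> ?K"
    unfolding tower_union_def using tower_subset[OF K SK] SK by (auto simp: lists_eq_set) 
  \<comment> \<open>Multiplication by \<open>u\<close> is realized by putting \<open>u\<close> in
    front of the word, so the union is stable under it where a single tower need not be.\<close>
  have uD: "u \<otimes> d \<in> ?D" if u: "u \<in> unitaries A \<inter> S" and d: "d \<in> ?D" for u d
  proof -
    obtain us where us: "us \<in> lists (unitaries A \<inter> S)" "d \<in> tower S us" using d unfolding tower_union_def by blast
    then have "set us \<subseteq> S" by (auto simp: lists_eq_set)
    then have "u \<otimes> d \<in> tower S (u # us)"
      using dilate_superset(2)[OF tower_operator_subsystem(1)[OF S] _ us(2)] u SD(1) by simp
    moreover have "u # us \<in> lists (unitaries A \<inter> S)" using u us(1) by auto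
    ultimately show ?thesis unfolding tower_union_def by blast
  qed
  define L where "L = {a \<in> ?K. \<forall>d\<in>?D. a \<otimes> d \<in> ?D \<and> adj A a \<otimes> d \<in> ?D}"
  have LK: "L \<subseteq> ?K" by (auto simp: L_def)
  have LD: "L \<subseteq> ?D"
  proof
    fix x assume "x \<in> L"
    then have "x \<otimes> \<one> \<in> ?D" "x \<in> carrier A" using DD(2) KD(2) by (auto simp: L_def)
    then show "x \<in> ?D" by simp
  qed
  \<comment> \<open>The closure is formed in \<open>?B\<close> because the generation hypothesis
    speaks of C*-subalgebras of \<open>?B\<close>.\<close>
  let ?C = "{a \<in> carrier ?B. \<forall>e>0. \<exists>x\<in>L. cnorm ?B (a \<ominus>\<^bsub>?B\<^esub> x) < e}"
  have "cstar_subalgebra ?B ?C"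
  proof (rule BB.closure_cstar_subalgebra)
    show "L \<subseteq> carrier ?B" using LK by simp
    show "\<zero>\<^bsub>?B\<^esub> \<in> L" using KD(3) DD(1,6) by (simp add: L_def)
    fix x assume x: "x \<in> L"
    then have xc: "x \<in> ?K" "x \<in> carrier A" using LK KD(2) by blast+
    have xD: "x \<otimes> d \<in> ?D" "adj A x \<otimes> d \<in> ?D" if "d \<in> ?D" for d using x that by (auto simp: L_def)
    show "adj ?B x \<in> L" using xc xD KD(7)[OF xc(1)] by (simp add: L_def)
    show "c \<odot>\<^bsub>?B\<^esub> x \<in> L" for c
      using xc xD KD(5)[OF xc(1)] DD(1,4) by (simp add: L_def adj_smult smult_mult_left)
    fix y assume y: "y \<in> L"
    then have yc: "y \<in> ?K" "y \<in> carrier A" using LK KD(2) by blast+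
    have yD: "y \<otimes> d \<in> ?D" "adj A y \<otimes> d \<in> ?D" if "d \<in> ?D" for d using y that by (auto simp: L_def)
    show "x \<oplus>\<^bsub>?B\<^esub> y \<in> L"
      using xc yc xD yD KD(4)[OF xc(1) yc(1)] DD(1,3) by (simp add: L_def adj_add l_distr)
    show "x \<otimes>\<^bsub>?B\<^esub> y \<in> L"
      using xc yc xD yD KD(6)[OF xc(1) yc(1)] DD(1) by (simp add: L_def adj_mult m_assoc)
  qed
  moreover have "unitaries ?B \<inter> S \<subseteq> ?C"
  proof
    fix u assume "u \<in> unitaries ?B \<inter> S"
    then have u: "u \<in> unitaries A \<inter> S" using SD(1) by (auto simp: unitaries_def)
    then have uc: "u \<in> ?K" "u \<in> carrier A" using SK SD(1) by auto
    \<comment> \<open>With \<open>u\<close> its adjoint is a unitary in \<open>S\<close>, which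
      gives the second condition in \<open>L\<close>.\<close>
    have "adj A u \<in> unitaries A \<inter> S" using u SD(1,5) by (auto simp: unitaries_def)
    then have uL: "u \<in> L" using u uc uD by (auto simp: L_def)
    have "u \<ominus>\<^bsub>?B\<^esub> u = \<zero>" using subalgebra_minus[OF K uc(1) uc(1)] uc(2) by (simp add: diff_eq_zero)
    then show "u \<in> ?C" using uL uc by (auto intro!: bexI[of _ u])
  qed
  ultimately have "cstar_generated ?B (unitaries ?B \<inter> S) \<subseteq> ?C" by (rule BB.cstar_generated_least)
  moreover have "cstar_generated ?B (unitaries ?B \<inter> S) = ?K"
    using gen by (simp add: unitary_operator_subsystem_def)
  ultimately have "a \<in> ?C" using a by blast
  then obtain x where x: "x \<in> L" "cnorm ?B (a \<ominus>\<^bsub>?B\<^esub> x) < e" using e by blast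
  then have "cnorm A (a \<ominus> x) < e" using subalgebra_minus[OF K a, of x] LK by auto
  then show ?thesis using x(1) LD by blast
qed

lemma mats_dense:
  assumes T: "T \<subseteq> carrier A" and x: "x \<in> Rect m m" and e: "e > 0"
    and dense: "\<And>i j e. i < m \<Longrightarrow> j < m \<Longrightarrow> e > 0 \<Longrightarrow> \<exists>d\<in>T. cnorm A (x (i, j) \<ominus> d) < e"
  shows "\<exists>z\<in>mats m T. matrix_norm m A (x \<ominus>\<^bsub>Mat m\<^esub> z) < e"
proof -
  \<comment> \<open>Each of the \<open>m^2\<close> entries may err by \<open>g\<close>; the extra 1
    makes the total strictly less than \<open>e\<close>.\<close>
  define g where "g = e / (real m * real m + 1)"
  have g: "g > 0" using e by (simp add: g_def add_nonneg_pos)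
  have "\<exists>d. d \<in> T \<and> cnorm A (x (i, j) \<ominus> d) < g" if "i < m" "j < m" for i j
    using dense[OF that g] by blast
  then obtain d where d: "\<And>i j. i < m \<Longrightarrow> j < m \<Longrightarrow> d i j \<in> T \<and> cnorm A (x (i, j) \<ominus> d i j) < g" by metis
  define z where "z = (\<lambda>(i, j)\<in>{..<m} \<times> {..<m}. d i j)"
  have z: "z \<in> rmats m m T" using d by (auto simp: z_def rmats_def)
  then have zc: "z \<in> Rect m m" using rmats_mono[OF T] by blast
  have "matrix_norm m A (x \<ominus>\<^bsub>Mat m\<^esub> z)
      \<le> (\<Sum>i<m. \<Sum>j<m. cnorm A ((x \<ominus>\<^bsub>Mat m\<^esub> z) (i, j)))"
    by (intro matrix_norm_le_sum matrix_minus_closed x zc)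
  also have "\<dots> \<le> (\<Sum>i<m. \<Sum>j<m. g)"
  proof (intro sum_mono)
    fix i j assume "i \<in> {..<m}" "j \<in> {..<m}"
    then show "cnorm A ((x \<ominus>\<^bsub>Mat m\<^esub> z) (i, j)) \<le> g"
      using matrix_minus_entry[OF x zc, of i j] d[of i j] by (simp add: z_def)
  qed
  also have "\<dots> = (real m * real m) * g" by simp
  also have "\<dots> < (real m * real m + 1) * g" using g by simp
  also have "\<dots> = e" unfolding g_def by (simp add: add_nonneg_pos less_imp_neq[symmetric])
  finally show ?thesis using z by (auto simp: mats_eq_rmats)
qed

text \<open>The \<open>n + k\<close> bounds have finitely many entries in total, so bounds over the
  union lie over a single tower, where \<open>tower_interpolates\<close> applies. Bounds over the
  generated algebra are then reached by density.\<close>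

lemma interpolates_generated:
  assumes nk: "n \<ge> 1" "k \<ge> 1" and S: "operator_subsystem A S"
    and gen: "unitary_operator_subsystem (A\<lparr>carrier := cstar_generated A S\<rparr>) S"
    and int: "\<And>m. m \<ge> 1 \<Longrightarrow>
      interpolates n k (Mat m) (mats m S) (mats m (cstar_generated A S))"
    and m: "m \<ge> 1"
  shows "interpolates n k (Mat m) (mats m (cstar_generated A S)) (mats m (cstar_generated A S))"
proof -
  let ?K = "cstar_generated A S"
  let ?M = "Mat m"
  let ?D = "tower_union S"
  interpret MC: unital_cstar_algebra ?M by (rule matrix_cstar)
  have K: "cstar_subalgebra A ?K" by (rule cstar_subalgebra_generated[OF operator_subsystemD(8)[OF S]])
  have D: "operator_subsystem A ?D" by (rule tower_union_operator_subsystem[OF S])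
  have "interpolates n k ?M (mats m ?D) (mats m ?K)"
    unfolding interpolates_def
  proof (intro allI impI)
    fix x y :: "nat \<Rightarrow> nat \<times> nat \<Rightarrow> 'a"
    assume x: "\<forall>i\<in>{1..n}. x i \<in> mats m ?D \<inter> self_adjoint ?M"
      and y: "\<forall>j\<in>{1..k}. y j \<in> mats m ?D \<inter> self_adjoint ?M"
      and b: "\<exists>b\<in>self_adjoint ?M. \<forall>i\<in>{1..n}. \<forall>j\<in>{1..k}. strictly_below ?M (x i) b \<and> strictly_below ?M b (y j)"
    let ?I = "{..<m} \<times> {..<m}"
    let ?P = "(\<Union>i\<in>{1..n}. x i ` ?I) \<union> (\<Union>j\<in>{1..k}. y j ` ?I)"
    have "?P \<subseteq> ?D" using x y by (fastforce simp: mats_def PiE_iff)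
    moreover have "finite ?P" by auto
    ultimately obtain us where us: "us \<in> lists (unitaries A \<inter> S)" "?P \<subseteq> tower S us"
      using finite_subset_tower[OF S] by meson
    have "set us \<subseteq> unitaries A \<inter> S" using us(1) by (auto simp: lists_eq_set)
    then have it: "interpolates n k ?M (mats m (tower S us)) (mats m ?K)"
      by (intro tower_interpolates[OF nk S K cstar_generated_superset int _ m])
    have tw: "z \<in> mats m (tower S us)" if "z \<in> mats m ?D" "z ` ?I \<subseteq> ?P" for z
      using that(1) order_trans[OF that(2) us(2)] by (auto simp: mats_def PiE_iff)
    have "\<forall>i\<in>{1..n}. x i \<in> mats m (tower S us) \<inter> self_adjoint ?M"
      using x by (intro ballI IntI tw) blast+
    moreover have "\<forall>j\<in>{1..k}. y j \<in> mats m (tower S us) \<inter> self_adjoint ?M"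
      using y by (intro ballI IntI tw) blast+
    ultimately show "\<exists>a\<in>mats m ?K \<inter> self_adjoint ?M. \<forall>i\<in>{1..n}. \<forall>j\<in>{1..k}.
        strictly_below ?M (x i) a \<and> strictly_below ?M a (y j)"
      using spec[OF spec[OF it[unfolded interpolates_def], of x], of y] b by blast
  qed
  then show ?thesis
  proof (rule MC.interpolates_dense[OF nk matrix_operator_subsystem[OF D], rotated])
    fix x and e :: real assume x: "x \<in> mats m ?K" and e: "e > 0"
    have xK: "x \<in> rmats m m ?K" using x by (simp add: mats_eq_rmats)
    have xc: "x \<in> Rect m m" using xK rmats_mono[OF cstar_subalgebraD(1)[OF K]] by blast
    show "\<exists>z\<in>mats m ?D. cnorm ?M (x \<ominus>\<^bsub>?M\<^esub> z) < e"
      unfolding matrix_algebra_sel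
      by (rule mats_dense[OF operator_subsystemD(8)[OF D] xc e tower_union_dense[OF S gen rmatsD[OF xK]]])
  qed
qed

end

theorem theorem0p6:
  fixes B :: "('a, 'b) cstar_scheme" and S :: "'a set" and n k :: nat
  assumes "n \<ge> 1" and "k \<ge> 1"
    and "unital_cstar_algebra B"
    and "operator_subsystem B S"
    and "unitary_operator_subsystem (B\<lparr>carrier := cstar_generated B S\<rparr>) S"
  shows "complete_CTR n k B S \<longleftrightarrow> complete_TR n k B (cstar_generated B S)"
proof -
  interpret unital_cstar_algebra B by (rule assms(3))
  have gen: "cstar_generated (matrix_algebra m B) (mats m S) = mats m (cstar_generated B S)" for m
    by (rule cstar_generated_mats[OF assms(4)])
  have sub: "mats m S \<subseteq> mats m (cstar_generated B S)" for m
    unfolding mats_eq_rmats by (rule rmats_mono[OF cstar_generated_superset])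
  show ?thesis
    \<comment> \<open>After rewriting with \<open>gen\<close> both properties interpolate into the
      same set and differ only in where the bounds are taken from, so one implication is
      monotonicity in the set of bounds.\<close>
    unfolding complete_CTR_def complete_TR_def CTR_def TR_def gen
    using interpolates_generated[OF assms(1,2,4,5)] interpolates_mono[OF _ sub] by blast
qed

end
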